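(* There is no inclusion among the three sets $\mathbf{Order}_3$, $\mathbf{Stab}_3$ and $\mathbf{Edge}_3$: none of these three sets is contained in another one of them.
   Context: Posets and graphs are finite, graphs simple. Let $\Bbbk$ be a field. The toric ring of a lattice polytope $P\subset\mathbb{R}^d$ is $\Bbbk[P]=\Bbbk[\mathbf{x}^{\mathbf{a}}t:\mathbf{a}\in P\cap\mathbb{Z}^d]$. Order polytope of a poset $\Pi=\{p_1,\dots,p_d\}$: $\mathcal{O}_\Pi=\{x\in\mathbb{R}^d:x_i\ge x_j\text{ if }p_i\prec p_j,\ 0\le x_i\le1\}$. Stable set polytope of a graph $G$ on $[d]$: $\mathrm{Stab}_G=\mathrm{conv}\{\sum_{i\in W}\mathbf{e}_i:W\text{ stable set of }G\}$ (stable set: set of pairwise non-adjacent vertices, including $\emptyset$). Edge polytope of a graph $G$ on $[d]$: $P_G=\mathrm{conv}\{\mathbf{e}_i+\mathbf{e}_j:\{i,j\}\in E(G)\}$. $G$ satisfies the odd cycle condition if any two odd cycles without common vertex are joined by an edge (between a vertex of one and a vertex of the other). Unimodular equivalence of lattice polytopes $P\subset\mathbb{R}^d$, $Q\subset\mathbb{R}^e$: there is an affine isomorphism $\mathrm{aff}(P)\to\mathrm{aff}(Q)$ mapping $\mathrm{aff}(P)\cap\mathbb{Z}^d$ bijectively onto $\mathrm{aff}(Q)\cap\mathbb{Z}^e$ and $P$ onto $Q$ (for full-dimensional polytopes in $\mathbb{R}^d$: $Q=f(P)+\mathbf{v}$ with $f\in\mathrm{GL}_d(\mathbb{Z})$,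 $\mathbf{v}\in\mathbb{Z}^d$). $\mathbf{Order}_n$, $\mathbf{Stab}_n$, $\mathbf{Edge}_n$ denote the sets of unimodular equivalence classes of order polytopes of posets, of stable set polytopes of perfect graphs, and of edge polytopes of graphs satisfying the odd cycle condition, respectively, whose toric rings have (divisor) class group of rank $n$. *)

theory Defs
  imports
    "HOL-Analysis.Analysis"
    "HOL-Analysis.Finite_Function_Topology"
    "HOL-Algebra.Ideal_Product"
    "HOL-Algebra.Generated_Rings"
    "HOL-Algebra.Free_Abelian_Groups"
begin

section \<open>Divisor class groups\<close>

definition height_one_primes :: "('a, 'b) ring_scheme \<Rightarrow> 'a set set" where
  "height_one_primes R =
    {p. primeideal p R \<and> p \<noteq> {\<zero>\<^bsub>R\<^esub>} \<and>
        (\<forall>q. primeideal q R \<and> q \<subseteq> p \<longrightarrow> q = {\<zero>\<^bsub>R\<^esub>} \<or> q = p)}"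

text \<open>The symbolic power, that is, the contraction to \<open>R\<close> of the \<open>n\<close>-th power of the
  maximal ideal of the localization \<open>R\<^sub>p\<close>.\<close>

definition symbolic_power :: "('a, 'b) ring_scheme \<Rightarrow> 'a set \<Rightarrow> nat \<Rightarrow> 'a set" where
  "symbolic_power R p n =
    {x \<in> carrier R. \<exists>s \<in> carrier R - p. s \<otimes>\<^bsub>R\<^esub> x \<in> p [^]\<^bsub>ideals_set R\<^esub> n}"

text \<open>The order of vanishing at a height one prime \<open>p\<close> of a nonzero element of a Noetherian
  normal domain \<open>R\<close>. There \<open>R\<^sub>p\<close> is a discrete valuation ring, and this is the valuation.\<close>

definition vanishing_order :: "('a, 'b) ring_scheme \<Rightarrow> 'a set \<Rightarrow> 'a \<Rightarrow> nat" where
  "vanishing_order R p f = (GREATEST n. f \<in> symbolic_power R p n)"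

definition divisor_group :: "('a, 'b) ring_scheme \<Rightarrow> ('a set \<Rightarrow>\<^sub>0 int) monoid" where
  "divisor_group R = free_Abelian_group (height_one_primes R)"

text \<open>The divisors of the nonzero elements \<open>f / g\<close> of the field of fractions.\<close>

definition principal_divisors :: "('a, 'b) ring_scheme \<Rightarrow> ('a set \<Rightarrow>\<^sub>0 int) set" where
  "principal_divisors R =
    {D \<in> carrier (divisor_group R).
      \<exists>f \<in> carrier R - {\<zero>\<^bsub>R\<^esub>}. \<exists>g \<in> carrier R - {\<zero>\<^bsub>R\<^esub>}. \<forall>p \<in> height_one_primes R.
        Poly_Mapping.lookup D p = int (vanishing_order R p f) - int (vanishing_order R p g)}"

definition class_group :: "('a, 'b) ring_scheme \<Rightarrow> ('a set \<Rightarrow>\<^sub>0 int) set monoid" where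
  "class_group R = divisor_group R Mod principal_divisors R"

definition int_independent :: "('a, 'b) monoid_scheme \<Rightarrow> 'a set \<Rightarrow> bool" where
  "int_independent G S \<longleftrightarrow> finite S \<and> S \<subseteq> carrier G \<and>
    (\<forall>c :: 'a \<Rightarrow> int. (\<Otimes>\<^bsub>G\<^esub>x\<in>S. x [^]\<^bsub>G\<^esub> c x) = \<one>\<^bsub>G\<^esub> \<longrightarrow> (\<forall>x\<in>S. c x = 0))"

text \<open>The (torsion-free) rank of a commutative group.\<close>

definition has_rank :: "('a, 'b) monoid_scheme \<Rightarrow> nat \<Rightarrow> bool" where
  "has_rank G n \<longleftrightarrow> (\<exists>S. int_independent G S \<and> card S = n) \<and>
    (\<forall>S. int_independent G S \<longrightarrow> card S \<le> n)"


section \<open>Lattice polytopes and their toric rings\<close>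

text \<open>Vectors are finitely supported functions, and the space \<open>\<real>\<^sup>d\<close> consists of those supported
  on \<open>{..<d}\<close>; so coordinates, vertices and poset elements are numbered from 0. A polytope
  is paired with the dimension of its ambient space.\<close>

type_synonym vec = "nat \<Rightarrow>\<^sub>0 real"
type_synonym polytope_in = "nat \<times> vec set"

definition real_space :: "nat \<Rightarrow> vec set" where
  "real_space d = {x. Poly_Mapping.keys x \<subseteq> {..<d}}"

definition lattice :: "nat \<Rightarrow> vec set" where
  "lattice d = {x \<in> real_space d. \<forall>i. Poly_Mapping.lookup x i \<in> \<int>}"

abbreviation unit_vec :: "nat \<Rightarrow> vec" where
  "unit_vec i \<equiv> Poly_Mapping.single i 1"

definition lattice_polytope :: "polytope_in \<Rightarrow> bool" where
  "lattice_polytope = (\<lambda>(d, P). \<exists>V. finite V \<and> V \<subseteq> lattice d \<and> P = convex hull V)"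

text \<open>The Laurent polynomial ring over \<open>'k\<close> in the variables indexed by the natural numbers:
  \<open>Poly_Mapping.single a c\<close> is the monomial with exponent \<open>a\<close> and coefficient \<open>c\<close>.\<close>

type_synonym 'k laurent = "(nat \<Rightarrow>\<^sub>0 int) \<Rightarrow>\<^sub>0 'k"

definition laurent_ring :: "'k::field laurent ring" where
  "laurent_ring = \<lparr>carrier = UNIV, mult = (*), one = 1, ring.zero = 0, ring.add = (+)\<rparr>"

text \<open>The variables \<open>0, \<dots>, d - 1\<close> are the coordinates of \<open>\<^bold>x\<close>, and the variable \<open>d\<close> is \<open>t\<close>.\<close>

definition toric_monomials :: "polytope_in \<Rightarrow> 'k::field laurent set" where
  "toric_monomials = (\<lambda>(d, P).
    {Poly_Mapping.single (a + Poly_Mapping.single d 1) 1 | a.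
      Poly_Mapping.map real_of_int a \<in> P})"

definition toric_ring :: "'k::field itself \<Rightarrow> polytope_in \<Rightarrow> 'k laurent ring" where
  "toric_ring _ P = laurent_ring
    \<lparr>carrier := generate_ring laurent_ring
      (range (Poly_Mapping.single 0) \<union> toric_monomials P)\<rparr>"

definition affine_on :: "vec set \<Rightarrow> (vec \<Rightarrow> vec) \<Rightarrow> bool" where
  "affine_on A \<phi> \<longleftrightarrow> (\<forall>x\<in>A. \<forall>y\<in>A. \<forall>u v. u + v = 1 \<longrightarrow>
    \<phi> (u *\<^sub>R x + v *\<^sub>R y) = u *\<^sub>R \<phi> x + v *\<^sub>R \<phi> y)"

definition unimodularly_equivalent :: "polytope_in \<Rightarrow> polytope_in \<Rightarrow> bool" where
  "unimodularly_equivalent = (\<lambda>(d, P) (e, Q). \<exists>\<phi>.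
    affine_on (affine hull P) \<phi> \<and>
    bij_betw \<phi> (affine hull P) (affine hull Q) \<and>
    bij_betw \<phi> (affine hull P \<inter> lattice d) (affine hull Q \<inter> lattice e) \<and>
    \<phi> ` P = Q)"

definition unimodular_class :: "polytope_in \<Rightarrow> polytope_in set" where
  "unimodular_class P = {Q. lattice_polytope Q \<and> unimodularly_equivalent P Q}"


section \<open>Order polytopes\<close>

definition order_polytope :: "nat \<Rightarrow> (nat \<times> nat) set \<Rightarrow> polytope_in" where
  "order_polytope d r = (d, {x \<in> real_space d.
    (\<forall>i<d. \<forall>j<d. (i, j) \<in> r \<and> i \<noteq> j \<longrightarrow> Poly_Mapping.lookup x i \<ge> Poly_Mapping.lookup x j) \<and>
    (\<forall>i<d. 0 \<le> Poly_Mapping.lookup x i \<and> Poly_Mapping.lookup x i \<le> 1)})"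


section \<open>Stable set polytopes of perfect graphs\<close>

definition simple_graph :: "nat \<Rightarrow> nat set set \<Rightarrow> bool" where
  "simple_graph d E \<longleftrightarrow> (\<forall>e\<in>E. e \<subseteq> {..<d} \<and> card e = 2)"

definition stable_set :: "nat \<Rightarrow> nat set set \<Rightarrow> nat set \<Rightarrow> bool" where
  "stable_set d E W \<longleftrightarrow> W \<subseteq> {..<d} \<and> (\<forall>u\<in>W. \<forall>v\<in>W. {u, v} \<notin> E)"

definition stable_set_polytope :: "nat \<Rightarrow> nat set set \<Rightarrow> polytope_in" where
  "stable_set_polytope d E = (d, convex hull {\<Sum>i\<in>W. unit_vec i | W. stable_set d E W})"

text \<open>The clique number and the chromatic number of the subgraph induced on \<open>W\<close>.\<close>

definition clique_number :: "nat set set \<Rightarrow> nat set \<Rightarrow> nat" where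
  "clique_number E W =
    Max {card C | C. C \<subseteq> W \<and> (\<forall>u\<in>C. \<forall>v\<in>C. u \<noteq> v \<longrightarrow> {u, v} \<in> E)}"

definition chromatic_number :: "nat set set \<Rightarrow> nat set \<Rightarrow> nat" where
  "chromatic_number E W =
    (LEAST k. \<exists>f :: nat \<Rightarrow> nat. f ` W \<subseteq> {..<k} \<and>
      (\<forall>u\<in>W. \<forall>v\<in>W. {u, v} \<in> E \<longrightarrow> f u \<noteq> f v))"

definition perfect_graph :: "nat \<Rightarrow> nat set set \<Rightarrow> bool" where
  "perfect_graph d E \<longleftrightarrow> simple_graph d E \<and>
    (\<forall>W \<subseteq> {..<d}. chromatic_number E W = clique_number E W)"


section \<open>Edge polytopes and the odd cycle condition\<close>

definition edge_polytope :: "nat \<Rightarrow> nat set set \<Rightarrow> polytope_in" where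
  "edge_polytope d E = (d, convex hull {unit_vec i + unit_vec j | i j. {i, j} \<in> E})"

definition graph_cycle :: "nat set set \<Rightarrow> nat list \<Rightarrow> bool" where
  "graph_cycle E c \<longleftrightarrow> length c \<ge> 3 \<and> distinct c \<and>
    (\<forall>i<length c. {c ! i, c ! (Suc i mod length c)} \<in> E)"

definition odd_cycle_condition :: "nat set set \<Rightarrow> bool" where
  "odd_cycle_condition E \<longleftrightarrow>
    (\<forall>c c'. graph_cycle E c \<and> odd (length c) \<and> graph_cycle E c' \<and> odd (length c') \<and>
      set c \<inter> set c' = {} \<longrightarrow> (\<exists>u\<in>set c. \<exists>v\<in>set c'. {u, v} \<in> E))"


section \<open>The sets of unimodular equivalence classes\<close>

definition Order_classes :: "'k::field itself \<Rightarrow> nat \<Rightarrow> polytope_in set set" where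
  "Order_classes k n = {unimodular_class (order_polytope d r) | d r.
    partial_order_on {..<d} r \<and>
    has_rank (class_group (toric_ring k (order_polytope d r))) n}"

definition Stab_classes :: "'k::field itself \<Rightarrow> nat \<Rightarrow> polytope_in set set" where
  "Stab_classes k n = {unimodular_class (stable_set_polytope d E) | d E.
    perfect_graph d E \<and>
    has_rank (class_group (toric_ring k (stable_set_polytope d E))) n}"

definition Edge_classes :: "'k::field itself \<Rightarrow> nat \<Rightarrow> polytope_in set set" where
  "Edge_classes k n = {unimodular_class (edge_polytope d E) | d E.
    simple_graph d E \<and> odd_cycle_condition E \<and>
    has_rank (class_group (toric_ring k (edge_polytope d E))) n}"

end

theory Submission
  imports Defs "HOL-Computational_Algebra.Factorial_Ring"
begin

text \<open>Each of the three families contains a polytope of dimension 6 or 5 whose toric ring has class group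
  of rank 3 and which is equivalent to no member of the other two families: the order polytope of
  \<open>stack\<close>, the stable set polytope of the 3-sun, and the edge polytope of the octahedron.

  The toric ring of a normal polytope is cut out of a Laurent polynomial ring, which is factorial, by
  the facet functionals. Its height one primes are the facet primes and the contractions of the
  principal primes of the Laurent ring, so the class group is the cokernel of the matrix of facet
  functionals, free of rank (number of facets) - (dimension) - 1.

  The vertices of all these polytopes are 0/1 vectors and are all the lattice points, and a unimodular equivalence
  preserves the relation \<open>a + b = c + d\<close> between lattice points. The families are told apart by
  configurations of lattice points defined by this relation alone.\<close>

section \<open>Laurent polynomials\<close>

text \<open>The Laurent ring has variables indexed by all naturals. Its factoriality is obtained by
  adding one variable at a time and showing that a prime in finitely many variables stays prime in
  all of them. The octahedron forces a further generality: its edge polytope is not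
  full-dimensional, so the exponents fill only the lattice where the coordinate sum is twice the
  degree. Lattices are therefore common zeros of additive functionals, and width arguments move
  divisibility between such a lattice and all exponents. The witnesses fit the rank formula: the
  Hasse diagram of \<open>stack\<close> with bounds has 10 covers, the 3-sun has 6 coordinate facets
  and 4 maximal cliques, the octahedron has 6 coordinate facets and 3 part inequalities in dimension
  5. The configurations are a cube of four pairs with equal sum, too large for an edge polytope; a
  square of neighbours available at every point, impossible at the empty stable set; and
  comparabilities forced by unique sums in a lattice of down-sets.\<close>

abbreviation xpow :: "(nat \<Rightarrow>\<^sub>0 int) \<Rightarrow> 'k::field laurent" where
  "xpow a \<equiv> Poly_Mapping.single a 1"

lemma sum_singles: "f = (\<Sum>a\<in>Poly_Mapping.keys f. Poly_Mapping.single a (Poly_Mapping.lookup f a))"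
  by (rule poly_mapping_eqI)
    (simp add: lookup_sum lookup_single when_def sum.delta in_keys_iff)

lemma lookup_single_times:
  fixes g :: "'k::field laurent"
  shows "Poly_Mapping.lookup (Poly_Mapping.single a c * g) b = c * Poly_Mapping.lookup g (b - a)"
proof -
  have eq: "(a + d = b) = (d = b - a)" for d
    by (auto simp: algebra_simps)
  have "Poly_Mapping.single a c * g
      = (\<Sum>d\<in>Poly_Mapping.keys g. Poly_Mapping.single (a + d) (c * Poly_Mapping.lookup g d))"
    by (subst sum_singles[of g]) (simp add: sum_distrib_left mult_single)
  then show ?thesis
    by (simp add: lookup_sum lookup_single when_def eq sum.delta in_keys_iff)
qed

lemma monom_mult: "xpow a * xpow b = (xpow (a + b) :: 'k::field laurent)"
  by (simp add: mult_single)

lemma monom_neg_mult [simp]: "xpow (- a) * xpow a = (1 :: 'k::field laurent)"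
  by (simp add: mult_single)

lemma monom_mult_neg [simp]: "xpow a * xpow (- a) = (1 :: 'k::field laurent)"
  by (simp add: mult_single)

lemma monom_nonzero [simp]: "xpow a \<noteq> (0 :: 'k::field laurent)"
  using lookup_single_eq[of a "1 :: 'k"] by force

lemma monom_unit [simp]: "xpow a dvd (1 :: 'k::field laurent)"
  using dvd_triv_left[of "xpow a" "xpow (- a)"] by simp

lemma monom_cancel [simp]: "xpow (- a) * (xpow a * f) = (f :: 'k::field laurent)"
  "xpow a * (xpow (- a) * f) = (f :: 'k::field laurent)"
  by (simp_all add: mult.assoc[symmetric])

lemma dvd_monom_mult_iff [simp]: "q dvd xpow a * f \<longleftrightarrow> q dvd (f :: 'k::field laurent)"
proof
  assume "q dvd xpow a * f"
  then have "q dvd xpow (- a) * (xpow a * f)" by (rule dvd_mult)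
  then show "q dvd f" by simp
qed (rule dvd_mult)

lemma monom_mult_dvd_iff [simp]: "xpow a * q dvd f \<longleftrightarrow> q dvd (f :: 'k::field laurent)"
proof
  assume "q dvd f"
  then have "xpow a * q dvd xpow a * (xpow (- a) * f)"
    by (intro mult_dvd_mono) simp_all
  then show "xpow a * q dvd f" by simp
qed (rule dvd_mult_right)

text \<open>The monoid algebra when \<open>A\<close> is a submonoid. \<open>A\<close> is left
  arbitrary so that the same notation covers monomial ideals and elements with a prescribed finite
  support.\<close>

definition kspan :: "(nat \<Rightarrow>\<^sub>0 int) set \<Rightarrow> 'k::field laurent set" where
  "kspan A = {f. Poly_Mapping.keys f \<subseteq> A}"

lemma kspan_0 [simp]: "0 \<in> kspan A"
  by (simp add: kspan_def)

lemma kspan_add: "f \<in> kspan A \<Longrightarrow> g \<in> kspan A \<Longrightarrow> f + g \<in> kspan A"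
  using keys_add[of f g] by (auto simp: kspan_def)

lemma kspan_uminus: "f \<in> kspan A \<Longrightarrow> - f \<in> kspan A"
  by (auto simp: kspan_def in_keys_iff)

lemma kspan_diff: "f \<in> kspan A \<Longrightarrow> g \<in> kspan A \<Longrightarrow> f - g \<in> kspan A"
  using kspan_add[of f A "- g"] kspan_uminus[of g A] by simp

lemma kspan_single: "a \<in> A \<Longrightarrow> Poly_Mapping.single a c \<in> kspan A"
  by (simp add: kspan_def)

lemma kspan_single_iff: "c \<noteq> 0 \<Longrightarrow> Poly_Mapping.single a c \<in> kspan A \<longleftrightarrow> a \<in> A"
  by (simp add: kspan_def)

lemma kspan_mono: "A \<subseteq> B \<Longrightarrow> f \<in> kspan A \<Longrightarrow> f \<in> kspan B"
  by (auto simp: kspan_def)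

lemma kspan_mult:
  assumes "f \<in> kspan A" "g \<in> kspan B" "\<And>a b. a \<in> A \<Longrightarrow> b \<in> B \<Longrightarrow> a + b \<in> C"
  shows "f * g \<in> kspan C"
  using assms keys_mult[of f g] by (fastforce simp: kspan_def)

subsection \<open>Homogeneous components and valuations\<close>

definition component :: "('e \<Rightarrow> int) \<Rightarrow> int \<Rightarrow> ('e \<Rightarrow>\<^sub>0 'k::comm_monoid_add) \<Rightarrow> ('e \<Rightarrow>\<^sub>0 'k)" where
  "component \<sigma> j f = (\<Sum>a | a \<in> Poly_Mapping.keys f \<and> \<sigma> a = j. Poly_Mapping.single a (Poly_Mapping.lookup f a))"

lemma lookup_component:
  "Poly_Mapping.lookup (component \<sigma> j f) a = (if \<sigma> a = j then Poly_Mapping.lookup f a else 0)"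
proof -
  have fin: "finite {a. a \<in> Poly_Mapping.keys f \<and> \<sigma> a = j}"
    by (rule finite_subset[OF _ finite_keys[of f]]) auto
  show ?thesis
    by (simp add: component_def lookup_sum lookup_single when_def sum.delta[OF fin] in_keys_iff)
qed

lemma keys_component: "Poly_Mapping.keys (component \<sigma> j f) = {a \<in> Poly_Mapping.keys f. \<sigma> a = j}"
  by (auto simp: in_keys_iff lookup_component split: if_splits)

lemma component_add: "component \<sigma> j (f + g) = component \<sigma> j f + component \<sigma> j g"
  by (rule poly_mapping_eqI) (simp add: lookup_component lookup_add)

lemma component_0 [simp]: "component \<sigma> j 0 = 0"
  by (rule poly_mapping_eqI) (simp add: lookup_component)

lemma component_diff:
  fixes f g :: "'e \<Rightarrow>\<^sub>0 'k::ab_group_add"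
  shows "component \<sigma> j (f - g) = component \<sigma> j f - component \<sigma> j g"
  by (rule poly_mapping_eqI) (simp add: lookup_component lookup_minus)

lemma component_sum: "component \<sigma> j (sum f I) = (\<Sum>i\<in>I. component \<sigma> j (f i))"
  by (induction I rule: infinite_finite_induct) (auto simp: component_add)

lemma component_eq_0_iff: "component \<sigma> j f = 0 \<longleftrightarrow> j \<notin> \<sigma> ` Poly_Mapping.keys f"
proof -
  have "component \<sigma> j f = 0 \<longleftrightarrow> Poly_Mapping.keys (component \<sigma> j f) = {}"
    by (metis keys_zero equals0D in_keys_iff lookup_zero poly_mapping_eqI)
  then show ?thesis
    by (auto simp: keys_component)
qed

lemma sum_components: "f = (\<Sum>j\<in>\<sigma> ` Poly_Mapping.keys f. component \<sigma> j f)"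
proof (rule poly_mapping_eqI)
  fix a
  show "Poly_Mapping.lookup f a = Poly_Mapping.lookup (\<Sum>j\<in>\<sigma> ` Poly_Mapping.keys f. component \<sigma> j f) a"
    by (cases "\<sigma> a \<in> \<sigma> ` Poly_Mapping.keys f")
      (auto simp: lookup_sum lookup_component in_keys_iff image_iff sum.delta')
qed

lemma component_single_times:
  fixes g :: "'k::field laurent"
  assumes "Modules.additive \<sigma>"
  shows "component \<sigma> k (Poly_Mapping.single a c * g) = Poly_Mapping.single a c * component \<sigma> (k - \<sigma> a) g"
  by (rule poly_mapping_eqI)
    (auto simp: lookup_component lookup_single_times additive.diff[OF assms])

lemma component_homogeneous_mult:
  fixes f g :: "'k::field laurent"
  assumes "Modules.additive \<sigma>" "\<And>a. a \<in> Poly_Mapping.keys f \<Longrightarrow> \<sigma> a = i"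
  shows "component \<sigma> k (f * g) = f * component \<sigma> (k - i) g"
proof -
  have "component \<sigma> k (f * g)
      = component \<sigma> k ((\<Sum>a\<in>Poly_Mapping.keys f. Poly_Mapping.single a (Poly_Mapping.lookup f a)) * g)"
    by (rule arg_cong[OF sum_singles])
  also have "\<dots> = (\<Sum>a\<in>Poly_Mapping.keys f. component \<sigma> k (Poly_Mapping.single a (Poly_Mapping.lookup f a) * g))"
    by (simp add: sum_distrib_right component_sum)
  also have "\<dots> = (\<Sum>a\<in>Poly_Mapping.keys f. Poly_Mapping.single a (Poly_Mapping.lookup f a)) * component \<sigma> (k - i) g"
    by (simp add: sum_distrib_right component_single_times[OF assms(1)] assms(2))
  finally show ?thesis
    unfolding sum_singles[of f, symmetric] .
qed

lemma component_mult:
  fixes f g :: "'k::field laurent"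
  assumes "Modules.additive \<sigma>"
  shows "component \<sigma> k (f * g)
    = (\<Sum>i\<in>\<sigma> ` Poly_Mapping.keys f. component \<sigma> i f * component \<sigma> (k - i) g)"
proof -
  have "component \<sigma> k (f * g)
      = component \<sigma> k ((\<Sum>i\<in>\<sigma> ` Poly_Mapping.keys f. component \<sigma> i f) * g)"
    by (rule arg_cong[OF sum_components])
  also have "\<dots> = (\<Sum>i\<in>\<sigma> ` Poly_Mapping.keys f. component \<sigma> k (component \<sigma> i f * g))"
    by (simp add: sum_distrib_right component_sum)
  also have "\<dots> = (\<Sum>i\<in>\<sigma> ` Poly_Mapping.keys f. component \<sigma> i f * component \<sigma> (k - i) g)"
    by (intro sum.cong refl component_homogeneous_mult assms) (simp add: keys_component)
  finally show ?thesis .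
qed

text \<open>For additive \<sigma> this is a monomial valuation; for a facet functional it is the
  valuation of the facet prime. At 0 it is the minimum of an empty set, hence the nonzero hypotheses
  below.\<close>

definition val :: "('e \<Rightarrow> int) \<Rightarrow> ('e \<Rightarrow>\<^sub>0 'k::zero) \<Rightarrow> int" where
  "val \<sigma> f = Min (\<sigma> ` Poly_Mapping.keys f)"

lemma ex_key: "f \<noteq> 0 \<Longrightarrow> \<exists>a. a \<in> Poly_Mapping.keys f"
  by (metis in_keys_iff lookup_zero poly_mapping_eqI)

lemma val_le: "a \<in> Poly_Mapping.keys f \<Longrightarrow> val \<sigma> f \<le> \<sigma> a"
  by (simp add: val_def)

lemma val_attained: "f \<noteq> 0 \<Longrightarrow> \<exists>a\<in>Poly_Mapping.keys f. \<sigma> a = val \<sigma> f"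
  using Min_in[of "\<sigma> ` Poly_Mapping.keys f"] ex_key[of f] by (fastforce simp: val_def)

lemma val_ge_iff: "f \<noteq> 0 \<Longrightarrow> n \<le> val \<sigma> f \<longleftrightarrow> (\<forall>a\<in>Poly_Mapping.keys f. n \<le> \<sigma> a)"
  using ex_key[of f] by (auto simp: val_def)

lemma val_single [simp]: "c \<noteq> 0 \<Longrightarrow> val \<sigma> (Poly_Mapping.single a c) = \<sigma> a"
  by (simp add: val_def)

lemma val_1: "Modules.additive \<sigma> \<Longrightarrow> val \<sigma> (1 :: 'k::field laurent) = 0"
  by (simp add: val_def additive.zero)

text \<open>The component of lowest degree of the product is the product of the lowest components,
  which is nonzero because there are no zero divisors.\<close>

lemma val_mult:
  fixes f g :: "'k::field laurent"
  assumes \<sigma>: "Modules.additive \<sigma>" and "f \<noteq> 0" "g \<noteq> 0"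
  shows "val \<sigma> (f * g) = val \<sigma> f + val \<sigma> g"
proof (rule antisym)
  let ?k = "val \<sigma> f + val \<sigma> g"
  have f: "val \<sigma> f \<in> \<sigma> ` Poly_Mapping.keys f" and g: "val \<sigma> g \<in> \<sigma> ` Poly_Mapping.keys g"
    using val_attained[OF assms(2), of \<sigma>] val_attained[OF assms(3), of \<sigma>] by force+
  have "component \<sigma> i f * component \<sigma> (?k - i) g = 0"
    if "i \<in> \<sigma> ` Poly_Mapping.keys f - {val \<sigma> f}" for i
  proof -
    have "i > val \<sigma> f"
      using that val_le[of _ f \<sigma>] by force
    then have "?k - i \<notin> \<sigma> ` Poly_Mapping.keys g"
      using val_le[of _ g \<sigma>] by force
    then have "component \<sigma> (?k - i) g = 0"
      by (simp add: component_eq_0_iff)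
    then show ?thesis by simp
  qed
  then have "component \<sigma> ?k (f * g) = component \<sigma> (val \<sigma> f) f * component \<sigma> (val \<sigma> g) g"
    unfolding component_mult[OF \<sigma>] by (subst sum.remove[OF _ f]) (simp_all add: sum.neutral)
  also have "\<dots> \<noteq> 0"
    using f g by (simp add: component_eq_0_iff)
  finally obtain a where "a \<in> Poly_Mapping.keys (f * g)" "\<sigma> a = ?k"
    by (auto simp: component_eq_0_iff)
  then show "val \<sigma> (f * g) \<le> ?k"
    by (metis val_le)
  have "\<sigma> c \<ge> ?k" if "c \<in> Poly_Mapping.keys (f * g)" for c
  proof -
    obtain a b where "a \<in> Poly_Mapping.keys f" "b \<in> Poly_Mapping.keys g" "c = a + b"
      using keys_mult[of f g] \<open>c \<in> _\<close> by blast
    then show ?thesis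
      by (simp add: additive.add[OF \<sigma>] add_mono val_le)
  qed
  moreover have "f * g \<noteq> 0"
    using assms by simp
  ultimately show "?k \<le> val \<sigma> (f * g)"
    by (simp add: val_ge_iff)
qed

section \<open>Widths of Newton polytopes and saturation of sublattices\<close>

lemma additive_uminus: "Modules.additive \<sigma> \<Longrightarrow> Modules.additive (\<lambda>a. - \<sigma> a)"
  by (simp add: Modules.additive_def)

text \<open>Length of the projection of the Newton polytope along \<sigma>. It replaces the degree,
  which monomial units would shift: for additive \<sigma> it adds over products and vanishes on
  units.\<close>

definition width :: "('e \<Rightarrow> int) \<Rightarrow> ('e \<Rightarrow>\<^sub>0 'k::zero) \<Rightarrow> int" where
  "width \<sigma> f = - val (\<lambda>a. - \<sigma> a) f - val \<sigma> f"

lemma width_ge: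
  assumes "a \<in> Poly_Mapping.keys f" "b \<in> Poly_Mapping.keys f"
  shows "\<sigma> a - \<sigma> b \<le> width \<sigma> f"
  using val_le[OF assms(1), of "\<lambda>a. - \<sigma> a"] val_le[OF assms(2), of \<sigma>] by (simp add: width_def)

lemma width_nonneg: "f \<noteq> 0 \<Longrightarrow> 0 \<le> width \<sigma> f"
  using ex_key[of f] width_ge[of _ f _ \<sigma>] by force

lemma width_mult:
  fixes f g :: "'k::field laurent"
  assumes "Modules.additive \<sigma>" "f \<noteq> 0" "g \<noteq> 0"
  shows "width \<sigma> (f * g) = width \<sigma> f + width \<sigma> g"
  using assms by (simp add: width_def val_mult additive_uminus)

lemma width_1: "Modules.additive \<sigma> \<Longrightarrow> width \<sigma> (1 :: 'k::field laurent) = 0"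
  by (simp add: width_def val_1 additive_uminus)

lemma width_single: "c \<noteq> 0 \<Longrightarrow> width \<sigma> (Poly_Mapping.single a c) = 0"
  by (simp add: width_def)

lemma width_0D: "width \<sigma> f = 0 \<Longrightarrow> a \<in> Poly_Mapping.keys f \<Longrightarrow> b \<in> Poly_Mapping.keys f \<Longrightarrow> \<sigma> a = \<sigma> b"
  using width_ge[of a f b \<sigma>] width_ge[of b f a \<sigma>] by simp

lemma width_le:
  assumes "f \<noteq> 0" "\<And>a. a \<in> Poly_Mapping.keys f \<Longrightarrow> lo \<le> \<sigma> a \<and> \<sigma> a \<le> hi"
  shows "width \<sigma> f \<le> hi - lo"
proof -
  have "- hi \<le> val (\<lambda>a. - \<sigma> a) f" "lo \<le> val \<sigma> f"
    using assms by (auto simp: val_ge_iff)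
  then show ?thesis by (simp add: width_def)
qed

lemma width_unit:
  fixes u :: "'k::field laurent"
  assumes "Modules.additive \<sigma>" "u dvd 1"
  shows "width \<sigma> u = 0"
proof -
  obtain v where v: "1 = u * v" using assms(2) by (auto simp: dvd_def)
  then have "u \<noteq> 0" "v \<noteq> 0" by auto
  then have "width \<sigma> u + width \<sigma> v = 0"
    using width_mult[OF assms(1), of u v] v width_1[OF assms(1), where 'k='k] by simp
  then show ?thesis
    using width_nonneg[OF \<open>u \<noteq> 0\<close>, of \<sigma>] width_nonneg[OF \<open>v \<noteq> 0\<close>, of \<sigma>] by linarith
qed

text \<open>A sublattice cut out by additive functionals is saturated; hence divisibility in its
  group algebra agrees with divisibility among all Laurent polynomials.\<close>

definition sublattice :: "((nat \<Rightarrow>\<^sub>0 int) \<Rightarrow> int) set \<Rightarrow> (nat \<Rightarrow>\<^sub>0 int) set" where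
  "sublattice T = {a. \<forall>\<tau>\<in>T. \<tau> a = 0}"

lemma sublattice_0: "\<forall>\<tau>\<in>T. Modules.additive \<tau> \<Longrightarrow> 0 \<in> sublattice T"
  by (simp add: sublattice_def additive.zero)

lemma sublattice_add:
  "\<forall>\<tau>\<in>T. Modules.additive \<tau> \<Longrightarrow> a \<in> sublattice T \<Longrightarrow> b \<in> sublattice T \<Longrightarrow> a + b \<in> sublattice T"
  by (auto simp: sublattice_def additive.add)

lemma sublattice_minus:
  "\<forall>\<tau>\<in>T. Modules.additive \<tau> \<Longrightarrow> a \<in> sublattice T \<Longrightarrow> - a \<in> sublattice T"
  by (simp add: sublattice_def additive.minus)

lemma sublattice_diff:
  "\<forall>\<tau>\<in>T. Modules.additive \<tau> \<Longrightarrow> a \<in> sublattice T \<Longrightarrow> b \<in> sublattice T \<Longrightarrow> a - b \<in> sublattice T"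
  by (auto simp: sublattice_def additive.diff)

lemma kspan_sublatticeI:
  assumes "a \<in> Poly_Mapping.keys f" "a \<in> sublattice T" "\<And>\<tau>. \<tau> \<in> T \<Longrightarrow> width \<tau> f = 0"
  shows "f \<in> kspan (sublattice T)"
proof -
  have "\<tau> c = 0" if "c \<in> Poly_Mapping.keys f" "\<tau> \<in> T" for c \<tau>
    using width_0D[OF assms(3)[OF that(2)] that(1) assms(1)] assms(2) that(2)
    by (simp add: sublattice_def)
  then show ?thesis
    by (auto simp: kspan_def sublattice_def)
qed

lemma width_kspan_sublattice:
  assumes "f \<in> kspan (sublattice T)" "f \<noteq> 0" "\<tau> \<in> T"
  shows "width \<tau> f = 0"
proof -
  have "width \<tau> f \<le> 0 - 0"
    using assms by (intro width_le) (force simp: kspan_def sublattice_def)+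
  then show ?thesis using width_nonneg[OF assms(2), of \<tau>] by simp
qed

text \<open>Widths add, so the quotient has width zero along all of \<open>T\<close>; a key of the
  product minus a key of \<open>f\<close> supplies one exponent in the sublattice, and width zero
  brings in the others.\<close>

lemma kspan_quotient:
  fixes f g :: "'k::field laurent"
  assumes T: "\<forall>\<tau>\<in>T. Modules.additive \<tau>"
    and "f * g \<in> kspan (sublattice T)" "f \<in> kspan (sublattice T)" "f \<noteq> 0"
  shows "g \<in> kspan (sublattice T)"
proof (cases "g = 0")
  case False
  obtain b where b: "b \<in> Poly_Mapping.keys (f * g)"
    using ex_key[of "f * g"] \<open>f \<noteq> 0\<close> False by auto
  then obtain a c where ac: "a \<in> Poly_Mapping.keys f" "c \<in> Poly_Mapping.keys g" "b = a + c"
    using keys_mult[of f g] by blast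
  have "b \<in> sublattice T" "a \<in> sublattice T"
    using assms b ac by (auto simp: kspan_def)
  then have "c \<in> sublattice T"
    using sublattice_diff[OF T, of b a] ac by simp
  moreover have "width \<tau> g = 0" if "\<tau> \<in> T" for \<tau>
    using width_kspan_sublattice[OF assms(2) _ that] width_kspan_sublattice[OF assms(3) _ that]
      width_mult[OF bspec[OF T that], of f g] False \<open>f \<noteq> 0\<close> by simp
  ultimately show ?thesis
    using ac(2) by (intro kspan_sublatticeI) auto
qed simp

text \<open>A factor lies in the group algebra only up to a monomial. Nonnegative widths with sum
  zero are zero, and translating by a key of \<open>f\<close> puts the exponent 0 into the
  support.\<close>

lemma kspan_factor:
  fixes f g :: "'k::field laurent"
  assumes T: "\<forall>\<tau>\<in>T. Modules.additive \<tau>"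
    and fg: "f * g \<in> kspan (sublattice T)" "f * g \<noteq> 0"
  obtains a where "xpow a * f \<in> kspan (sublattice T)" "xpow (- a) * g \<in> kspan (sublattice T)"
proof -
  have nz: "f \<noteq> 0" "g \<noteq> 0" using fg by auto
  obtain b where b: "b \<in> Poly_Mapping.keys f"
    using ex_key[OF nz(1)] by auto
  have "Poly_Mapping.lookup (xpow (- b) * f) 0 \<noteq> 0"
    using b by (simp add: lookup_single_times in_keys_iff)
  then have k: "0 \<in> Poly_Mapping.keys (xpow (- b) * f)"
    by (simp add: in_keys_iff)
  have w: "width \<tau> (xpow (- b) * f) = 0" if "\<tau> \<in> T" for \<tau>
    using width_kspan_sublattice[OF fg that] width_mult[OF bspec[OF T that] nz]
      width_nonneg[OF nz(1), of \<tau>] width_nonneg[OF nz(2), of \<tau>]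
      width_mult[OF bspec[OF T that] _ nz(1), of "xpow (- b)"] by (simp add: width_single)
  have 1: "xpow (- b) * f \<in> kspan (sublattice T)"
    by (rule kspan_sublatticeI[OF k sublattice_0[OF T] w])
  have "(xpow (- b) * f) * (xpow b * g) = xpow (- b) * (xpow b * (f * g))"
    by (simp only: mult_ac)
  also have "\<dots> = f * g" by simp
  finally have "(xpow (- b) * f) * (xpow b * g) \<in> kspan (sublattice T)"
    using fg(1) by (simp only:)
  then have "xpow b * g \<in> kspan (sublattice T)"
    using kspan_quotient[OF T _ 1, of "xpow b * g"] nz by simp
  then show ?thesis
    using that[of "- b"] 1 by simp
qed

section \<open>Unique factorization of Laurent polynomials\<close>

abbreviation coord :: "nat \<Rightarrow> (nat \<Rightarrow>\<^sub>0 int) \<Rightarrow> int" where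
  "coord i \<equiv> \<lambda>a. Poly_Mapping.lookup a i"

text \<open>The exponents in the first \<open>m\<close> variables, written as a
  \<open>sublattice\<close> so that the saturation lemmas apply to the subring.\<close>

abbreviation first_coords :: "nat \<Rightarrow> (nat \<Rightarrow>\<^sub>0 int) set" where
  "first_coords m \<equiv> sublattice (coord ` {m..})"

abbreviation vpow :: "nat \<Rightarrow> int \<Rightarrow> 'k::field laurent" where
  "vpow m j \<equiv> xpow (Poly_Mapping.single m j)"

lemma additive_coord [simp]: "Modules.additive (coord i)"
  by (simp add: Modules.additive_def lookup_add)

lemma additive_coords: "\<forall>\<tau> \<in> coord ` {m..}. Modules.additive \<tau>"
  by auto

lemma first_coords_iff: "a \<in> first_coords m \<longleftrightarrow> (\<forall>i\<ge>m. Poly_Mapping.lookup a i = 0)"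
  by (auto simp: sublattice_def)

lemma first_coords_mono: "m \<le> n \<Longrightarrow> first_coords m \<subseteq> first_coords n"
  by (auto simp: first_coords_iff)

lemma kspan_first_coords_mult:
  "f \<in> kspan (first_coords m) \<Longrightarrow> g \<in> kspan (first_coords m) \<Longrightarrow> f * g \<in> kspan (first_coords m)"
  by (erule kspan_mult) (auto simp: first_coords_iff lookup_add)

lemma vpow_kspan: "i < m \<Longrightarrow> vpow i j \<in> kspan (first_coords m)"
  by (rule kspan_single) (simp add: first_coords_iff lookup_single)

lemma vpow_mult: "vpow m i * vpow m j = (vpow m (i + j) :: 'k::field laurent)"
  by (simp add: mult_single single_add)

lemma one_kspan_first_coords: "1 \<in> kspan (first_coords m)"
  by (simp add: kspan_def first_coords_iff)

lemma ex_first_coords: "\<exists>n\<ge>m. (f :: 'k::field laurent) \<in> kspan (first_coords n)"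
proof -
  let ?I = "insert m (\<Union>a\<in>Poly_Mapping.keys f. Poly_Mapping.keys a)"
  have "Poly_Mapping.lookup a i = 0" if a: "a \<in> Poly_Mapping.keys f" and i: "i \<ge> Suc (Max ?I)" for a i
  proof (rule ccontr)
    assume "Poly_Mapping.lookup a i \<noteq> 0"
    then have "i \<in> ?I"
      using a by (auto simp: in_keys_iff)
    then have "i \<le> Max ?I"
      by (intro Max_ge) auto
    then show False using i by simp
  qed
  then have "Poly_Mapping.keys f \<subseteq> first_coords (Suc (Max ?I))"
    by (auto simp: first_coords_iff)
  moreover have "m \<le> Suc (Max ?I)"
    by (meson Max_ge Suc_leD finite.insertI finite_UN finite_keys insertI1 le_SucI)
  ultimately show ?thesis
    by (auto simp: kspan_def)
qed

lemma component_descend: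
  assumes "f \<in> kspan (first_coords (Suc m))"
  shows "vpow m (- j) * component (coord m) j f \<in> kspan (first_coords m)"
proof -
  have 1: "component (coord m) j f \<in> kspan {a \<in> first_coords (Suc m). Poly_Mapping.lookup a m = j}"
    using assms by (auto simp: kspan_def keys_component)
  have 2: "vpow m (- j) \<in> kspan {Poly_Mapping.single m (- j)}"
    by (simp add: kspan_def)
  show ?thesis
  proof (rule kspan_mult[OF 2 1])
    fix a b assume "a \<in> {Poly_Mapping.single m (- j)}"
      "b \<in> {a \<in> first_coords (Suc m). Poly_Mapping.lookup a m = j}"
    then have "Poly_Mapping.lookup (a + b) i = 0" if "m \<le> i" for i
      using that by (cases "i = m") (auto simp: first_coords_iff lookup_add lookup_single)
    then show "a + b \<in> first_coords m"
      by (simp add: first_coords_iff)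
  qed
qed

lemma dvd_components_iff:
  fixes q f :: "'k::field laurent"
  assumes "q \<in> kspan (first_coords m)"
  shows "q dvd f \<longleftrightarrow> (\<forall>j. q dvd component (coord m) j f)"
proof
  assume "q dvd f"
  then obtain h where h: "f = q * h" by auto
  have "component (coord m) j f = q * component (coord m) (j - 0) h" for j
    unfolding h using assms by (intro component_homogeneous_mult) (auto simp: kspan_def first_coords_iff)
  then show "\<forall>j. q dvd component (coord m) j f" by auto
next
  assume "\<forall>j. q dvd component (coord m) j f"
  then show "q dvd f"
    by (subst sum_components[of f "coord m"]) (auto intro: dvd_sum)
qed

text \<open>Divisibility refers to the full Laurent ring, the two factors only to the first
  \<open>m\<close> variables. By saturation this is primality in the smaller ring.\<close>

definition prime_on :: "nat \<Rightarrow> 'k::field laurent \<Rightarrow> bool" where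
  "prime_on m q \<longleftrightarrow> q \<in> kspan (first_coords m) \<and> q \<noteq> 0 \<and> \<not> q dvd 1 \<and>
    (\<forall>f\<in>kspan (first_coords m). \<forall>g\<in>kspan (first_coords m). q dvd f * g \<longrightarrow> q dvd f \<or> q dvd g)"

text \<open>If \<open>q\<close> divides neither factor, take in each the lowest power of the new
  variable whose coefficient \<open>q\<close> does not divide. In the coefficient of the product at
  the sum of these powers, all other summands are divisible by \<open>q\<close>.\<close>

lemma prime_on_Suc:
  assumes "prime_on m (q :: 'k::field laurent)"
  shows "prime_on (Suc m) q"
  unfolding prime_on_def
proof (intro conjI ballI impI)
  show "q \<noteq> 0" "\<not> q dvd 1"
    using assms by (auto simp: prime_on_def)
  have qm: "q \<in> kspan (first_coords m)"
    using assms by (simp add: prime_on_def)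
  then show "q \<in> kspan (first_coords (Suc m))"
    by (rule kspan_mono[rotated]) (rule first_coords_mono, simp)
  fix f g :: "'k laurent"
  assume f: "f \<in> kspan (first_coords (Suc m))" and g: "g \<in> kspan (first_coords (Suc m))" and fg: "q dvd f * g"
  let ?c = "component (coord m)"
  show "q dvd f \<or> q dvd g"
  proof (rule ccontr)
    assume contra: "\<not> (q dvd f \<or> q dvd g)"
    define J where "J h = {j. \<not> q dvd ?c j h}" for h
    have "J h \<subseteq> coord m ` Poly_Mapping.keys h" for h
    proof
      fix i assume "i \<in> J h"
      then have "?c i h \<noteq> 0" by (auto simp: J_def)
      then show "i \<in> coord m ` Poly_Mapping.keys h" by (simp add: component_eq_0_iff)
    qed
    then have fin: "finite (J h)" for h
      by (rule finite_subset) simp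
    have "J f \<noteq> {}" "J g \<noteq> {}"
      using contra dvd_components_iff[OF qm, of f] dvd_components_iff[OF qm, of g]
      unfolding J_def by blast+
    define j k where "j = Min (J f)" and "k = Min (J g)"
    have jk: "j \<in> J f" "k \<in> J g"
      unfolding j_def k_def using fin \<open>J f \<noteq> {}\<close> \<open>J g \<noteq> {}\<close> by (auto intro: Min_in)
    have "q dvd ?c i h" if "i < Min (J h)" for i h
      using that Min_le[OF fin[of h], of i] unfolding J_def by (metis leD mem_Collect_eq)
    then have low: "q dvd ?c i f" if "i < j" for i
      using that by (simp add: j_def)
    have low': "q dvd ?c i g" if "i < k" for i
      using that \<open>\<And>i h. i < Min (J h) \<Longrightarrow> q dvd ?c i h\<close> by (simp add: k_def)
    have "?c j f \<noteq> 0"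
      using jk(1) by (auto simp: J_def)
    then have jmem: "j \<in> coord m ` Poly_Mapping.keys f"
      by (simp add: component_eq_0_iff)
    have others: "q dvd ?c i f * ?c (j + k - i) g" if "i \<noteq> j" for i
      using that low[of i] low'[of "j + k - i"] by (cases "i < j") auto
    have "q dvd ?c (j + k) (f * g)"
      using fg dvd_components_iff[OF qm] by blast
    also have "?c (j + k) (f * g) = ?c j f * ?c k g + (\<Sum>i\<in>coord m ` Poly_Mapping.keys f - {j}. ?c i f * ?c (j + k - i) g)"
      by (simp add: component_mult sum.remove[OF _ jmem])
    finally have "q dvd ?c j f * ?c k g + (\<Sum>i\<in>coord m ` Poly_Mapping.keys f - {j}. ?c i f * ?c (j + k - i) g)" .
    moreover have "q dvd (\<Sum>i\<in>coord m ` Poly_Mapping.keys f - {j}. ?c i f * ?c (j + k - i) g)"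
      using others by (intro dvd_sum) auto
    ultimately have "q dvd ?c j f * ?c k g"
      by (simp add: dvd_add_left_iff)
    moreover have "vpow m (- j) * ?c j f * (vpow m (- k) * ?c k g)
        = vpow m (- j) * (vpow m (- k) * (?c j f * ?c k g))"
      by (simp only: mult_ac)
    ultimately have "q dvd vpow m (- j) * ?c j f * (vpow m (- k) * ?c k g)"
      by (simp only: dvd_monom_mult_iff)
    then have "q dvd vpow m (- j) * ?c j f \<or> q dvd vpow m (- k) * ?c k g"
      using assms component_descend[OF f, of j] component_descend[OF g, of k]
      unfolding prime_on_def by blast
    then show False
      using jk by (simp add: J_def)
  qed
qed

text \<open>Any two Laurent polynomials lie in a common ring of finitely many variables, to which
  primality climbs by \<open>prime_on_Suc\<close>.\<close>

lemma prime_on_imp_prime_elem: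
  assumes "prime_on m (q :: 'k::field laurent)"
  shows "prime_elem q"
proof (rule prime_elemI)
  show "q \<noteq> 0" "\<not> q dvd 1"
    using assms by (auto simp: prime_on_def)
  have up: "prime_on n q" if "m \<le> n" for n
    using that assms by (induction rule: dec_induct) (auto intro: prime_on_Suc)
  fix f g :: "'k laurent"
  assume fg: "q dvd f * g"
  obtain n1 where n1: "n1 \<ge> m" "f \<in> kspan (first_coords n1)"
    using ex_first_coords by blast
  obtain n where n: "n \<ge> n1" "g \<in> kspan (first_coords n)"
    using ex_first_coords by blast
  have "f \<in> kspan (first_coords n)"
    using n1 n first_coords_mono kspan_mono by blast
  then show "q dvd f \<or> q dvd g"
    using fg n up[of n] n1(1) unfolding prime_on_def by auto
qed

text \<open>The factors are prime in the full Laurent ring while unit and factors lie in the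
  subring, so a factorization remains valid when variables are added.\<close>

definition factors_on :: "nat \<Rightarrow> 'k::field laurent \<Rightarrow> 'k laurent \<Rightarrow> 'k laurent multiset \<Rightarrow> bool" where
  "factors_on m f u ms \<longleftrightarrow> f = u * prod_mset ms \<and> u dvd 1 \<and> u \<in> kspan (first_coords m) \<and>
    (\<forall>q\<in>#ms. prime_elem q \<and> q \<in> kspan (first_coords m))"

lemma factors_on_mult:
  "factors_on m f u ms \<Longrightarrow> factors_on m g v ns \<Longrightarrow> factors_on m (f * g) (u * v) (ms + ns)"
  using mult_dvd_mono[of u 1 v 1]
  by (auto simp: factors_on_def mult_ac intro: kspan_first_coords_mult)

lemma factors_on_unit:
  "u dvd 1 \<Longrightarrow> u \<in> kspan (first_coords m) \<Longrightarrow> factors_on m u u {#}"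
  by (simp add: factors_on_def)

lemma factors_on_prime:
  "prime_elem q \<Longrightarrow> q \<in> kspan (first_coords m) \<Longrightarrow> factors_on m q 1 {#q#}"
  by (simp add: factors_on_def one_kspan_first_coords)

text \<open>A prime of \<open>ms\<close> divides the cofactor of \<open>f\<close> because it does
  not divide \<open>f\<close>, and can be cancelled on both sides. This removes the denominators
  left by pseudo-division.\<close>

lemma cancel_prod_primes:
  fixes f y :: "'k::field laurent"
  assumes "\<And>q. q \<in># ms \<Longrightarrow> prime_elem q" "\<And>q. q \<in># ms \<Longrightarrow> \<not> q dvd f" "f dvd prod_mset ms * y"
  shows "f dvd y"
  using assms
proof (induction ms arbitrary: y)
  case (add q ms)
  obtain z where z: "prod_mset (add_mset q ms) * y = f * z"
    using add.prems(3) by auto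
  then have "q dvd f * z"
    by (metis dvd_mult2 dvd_triv_left prod_mset.add_mset)
  then have "q dvd z"
    using add.prems(1,2)[of q] prime_elem_dvd_multD by (metis union_single_eq_member)
  then obtain w where "z = q * w" by auto
  then have "q * (prod_mset ms * y) = q * (f * w)"
    using z by (simp add: mult_ac)
  moreover have "q \<noteq> 0"
    using add.prems(1)[of q] by auto
  ultimately have "prod_mset ms * y = f * w" by simp
  then show ?case
    using add.IH[of y] add.prems by (metis dvd_triv_left union_iff union_single_eq_member add_mset_add_single)
qed simp

text \<open>Each prime goes to a factor that it divides. A factorization of \<open>f\<close> with
  denominators, as over the field of fractions of the coefficients, becomes one without.\<close>

lemma split_prod_primes:
  fixes f q r :: "'k::field laurent"
  assumes "\<And>p. p \<in># ms \<Longrightarrow> prime_elem p" "prod_mset ms * f = q * r"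
  obtains ns ls q' r' where "ms = ns + ls" "q = prod_mset ns * q'" "r = prod_mset ls * r'" "f = q' * r'"
  using assms
proof (induction ms arbitrary: q r thesis)
  case empty
  then show ?case by (metis add_0 mult_1 prod_mset_empty)
next
  case (add p ms)
  have p: "prime_elem p" using add.prems(2) by simp
  then have nz: "p \<noteq> 0" by auto
  have "p dvd q * r"
    using add.prems(3) by (metis dvd_mult2 dvd_triv_left prod_mset.add_mset)
  then consider "p dvd q" | "p dvd r"
    using p prime_elem_dvd_multD by blast
  then show ?case
  proof cases
    case 1
    then obtain q1 where q1: "q = p * q1" by auto
    then have "prod_mset ms * f = q1 * r"
      using add.prems(3) nz by (simp add: mult.assoc)
    then obtain ns ls q' r' where "ms = ns + ls" "q1 = prod_mset ns * q'" "r = prod_mset ls * r'" "f = q' * r'"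
      using add.IH[of q1 r] add.prems(2) by (metis union_iff add_mset_add_single)
    then show ?thesis
      using add.prems(1)[of "add_mset p ns" ls q' r'] q1 by (simp add: mult_ac)
  next
    case 2
    then obtain r1 where r1: "r = p * r1" by auto
    then have "prod_mset ms * f = q * r1"
      using add.prems(3) nz by (simp add: mult_ac)
    then obtain ns ls q' r' where "ms = ns + ls" "q = prod_mset ns * q'" "r1 = prod_mset ls * r'" "f = q' * r'"
      using add.IH[of q r1] add.prems(2) by (metis union_iff add_mset_add_single)
    then show ?thesis
      using add.prems(1)[of ns "add_mset p ls" q' r'] r1 by (simp add: mult_ac)
  qed
qed

section \<open>Division in one variable and existence of prime factorizations\<close>

lemma width_0_descend:
  fixes f :: "'k::field laurent"
  assumes "f \<in> kspan (first_coords (Suc m))" "width (coord m) f = 0"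
  obtains j where "vpow m (- j) * f \<in> kspan (first_coords m)"
proof (cases "f = 0")
  case True
  then show ?thesis using that[of 0] by simp
next
  case False
  then obtain a where a: "a \<in> Poly_Mapping.keys f"
    using ex_key by blast
  have "component (coord m) (coord m a) f = f"
  proof (rule poly_mapping_eqI)
    fix c
    show "Poly_Mapping.lookup (component (coord m) (coord m a) f) c = Poly_Mapping.lookup f c"
      using width_0D[OF assms(2) _ a, of c] by (cases "c \<in> Poly_Mapping.keys f") (simp_all add: lookup_component in_keys_iff)
  qed
  then show ?thesis
    using that component_descend[OF assms(1), of "coord m a"] by simp
qed

text \<open>The multiplier \<open>c\<close>, free of variable \<open>m\<close>, stands for the
  denominator that division over the field of fractions would need. Width in that variable serves as
  degree, and each step cancels the top component.\<close>

lemma pseudo_division: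
  fixes r y :: "'k::field laurent"
  assumes r: "r \<in> kspan (first_coords (Suc m))" "r \<noteq> 0"
    and y: "y \<in> kspan (first_coords (Suc m))"
  obtains c q where "c \<in> kspan (first_coords m)" "c \<noteq> 0" "q \<in> kspan (first_coords (Suc m))"
    "c * y = q * r \<or> width (coord m) (c * y - q * r) < width (coord m) r"
  using y
proof (induction "nat (width (coord m) y)" arbitrary: y thesis rule: less_induct)
  case less
  let ?w = "width (coord m)" and ?c = "component (coord m)"
  show ?case
  proof (cases "y = 0 \<or> ?w y < ?w r")
    case True
    then show ?thesis
      using less.prems(1)[of 1 0] by (auto simp: one_kspan_first_coords)
  next
    case False
    then have "y \<noteq> 0" and wle: "?w r \<le> ?w y" by auto
    define top where "top f = - val (\<lambda>a. - coord m a) f" for f :: "'k laurent"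
    have top: "coord m a \<le> top f" "val (coord m) f \<le> coord m a" if "a \<in> Poly_Mapping.keys f" for a f
      using val_le[OF that, of "\<lambda>a. - coord m a"] val_le[OF that, of "coord m"] by (simp_all add: top_def)
    have w_eq: "?w f = top f - val (coord m) f" for f
      by (simp add: width_def top_def)
    have top_att: "?c (top f) f \<noteq> 0" if "f \<noteq> 0" for f
      using val_attained[OF that, of "\<lambda>a. - coord m a"] unfolding component_eq_0_iff top_def by force
    define br where "br = vpow m (- top r) * ?c (top r) r"
    define b_y where "b_y = vpow m (- top y) * ?c (top y) y"
    have br: "br \<in> kspan (first_coords m)" "br \<noteq> 0" and b_y: "b_y \<in> kspan (first_coords m)"
      unfolding br_def b_y_def
      using component_descend[OF r(1)] component_descend[OF less.prems(2)] top_att[OF r(2)] by auto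
    have up: "x \<in> kspan (first_coords (Suc m))" if "x \<in> kspan (first_coords m)" for x :: "'k laurent"
      using that first_coords_mono[of m "Suc m"] kspan_mono by (metis le_SucI order_refl)
    define q0 where "q0 = b_y * vpow m (top y - top r)"
    have q0: "q0 \<in> kspan (first_coords (Suc m))"
      unfolding q0_def by (intro kspan_first_coords_mult up b_y vpow_kspan) simp
    define y' where "y' = br * y - q0 * r"
    have y': "y' \<in> kspan (first_coords (Suc m))"
      unfolding y'_def by (intro kspan_diff kspan_first_coords_mult up br q0 r less.prems(2))
    have hom0: "coord m a = 0" if "a \<in> Poly_Mapping.keys x" "x \<in> kspan (first_coords m)" for a and x :: "'k laurent"
      using that by (auto simp: kspan_def first_coords_iff)
    have homq0: "coord m a = top y - top r" if a: "a \<in> Poly_Mapping.keys q0" for a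
    proof -
      obtain b where "b \<in> Poly_Mapping.keys b_y" "a = b + Poly_Mapping.single m (top y - top r)"
        using a keys_mult[of b_y "vpow m (top y - top r)"] unfolding q0_def by fastforce
      then show ?thesis
        using hom0[OF _ b_y] by (simp add: lookup_add)
    qed
    have tops: "vpow m (top y - top r) * ?c (top r) r = vpow m (top y) * br"
      unfolding br_def by (simp add: mult.assoc[symmetric] monom_mult single_add[symmetric])
    have "?c (top y) y' = br * ?c (top y) y - q0 * ?c (top r) r"
      unfolding y'_def component_diff
      using component_homogeneous_mult[of "coord m" br 0 "top y" y] hom0[OF _ br(1)]
        component_homogeneous_mult[of "coord m" q0 "top y - top r" "top y" r] homq0 by simp
    also have "\<dots> = 0"
      unfolding q0_def mult.assoc tops by (simp add: b_y_def mult_ac vpow_mult)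
    finally have no_top: "coord m a \<noteq> top y" if "a \<in> Poly_Mapping.keys y'" for a
      using that by (metis component_eq_0_iff imageI)
    \<comment> \<open>The lower end does not drop: \<open>q0 * r\<close> begins at the top of
      \<open>y\<close> minus the width of \<open>r\<close>, which is at least the lower end of
      \<open>y\<close> since \<open>r\<close> is not wider. The upper end loses at least
      one.\<close>
    have bounds: "val (coord m) y \<le> coord m a \<and> coord m a \<le> top y - 1" if "a \<in> Poly_Mapping.keys y'" for a
    proof -
      note a = that
      have "a \<in> Poly_Mapping.keys (br * y) \<or> a \<in> Poly_Mapping.keys (q0 * r)"
        using that keys_diff[of "br * y" "q0 * r"] by (auto simp: y'_def)
      then have "val (coord m) y \<le> coord m a \<and> coord m a \<le> top y"
      proof
        assume "a \<in> Poly_Mapping.keys (br * y)"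
        then obtain b c where "b \<in> Poly_Mapping.keys br" "c \<in> Poly_Mapping.keys y" "a = b + c"
          using keys_mult[of br y] by blast
        then show ?thesis
          using hom0[OF _ br(1)] top[of c y] by (simp add: lookup_add)
      next
        assume "a \<in> Poly_Mapping.keys (q0 * r)"
        then obtain b c where "b \<in> Poly_Mapping.keys q0" "c \<in> Poly_Mapping.keys r" "a = b + c"
          using keys_mult[of q0 r] by blast
        then show ?thesis
          using homq0[of b] top[of c r] wle by (simp add: lookup_add w_eq)
      qed
      then show ?thesis
        using no_top[OF that] by simp
    qed
    show ?thesis
    proof (cases "y' = 0")
      case True
      then show ?thesis
        using less.prems(1)[OF br q0] by (simp add: y'_def)
    next
      case False
      have "?w y' \<le> top y - 1 - val (coord m) y"
        using bounds by (intro width_le False) auto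
      then have lt: "?w y' < ?w y" by (simp add: w_eq)
      have "nat (?w y') < nat (?w y)"
        using lt width_nonneg[OF False, of "coord m"] by simp
      from less.hyps[OF this _ y'] obtain c q where
        c: "c \<in> kspan (first_coords m)" "c \<noteq> 0" "q \<in> kspan (first_coords (Suc m))"
        and cq: "c * y' = q * r \<or> ?w (c * y' - q * r) < ?w r" by metis
      have "c * br \<in> kspan (first_coords m)" "c * br \<noteq> 0"
        using c br kspan_first_coords_mult by auto
      moreover have "q + c * q0 \<in> kspan (first_coords (Suc m))"
        by (intro kspan_add kspan_first_coords_mult c q0 up)
      moreover have "c * br * y - (q + c * q0) * r = c * y' - q * r"
        by (simp add: y'_def algebra_simps)
      ultimately show ?thesis
        using less.prems(1)[of "c * br" "q + c * q0"] cq by (metis eq_iff_diff_eq_0)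
    qed
  qed
qed

lemma prime_elem_dvd_prod_msetD:
  fixes q :: "'a::comm_semiring_1"
  assumes "prime_elem q" "q dvd prod_mset ms"
  shows "\<exists>p\<in>#ms. q dvd p"
  using assms(2)
proof (induction ms)
  case empty
  then show ?case using prime_elem_not_unit[OF assms(1)] by simp
next
  case (add p ms)
  then show ?case using prime_elem_dvd_multD[OF assms(1), of p "prod_mset ms"] by auto
qed

lemma kspan_first_coords_quotient:
  fixes f g :: "'k::field laurent"
  assumes "f * g \<in> kspan (first_coords m)" "f \<in> kspan (first_coords m)" "f \<noteq> 0"
  shows "g \<in> kspan (first_coords m)"
  by (rule kspan_quotient[OF additive_coords assms])

lemma kspan_first_coords_Suc: "f \<in> kspan (first_coords m) \<Longrightarrow> f \<in> kspan (first_coords (Suc m))"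
  by (rule kspan_mono[OF first_coords_mono]) simp_all

text \<open>Gauss's lemma: a pseudo-remainder argument replaces the passage to the field of fractions.\<close>

lemma irreducible_imp_prime_on:
  fixes f :: "'k::field laurent"
  assumes UF: "\<And>c. c \<in> kspan (first_coords m) \<Longrightarrow> c \<noteq> 0 \<Longrightarrow> \<exists>u ms. factors_on m (c :: 'k laurent) u ms"
    and f: "f \<in> kspan (first_coords (Suc m))" "f \<noteq> 0" "width (coord m) f > 0"
    and prim: "\<And>q. q \<in> kspan (first_coords m) \<Longrightarrow> prime_elem q \<Longrightarrow> \<not> q dvd f"
    and irred: "\<And>g h. g \<in> kspan (first_coords (Suc m)) \<Longrightarrow> h \<in> kspan (first_coords (Suc m)) \<Longrightarrow>
      f = g * h \<Longrightarrow> width (coord m) g = 0 \<or> width (coord m) h = 0"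
  shows "prime_on (Suc m) f"
  unfolding prime_on_def
proof (intro conjI ballI impI)
  let ?B = "kspan (first_coords m) :: 'k laurent set" and ?C = "kspan (first_coords (Suc m)) :: 'k laurent set"
  let ?w = "width (coord m) :: 'k laurent \<Rightarrow> int"
  show "f \<in> ?C" "f \<noteq> 0" using f by auto
  show "\<not> f dvd 1"
    using width_unit[of "coord m" f] f(3) by auto
  fix g h assume g: "g \<in> ?C" and h: "h \<in> ?C" and gh: "f dvd g * h"
  show "f dvd g \<or> f dvd h"
  proof (rule disjCI)
    assume nh: "\<not> f dvd h"
    \<comment> \<open>\<open>f\<close> has no prime factor among the coefficients, so a nonzero
      coefficient can be cancelled from a multiple of \<open>f\<close>.\<close>
    have cancel: "f dvd y" if cy: "c \<in> ?B" "c \<noteq> 0" "f dvd c * y" for c y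
    proof -
      obtain u ms where ums: "factors_on m c u ms"
        using UF[OF cy(1,2)] by blast
      have "f dvd prod_mset ms * (u * y)"
        using cy(3) ums by (simp add: factors_on_def mult_ac)
      then have "f dvd u * y"
        using ums prim by (intro cancel_prod_primes[of ms f "u * y"]) (auto simp: factors_on_def)
      moreover have "u * y dvd y"
        using ums mult_dvd_mono[of u 1 y y] by (simp add: factors_on_def)
      ultimately show ?thesis by (rule dvd_trans)
    qed
    \<comment> \<open>The ideal generated by \<open>f\<close> and \<open>g\<close> in
      \<open>m + 1\<close> variables; a nonzero element of least width is their greatest common
      divisor over the field of fractions.\<close>
    define I where "I = {a * f + b * g | a b. a \<in> ?C \<and> b \<in> ?C}"
    have I_diff: "x - y \<in> I" if xy: "x \<in> I" "y \<in> I" for x y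
    proof -
      obtain a b a' b' where "x = a * f + b * g" "y = a' * f + b' * g"
        and ab: "a \<in> ?C" "b \<in> ?C" "a' \<in> ?C" "b' \<in> ?C"
        using xy by (auto simp: I_def)
      then have "x - y = (a - a') * f + (b - b') * g"
        by (simp add: algebra_simps)
      then show ?thesis
        using ab kspan_diff unfolding I_def by blast
    qed
    have I_mult: "c * x \<in> I" if cx: "c \<in> ?C" "x \<in> I" for c x
    proof -
      obtain a b where "x = a * f + b * g" and ab: "a \<in> ?C" "b \<in> ?C"
        using cx by (auto simp: I_def)
      then have "c * x = (c * a) * f + (c * b) * g"
        by (simp add: algebra_simps)
      then show ?thesis
        using ab cx kspan_first_coords_mult unfolding I_def by blast
    qed
    have I_C: "x \<in> ?C" if "x \<in> I" for x
      using that f(1) g by (auto simp: I_def intro!: kspan_add kspan_first_coords_mult)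
    have "f = 1 * f + 0 * g" by simp
    then have fI: "f \<in> I"
      unfolding I_def using one_kspan_first_coords kspan_0 by blast
    have "g = 0 * f + 1 * g" by simp
    then have gI: "g \<in> I"
      unfolding I_def using one_kspan_first_coords kspan_0 by blast
    define r where "r = arg_min (\<lambda>x. nat (?w x)) (\<lambda>x. x \<in> I \<and> x \<noteq> 0)"
    have r: "r \<in> I" "r \<noteq> 0"
      using arg_min_natI[of "\<lambda>x. x \<in> I \<and> x \<noteq> 0" f "\<lambda>x. nat (?w x)"] fI f(2) by (auto simp: r_def)
    have rmin: "?w r \<le> ?w x" if "x \<in> I" "x \<noteq> 0" for x
      using arg_min_nat_le[of "\<lambda>x. x \<in> I \<and> x \<noteq> 0" x "\<lambda>x. nat (?w x)"] that width_nonneg[of x "coord m"]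
      by (simp add: r_def)
    \<comment> \<open>The remainder of the pseudo-division by \<open>r\<close> lies in the ideal and
      is narrower than \<open>r\<close>, so it is zero.\<close>
    have rdvd: "\<exists>c q. c \<in> ?B \<and> c \<noteq> 0 \<and> q \<in> ?C \<and> c * y = q * r" if y: "y \<in> I" for y
    proof -
      obtain c q where c: "c \<in> ?B" "c \<noteq> 0" "q \<in> ?C" and "c * y = q * r \<or> ?w (c * y - q * r) < ?w r"
        using pseudo_division[OF I_C[OF r(1)] r(2) I_C[OF y]] by metis
      moreover have "c * y - q * r \<in> I"
        by (intro I_diff I_mult y r(1) c kspan_first_coords_Suc)
      ultimately have "c * y = q * r"
        using rmin[of "c * y - q * r"] by fastforce
      then show ?thesis using c by blast
    qed
    obtain c q where c: "c \<in> ?B" "c \<noteq> 0" and q: "q \<in> ?C" and cf: "c * f = q * r"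
      using rdvd[OF fI] by blast
    obtain u ms where ums: "factors_on m c u ms"
      using UF[OF c] by blast
    then obtain v where v: "u * v = 1" and c_eq: "c = u * prod_mset ms"
      unfolding factors_on_def dvd_def by metis
    have uC: "u \<in> ?C"
      using ums by (auto simp: factors_on_def intro: kspan_first_coords_Suc)
    have "u \<noteq> 0" using v by auto
    have vC: "v \<in> ?C"
      using kspan_first_coords_quotient[of u v "Suc m"] v uC \<open>u \<noteq> 0\<close> one_kspan_first_coords[of "Suc m"] by metis
    have "prod_mset ms * f = v * (c * f)"
    proof -
      have "v * (c * f) = u * v * (prod_mset ms * f)"
        unfolding c_eq by (simp only: mult_ac)
      also have "\<dots> = prod_mset ms * f"
        unfolding v by simp
      finally show ?thesis by (rule sym)
    qed
    then have "prod_mset ms * f = (v * q) * r"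
      by (simp add: cf mult_ac)
    moreover have "prime_elem p" if "p \<in># ms" for p
      using that ums by (simp add: factors_on_def)
    \<comment> \<open>With the primes of \<open>c\<close> distributed over both factors,
      \<open>c * f = q * r\<close> turns into a factorization of \<open>f\<close> itself, and
      irreducibility applies.\<close>
    ultimately obtain ns ls q' r' where split: "ms = ns + ls" "v * q = prod_mset ns * q'"
      "r = prod_mset ls * r'" "f = q' * r'"
      using split_prod_primes[of ms f "v * q" r] by blast
    have prodB: "prod_mset xs \<in> ?B" if "set_mset xs \<subseteq> set_mset ms" for xs
      using that
    proof (induction xs)
      case (add x xs)
      then have "x \<in> ?B"
        using ums by (auto simp: factors_on_def)
      then show ?case
        using add by (auto intro!: kspan_first_coords_mult)
    qed (simp add: one_kspan_first_coords)
    have lsB: "prod_mset ls \<in> ?B"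
      using split(1) by (intro prodB) simp
    have "q' \<noteq> 0" "r' \<noteq> 0" using split(4) f(2) by auto
    have nz: "prod_mset ls \<noteq> 0" using split(3) r(2) by auto
    have r'C: "r' \<in> ?C"
      using kspan_first_coords_quotient[of "prod_mset ls" r' "Suc m"] split I_C[OF r(1)] kspan_first_coords_Suc[OF lsB] nz by simp
    have q'C: "q' \<in> ?C"
      using kspan_first_coords_quotient[of r' q' "Suc m"] split(4) f(1) r'C \<open>r' \<noteq> 0\<close> by (simp add: mult.commute)
    consider "?w r' = 0" | "?w q' = 0"
      using irred[OF q'C r'C split(4)] by blast
    then show "f dvd g"
    proof cases
      \<comment> \<open>Here \<open>r\<close> is a coefficient times a monomial. As \<open>f\<close>
        divides \<open>r * h\<close>, it divides \<open>h\<close>, against the assumption.\<close>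
      case 1
      have "width (coord m) (prod_mset ls) = 0"
        by (rule width_kspan_sublattice[OF lsB nz]) simp
      then have "?w r = 0"
        using 1 width_mult[of "coord m" "prod_mset ls" r'] nz \<open>r' \<noteq> 0\<close> split(3) by simp
      then obtain j where j: "vpow m (- j) * r \<in> ?B"
        using width_0_descend[OF I_C[OF r(1)]] by blast
      obtain a b where ab: "r = a * f + b * g"
        using r(1) by (auto simp: I_def)
      have "f dvd r * h"
        unfolding ab distrib_right mult.assoc using gh by (intro dvd_add) (auto simp: mult.left_commute)
      then have "f dvd (vpow m (- j) * r) * h"
        by (simp add: mult.assoc)
      then have "f dvd h"
        by (rule cancel[OF j, rotated]) (simp add: r(2))
      then show ?thesis using nh by blast
    next
      \<comment> \<open>Here \<open>q'\<close> is a coefficient times a monomial and divides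
        \<open>f\<close>, which has no prime factor among the coefficients; so \<open>q'\<close> is
        a unit and \<open>f\<close> divides \<open>r\<close>.\<close>
      case 2
      then obtain j where j: "vpow m (- j) * q' \<in> ?B"
        using width_0_descend[OF q'C] by blast
      then obtain w ks where wks: "factors_on m (vpow m (- j) * q') w ks"
        using UF[OF j] \<open>q' \<noteq> 0\<close> by auto
      have "\<not> p \<in># ks" for p
      proof
        assume "p \<in># ks"
        then have "p dvd vpow m (- j) * q'"
          using wks by (auto simp: factors_on_def intro: dvd_mult dvd_prod_mset)
        then have "p dvd f"
          using split(4) by simp
        then show False
          using prim[of p] wks \<open>p \<in># ks\<close> by (auto simp: factors_on_def)
      qed
      then have "vpow m (- j) * q' dvd 1"
        using wks by (metis factors_on_def multiset_nonemptyE mult.right_neutral prod_mset_empty)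
      then have "q' dvd 1" by simp
      then have "f dvd r'"
        using split(4) mult_dvd_mono[of q' 1 r' r'] by simp
      then have fr: "f dvd r"
        using split(3) by simp
      obtain c' q2 where c': "c' \<in> ?B" "c' \<noteq> 0" "c' * g = q2 * r"
        using rdvd[OF gI] by blast
      then have "f dvd c' * g"
        using fr by simp
      then show ?thesis
        using cancel[OF c'(1,2)] by blast
    qed
  qed
qed

text \<open>Induction on the number of variables, and inside it on the pair of the width and the
  number of prime factors of the leading coefficient. A prime coefficient is split off at constant
  width but shortens the leading coefficient; a proper splitting gives narrower factors; if neither
  exists, the element is prime or, up to a monomial, free of the variable.\<close>

lemma factors_on_exists:
  fixes f :: "'k::field laurent"
  assumes "f \<in> kspan (first_coords m)" "f \<noteq> 0"
  shows "\<exists>u ms. factors_on m f u ms"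
  using assms
proof (induction m arbitrary: f)
  case 0
  have "first_coords 0 \<subseteq> {0}"
    by (auto simp: sublattice_def intro!: poly_mapping_eqI)
  then have "Poly_Mapping.keys f \<subseteq> {0}"
    using 0(1) by (auto simp: kspan_def)
  then have f: "f = Poly_Mapping.single 0 (Poly_Mapping.lookup f 0)"
    by (intro poly_mapping_eqI) (auto simp: lookup_single when_def in_keys_iff)
  then have "Poly_Mapping.lookup f 0 \<noteq> 0"
    using 0(2) by (metis single_zero)
  then have "f * Poly_Mapping.single 0 (inverse (Poly_Mapping.lookup f 0)) = 1"
    by (subst f) (simp add: mult_single)
  then have "f dvd 1" by (metis dvd_triv_left)
  then show ?case using factors_on_unit 0(1) by blast
next
  case (Suc m)
  let ?C = "kspan (first_coords (Suc m)) :: 'k laurent set" and ?w = "width (coord m) :: 'k laurent \<Rightarrow> int"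
  let ?top = "\<lambda>f :: 'k laurent. - val (\<lambda>a. - coord m a) f"
  define lead where "lead f = vpow m (- ?top f) * component (coord m) (?top f) f" for f :: "'k laurent"
  have lead: "lead f \<in> kspan (first_coords m)" if "f \<in> ?C" for f
    unfolding lead_def by (rule component_descend[OF that])
  have lead_nz: "lead f \<noteq> 0" if nz: "f \<noteq> 0" for f
  proof -
    obtain a where "a \<in> Poly_Mapping.keys f" "- coord m a = val (\<lambda>a. - coord m a) f"
      using val_attained[OF nz, of "\<lambda>a. - coord m a"] by blast
    then have "component (coord m) (?top f) f \<noteq> 0"
      unfolding component_eq_0_iff by force
    then show ?thesis by (simp add: lead_def)
  qed
  have lead_mult: "lead (q * f) = q * lead f" if q: "q \<in> kspan (first_coords m)" "q \<noteq> 0" "f \<noteq> 0" for q f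
  proof -
    have hom: "coord m a = 0" if "a \<in> Poly_Mapping.keys q" for a
      using that q(1) by (auto simp: kspan_def first_coords_iff)
    then have "val (\<lambda>a. - coord m a) q = 0"
      using val_attained[OF q(2), of "\<lambda>a. - coord m a"] by force
    then have "?top (q * f) = ?top f"
      using val_mult[OF additive_uminus[OF additive_coord] q(2,3), of m] by simp
    then show ?thesis
      unfolding lead_def using component_homogeneous_mult[of "coord m" q 0 "?top f" f] hom
      by (simp add: mult_ac)
  qed
  have "\<exists>u ms. factors_on (Suc m) f u ms"
    if "f \<in> ?C" "f \<noteq> 0" "factors_on m (lead f) v ns" for f v ns
    using that
  proof (induction "(nat (?w f), size ns)" arbitrary: f v ns rule: wf_induct_rule[OF wf_lex_prod[OF wf_less_than wf_less_than]])
    case (1 f ns v)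
    note less = 1
    note fC = less(2) and fnz = less(3)
    have sub: "\<exists>u ms. factors_on (Suc m) g u ms" if g: "g \<in> ?C" "g \<noteq> 0" "?w g < ?w f" for g
    proof -
      obtain v' ns' where "factors_on m (lead g) v' ns'"
        using Suc.IH[OF lead[OF g(1)] lead_nz[OF g(2)]] by blast
      then show ?thesis
        using g width_nonneg[of g "coord m"] by (intro less(1)[OF _ g(1,2)]) auto
    qed
    consider (content) q where "q \<in> kspan (first_coords m)" "prime_elem q" "q dvd f"
      | (zero) "?w f = 0"
      | (split) g h where "g \<in> ?C" "h \<in> ?C" "f = g * h" "?w g \<noteq> 0" "?w h \<noteq> 0"
      | (prime) "prime_on (Suc m) f"
      using irreducible_imp_prime_on[OF Suc.IH fC fnz] width_nonneg[OF fnz, of "coord m"] by force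
    then show ?case
    proof cases
      case content
      then obtain g where g: "f = q * g" by auto
      have qnz: "q \<noteq> 0" "g \<noteq> 0" using g fnz by auto
      have qC: "q \<in> ?C" using content(1) by (rule kspan_first_coords_Suc)
      have gC: "g \<in> ?C"
        using kspan_first_coords_quotient[OF _ qC qnz(1)] fC g by simp
      have lf: "q * lead g = v * prod_mset ns" and v: "v dvd 1" "v \<in> kspan (first_coords m)"
        and ns: "\<And>p. p \<in># ns \<Longrightarrow> prime_elem p \<and> p \<in> kspan (first_coords m)"
        using less(4) lead_mult[OF content(1) qnz] g by (auto simp: factors_on_def)
      have "\<not> q dvd v"
        using v(1) content(2) dvd_trans prime_elem_not_unit by blast
      then have "q dvd prod_mset ns"
        using content(2) lf by (metis dvd_triv_left prime_elem_dvd_multD)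
      \<comment> \<open>\<open>q\<close> is an associate of a prime \<open>p\<close> in the
        factorization of the leading coefficient; removing \<open>p\<close> there and absorbing the
        unit \<open>e\<close> gives a factorization of \<open>lead g\<close>.\<close>
      then obtain p where p: "p \<in># ns" "q dvd p"
        using content(2) prime_elem_dvd_prod_msetD by blast
      then obtain e where e: "p = q * e" by auto
      have enz: "e \<noteq> 0" using ns[OF p(1)] e by auto
      have "p dvd q \<or> p dvd e"
        using ns[OF p(1)] e prime_elem_dvd_multD[of p q e] by simp
      moreover have "\<not> p dvd e"
        using prime_elem_not_unit[OF content(2)] enz e by simp
      ultimately have e_unit: "e dvd 1"
        using qnz e by simp
      have eB: "e \<in> kspan (first_coords m)"
        using kspan_first_coords_quotient[OF _ content(1) qnz(1), of e] ns[OF p(1)] e by simp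
      define ns' where "ns' = ns - {#p#}"
      have ns': "ns = add_mset p ns'" using p(1) by (simp add: ns'_def)
      have "q * lead g = q * (v * e * prod_mset ns')"
        using lf by (simp add: ns' e mult_ac)
      then have "lead g = v * e * prod_mset ns'"
        using qnz by simp
      then have fl: "factors_on m (lead g) (v * e) ns'"
        using v e_unit eB ns kspan_first_coords_mult mult_dvd_mono[OF v(1) e_unit]
        by (auto simp: factors_on_def ns')
      have "?w q = 0"
        by (rule width_kspan_sublattice[OF content(1) qnz(1)]) simp
      then have "?w g = ?w f"
        using width_mult[of "coord m" q g] qnz g by simp
      then obtain u ms where "factors_on (Suc m) g u ms"
        using less(1)[OF _ gC qnz(2) fl] by (auto simp: ns')
      then show ?thesis
        using factors_on_mult[OF factors_on_prime[OF content(2) qC]] g by blast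
    next
      case zero
      then obtain j where j: "vpow m (- j) * f \<in> kspan (first_coords m)"
        using width_0_descend[OF fC] by blast
      then obtain u ms where "factors_on m (vpow m (- j) * f) u ms"
        using Suc.IH fnz by fastforce
      then have "factors_on (Suc m) (vpow m (- j) * f) u ms"
        by (auto simp: factors_on_def intro: kspan_first_coords_Suc)
      moreover have "factors_on (Suc m) (vpow m j) (vpow m j) {#}"
        by (intro factors_on_unit vpow_kspan) auto
      ultimately have "factors_on (Suc m) (vpow m j * (vpow m (- j) * f)) (vpow m j * u) ({#} + ms)"
        by (rule factors_on_mult[rotated])
      moreover have "vpow m j * (vpow m (- j) * f) = f"
        by (simp add: mult.assoc[symmetric] vpow_mult)
      ultimately show ?thesis by metis
    next
      case split
      then have nz: "g \<noteq> 0" "h \<noteq> 0" using fnz by auto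
      have "?w f = ?w g + ?w h"
        using width_mult[of "coord m" g h] nz split by simp
      then have "?w g < ?w f" "?w h < ?w f"
        using split width_nonneg[OF nz(1), of "coord m"] width_nonneg[OF nz(2), of "coord m"] by auto
      then show ?thesis
        using sub[OF split(1) nz(1)] sub[OF split(2) nz(2)] factors_on_mult split(3) by metis
    next
      case prime
      then show ?thesis
        using factors_on_prime[OF prime_on_imp_prime_elem fC] by blast
    qed
  qed
  then show ?case
    using Suc.IH[OF lead lead_nz] Suc.prems by blast
qed

theorem laurent_prime_factorization:
  fixes f :: "'k::field laurent"
  assumes "f \<noteq> 0"
  obtains u ms where "f = u * prod_mset ms" "u dvd 1" "\<And>q. q \<in># ms \<Longrightarrow> prime_elem q"
proof -
  obtain m where "f \<in> kspan (first_coords m)"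
    using ex_first_coords by blast
  then show ?thesis
    using factors_on_exists[OF _ assms] that by (metis factors_on_def)
qed

section \<open>Height one primes of a normal toric ring\<close>

lemma additive_frag_cmul:
  assumes "Modules.additive \<tau>"
  shows "\<tau> (frag_cmul c a) = c * (\<tau> a :: int)"
proof (induction c rule: int_induct[where k = 0])
  case base
  then show ?case by (simp add: additive.zero[OF assms])
next
  case (step1 c)
  then show ?case by (simp add: frag_cmul_distrib additive.add[OF assms] algebra_simps)
next
  case (step2 c)
  then show ?case by (simp add: frag_cmul_diff_distrib additive.diff[OF assms] algebra_simps)
qed

lemma xpow_power: "xpow a ^ n = (xpow (frag_cmul (int n) a) :: 'k::field laurent)"
  by (induction n) (simp_all add: mult_single frag_cmul_distrib)

section \<open>Multiplicities of prime factors\<close>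

definition pord :: "'k::field laurent \<Rightarrow> 'k laurent \<Rightarrow> nat" where
  "pord q f = (GREATEST n. q ^ n dvd f)"

text \<open>Each factor \<open>q\<close> uses up one member of \<open>ms\<close>, to which it is
  associated. The bound makes the maximum in \<open>pord\<close> exist.\<close>

lemma prime_power_dvd_prod_mset:
  fixes q :: "'k::field laurent"
  assumes q: "prime_elem q" and "\<And>p. p \<in># ms \<Longrightarrow> prime_elem p" "u dvd 1" "q ^ n dvd u * prod_mset ms"
  shows "n \<le> size ms"
  using assms(2-)
proof (induction ms arbitrary: n u)
  case empty
  then have "q ^ n dvd 1" using dvd_trans[of "q ^ n" u 1] by simp
  then show ?case
    using q prime_elem_not_unit[OF q] dvd_trans[of q "q ^ n" 1] by (cases n) auto
next
  case (add p ms)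
  have p: "prime_elem p" using add.prems(1) by simp
  have qnz: "q \<noteq> 0" "p \<noteq> 0" using q p by auto
  show ?case
  proof (cases n)
    case (Suc k)
    show ?thesis
    proof (cases "q dvd p")
      case True
      then obtain e where e: "p = q * e" by auto
      then have "p dvd q * e" by simp
      then have "p dvd q \<or> p dvd e"
        by (rule prime_elem_dvd_multD[OF p])
      moreover have "\<not> p dvd e"
        using prime_elem_not_unit[OF q] qnz e by auto
      ultimately have "e dvd 1" using qnz e by simp
      then have "u * e dvd 1" using mult_dvd_mono[OF add.prems(2)] by fastforce
      moreover have "q * q ^ k dvd q * (u * e * prod_mset ms)"
        using add.prems(3) Suc e by (simp add: mult_ac)
      then have "q ^ k dvd u * e * prod_mset ms"
        using qnz by simp
      ultimately have "k \<le> size ms"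
        using add.IH[of "u * e" k] add.prems(1) by auto
      then show ?thesis using Suc by simp
    next
      case False
      have "q ^ n dvd u * prod_mset ms"
      proof -
        have "q ^ n dvd p * (u * prod_mset ms)"
          using add.prems(3) by (simp add: mult_ac)
        moreover have "q ^ n dvd y" if "q ^ n dvd p * y" for n y
          using that
        proof (induction n arbitrary: y)
          case (Suc n)
          then have "q dvd p * y" using dvd_trans[of q "q ^ Suc n"] by auto
          then have "q dvd y" using False q prime_elem_dvd_multD by blast
          then obtain z where z: "y = q * z" by auto
          then have "q * q ^ n dvd q * (p * z)" using Suc.prems by (simp add: mult_ac)
          then have "q ^ n dvd p * z" using qnz by simp
          then have "q ^ n dvd z" by (rule Suc.IH)
          then show ?case using z by simp
        qed simp
        ultimately show ?thesis by blast
      qed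
      then have "n \<le> size ms" using add.IH[of u n] add.prems by auto
      then show ?thesis by simp
    qed
  qed simp
qed

lemma power_dvd_iff_le_pord:
  fixes q f :: "'k::field laurent"
  assumes "prime_elem q" "f \<noteq> 0"
  shows "q ^ n dvd f \<longleftrightarrow> n \<le> pord q f"
proof -
  obtain u ms where "f = u * prod_mset ms" "u dvd 1" "\<And>p. p \<in># ms \<Longrightarrow> prime_elem p"
    using laurent_prime_factorization[OF assms(2)] by blast
  then have b: "\<forall>n. q ^ n dvd f \<longrightarrow> n \<le> size ms"
    using prime_power_dvd_prod_mset[OF assms(1)] by blast
  have "q ^ 0 dvd f" by simp
  from GreatestI_nat[of "\<lambda>n. q ^ n dvd f", OF this b[rule_format]] have "q ^ pord q f dvd f"
    by (simp add: pord_def)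
  moreover have "n \<le> pord q f" if "q ^ n dvd f"
    unfolding pord_def using Greatest_le_nat[of "\<lambda>n. q ^ n dvd f", OF that] b by blast
  ultimately show ?thesis
    using le_imp_power_dvd dvd_trans by blast
qed

lemma pord_eqI:
  fixes q f :: "'k::field laurent"
  assumes "prime_elem q" "f = q ^ n * g" "\<not> q dvd g"
  shows "pord q f = n"
proof -
  have nz: "q \<noteq> 0" "g \<noteq> 0" using assms by auto
  then have fnz: "f \<noteq> 0" using assms(2) by simp
  have "\<not> q ^ Suc n dvd f"
    using assms nz by (simp add: mult.commute[of q])
  moreover have "q ^ n dvd f" using assms(2) by simp
  ultimately show ?thesis
    using power_dvd_iff_le_pord[OF assms(1) fnz, of n] power_dvd_iff_le_pord[OF assms(1) fnz, of "Suc n"] by simp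
qed

lemma pord_decompose:
  fixes q f :: "'k::field laurent"
  assumes "prime_elem q" "f \<noteq> 0"
  obtains g where "f = q ^ pord q f * g" "\<not> q dvd g"
proof -
  obtain g where g: "f = q ^ pord q f * g"
    using power_dvd_iff_le_pord[OF assms, of "pord q f"] by auto
  have "\<not> q dvd g"
  proof
    assume "q dvd g"
    then have "q ^ Suc (pord q f) dvd f"
      by (subst g) (simp add: mult.commute[of q])
    then show False using power_dvd_iff_le_pord[OF assms] by (metis Suc_n_not_le_n)
  qed
  then show ?thesis using g that by blast
qed

lemma pord_mult:
  fixes q f g :: "'k::field laurent"
  assumes q: "prime_elem q" and "f \<noteq> 0" "g \<noteq> 0"
  shows "pord q (f * g) = pord q f + pord q g"
proof -
  obtain f' where f': "f = q ^ pord q f * f'" "\<not> q dvd f'"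
    using pord_decompose[OF q assms(2)] by blast
  obtain g' where g': "g = q ^ pord q g * g'" "\<not> q dvd g'"
    using pord_decompose[OF q assms(3)] by blast
  have "f * g = (q ^ pord q f * f') * (q ^ pord q g * g')"
    using f'(1) g'(1) by (rule arg_cong2)
  also have "\<dots> = q ^ (pord q f + pord q g) * (f' * g')"
    by (simp only: power_add mult_ac)
  finally show ?thesis
    using f'(2) g'(2) q prime_elem_dvd_multD by (intro pord_eqI[OF q]) blast+
qed

lemma pord_self: "prime_elem q \<Longrightarrow> pord q q = 1"
  by (rule pord_eqI[of _ _ _ 1]) (auto simp: prime_elem_not_unit)

lemma pord_eq_0: "prime_elem q \<Longrightarrow> \<not> q dvd f \<Longrightarrow> pord q f = 0"
  by (rule pord_eqI) auto

lemma pord_unit: "prime_elem q \<Longrightarrow> u dvd 1 \<Longrightarrow> pord q u = 0"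
  using dvd_trans prime_elem_not_unit by (intro pord_eq_0) blast+

lemma pord_power:
  fixes q f :: "'k::field laurent"
  assumes "prime_elem q" "f \<noteq> 0"
  shows "pord q (f ^ n) = n * pord q f"
  by (induction n) (use assms in \<open>simp_all add: pord_mult pord_unit\<close>)

lemma pord_prod:
  fixes q :: "'k::field laurent"
  assumes "prime_elem q" "\<And>i. i \<in> I \<Longrightarrow> f i \<noteq> 0"
  shows "pord q (prod f I) = (\<Sum>i\<in>I. pord q (f i))"
  using assms(2)
  by (induction I rule: infinite_finite_induct) (simp_all add: pord_unit[OF assms(1)] pord_mult[OF assms(1)])

lemma dvd_if_pord_le:
  fixes f g :: "'k::field laurent"
  assumes "f \<noteq> 0" "g \<noteq> 0" "\<And>q. prime_elem q \<Longrightarrow> q dvd f \<Longrightarrow> pord q f \<le> pord q g"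
  shows "f dvd g"
proof -
  obtain u ms where f: "f = u * prod_mset ms" "u dvd 1" "\<And>p. p \<in># ms \<Longrightarrow> prime_elem p"
    using laurent_prime_factorization[OF assms(1)] by blast
  have "u * prod_mset ms dvd g"
    if "\<And>q. q \<in># ms \<Longrightarrow> pord q (prod_mset ms) \<le> pord q g" "g \<noteq> 0" for g
    using f(3) that
  proof (induction ms arbitrary: g)
    case empty
    then show ?case using f(2) by (simp add: unit_imp_dvd dvd_trans[OF f(2)])
  next
    case (add p ms)
    have p: "prime_elem p" using add.prems(1) by simp
    then have pnz: "p \<noteq> 0" by auto
    have msnz: "prod_mset ms \<noteq> 0"
      using add.prems(1)[of 0] by auto
    have "1 \<le> pord p (p * prod_mset ms)"
      using pord_mult[OF p pnz msnz] pord_self[OF p] by simp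
    then have "1 \<le> pord p g"
      using add.prems(2)[of p] by simp
    then have "p dvd g"
      using power_dvd_iff_le_pord[OF p add.prems(3), of 1] by simp
    then obtain h where h: "g = p * h" by auto
    then have hnz: "h \<noteq> 0" using add.prems(3) by auto
    have "u * prod_mset ms dvd h"
    proof (rule add.IH[OF _ _ hnz])
      fix q assume "q \<in># ms"
      then have q: "prime_elem q" using add.prems(1) by simp
      then show "pord q (prod_mset ms) \<le> pord q h"
        using add.prems(2)[of q] \<open>q \<in># ms\<close> pord_mult[OF q pnz msnz] pord_mult[OF q pnz hnz] h by simp
    qed (use add.prems(1) in simp)
    then show ?case
      using mult_dvd_mono[of p p "u * prod_mset ms" h] h by (simp add: mult_ac)
  qed
  moreover have "pord q (prod_mset ms) \<le> pord q g" if "q \<in># ms" for q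
  proof -
    have q: "prime_elem q" using f(3) that by blast
    have "q dvd f" using that f(1) by (simp add: dvd_prod_mset)
    moreover have "pord q f = pord q (prod_mset ms)"
      using pord_mult[OF q, of u "prod_mset ms"] assms(1) f(1,2) pord_unit[OF q f(2)] by auto
    ultimately show ?thesis using assms(3)[OF q] by simp
  qed
  ultimately show ?thesis using assms(2) f(1) by simp
qed

text \<open>A normal monoid ring: the lattice is \<open>sublattice T\<close> and \<open>S\<close> is
  cut out by the functionals \<sigma>. \<open>facet_point\<close> gives a lattice point in the
  relative interior of each facet, so that no inequality follows from the others;
  \<open>facet_primitive\<close> normalises the valuations.\<close>

locale toric_cone =
  fixes R :: "'k::field laurent ring"
    and T :: "((nat \<Rightarrow>\<^sub>0 int) \<Rightarrow> int) set"
    and F :: "nat set"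
    and \<sigma> :: "nat \<Rightarrow> (nat \<Rightarrow>\<^sub>0 int) \<Rightarrow> int"
    and S :: "(nat \<Rightarrow>\<^sub>0 int) set"
  assumes S_def: "S = {a \<in> sublattice T. \<forall>i\<in>F. 0 \<le> \<sigma> i a}"
    and R_def: "R = laurent_ring \<lparr>carrier := kspan S\<rparr>"
    and T_additive: "\<forall>\<tau>\<in>T. Modules.additive \<tau>"
    and sigma_additive: "i \<in> F \<Longrightarrow> Modules.additive (\<sigma> i)"
    and finite_F: "finite F"
    and facet_point: "i \<in> F \<Longrightarrow> \<exists>s\<in>sublattice T. \<sigma> i s = 0 \<and> (\<forall>j\<in>F - {i}. 0 < \<sigma> j s)"
    and facet_primitive: "i \<in> F \<Longrightarrow> \<exists>a\<in>sublattice T. \<sigma> i a = 1"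
begin

abbreviation M :: "(nat \<Rightarrow>\<^sub>0 int) set" where "M \<equiv> sublattice T"

abbreviation K :: "'k laurent set" where "K \<equiv> kspan S"

lemma R_simps [simp]:
  "carrier R = K" "a \<otimes>\<^bsub>R\<^esub> b = a * b" "a \<oplus>\<^bsub>R\<^esub> b = a + b" "\<one>\<^bsub>R\<^esub> = 1" "\<zero>\<^bsub>R\<^esub> = 0"
  by (simp_all add: R_def laurent_ring_def)

lemma M_closed: "0 \<in> M" "a \<in> M \<Longrightarrow> b \<in> M \<Longrightarrow> a + b \<in> M" "a \<in> M \<Longrightarrow> - a \<in> M"
    "a \<in> M \<Longrightarrow> b \<in> M \<Longrightarrow> a - b \<in> M" "a \<in> M \<Longrightarrow> frag_cmul c a \<in> M"
proof -
  show "frag_cmul c a \<in> M" if "a \<in> M"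
  proof -
    have "\<tau> (frag_cmul c a) = 0" if "\<tau> \<in> T" for \<tau>
      using additive_frag_cmul[OF bspec[OF T_additive that], of c a] that \<open>a \<in> M\<close>
      by (simp add: sublattice_def)
    then show ?thesis by (simp add: sublattice_def)
  qed
qed (use T_additive in \<open>auto simp: sublattice_0 sublattice_add sublattice_minus sublattice_diff\<close>)

lemma M_sum: "(\<And>i. i \<in> I \<Longrightarrow> f i \<in> M) \<Longrightarrow> sum f I \<in> M"
  by (induction I rule: infinite_finite_induct) (auto intro: M_closed)

lemma sigma_simps [simp]:
  assumes "i \<in> F"
  shows "\<sigma> i 0 = 0" "\<sigma> i (a + b) = \<sigma> i a + \<sigma> i b" "\<sigma> i (- a) = - \<sigma> i a"
    "\<sigma> i (a - b) = \<sigma> i a - \<sigma> i b" "\<sigma> i (frag_cmul c a) = c * \<sigma> i a"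
    "\<sigma> i (sum f I) = (\<Sum>j\<in>I. \<sigma> i (f j))"
  using sigma_additive[OF assms]
  by (simp_all add: additive.zero additive.add additive.minus additive.diff additive_frag_cmul additive.sum)

lemma S_M: "a \<in> S \<Longrightarrow> a \<in> M"
  by (simp add: S_def)

lemma S_nonneg: "a \<in> S \<Longrightarrow> i \<in> F \<Longrightarrow> 0 \<le> \<sigma> i a"
  by (simp add: S_def)

lemma S_iff: "a \<in> S \<longleftrightarrow> a \<in> M \<and> (\<forall>i\<in>F. 0 \<le> \<sigma> i a)"
  by (simp add: S_def)

lemma S_0: "0 \<in> S"
  by (simp add: S_iff M_closed)

lemma S_add: "a \<in> S \<Longrightarrow> b \<in> S \<Longrightarrow> a + b \<in> S"
  by (simp add: S_iff M_closed)

lemma S_sum: "(\<And>i. i \<in> I \<Longrightarrow> f i \<in> S) \<Longrightarrow> sum f I \<in> S"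
  by (induction I rule: infinite_finite_induct) (auto intro: S_0 S_add)

lemma S_cmul: "a \<in> S \<Longrightarrow> 0 \<le> c \<Longrightarrow> frag_cmul c a \<in> S"
  by (simp add: S_iff M_closed)

lemma K_mult: "f \<in> K \<Longrightarrow> g \<in> K \<Longrightarrow> f * g \<in> K"
  by (erule kspan_mult) (auto intro: S_add)

lemma K_1: "1 \<in> K"
  by (simp add: kspan_def S_0)

lemma K_power: "f \<in> K \<Longrightarrow> f ^ n \<in> K"
  by (induction n) (auto intro: K_mult K_1)

lemma xpow_K_iff [simp]: "xpow a \<in> K \<longleftrightarrow> a \<in> S"
  by (simp add: kspan_single_iff)

lemma K_kspan_M: "f \<in> K \<Longrightarrow> f \<in> kspan M"
  by (rule kspan_mono[rotated]) (auto intro: S_M)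

lemma cring_R: "cring R"
proof (rule cringI)
  show "abelian_group R"
  proof (rule abelian_groupI)
    fix x assume "x \<in> carrier R"
    then show "\<exists>y\<in>carrier R. y \<oplus>\<^bsub>R\<^esub> x = \<zero>\<^bsub>R\<^esub>"
      by (intro bexI[of _ "- x"]) (auto intro: kspan_uminus)
  qed (auto intro: kspan_add)
  show "comm_monoid R"
    by (rule comm_monoidI) (auto intro: K_mult K_1 simp: mult_ac)
qed (auto simp: algebra_simps)

definition prime_ideal :: "'k laurent set \<Rightarrow> bool" where
  "prime_ideal p \<longleftrightarrow> p \<subseteq> K \<and> 0 \<in> p \<and> (\<forall>a\<in>p. \<forall>b\<in>p. a + b \<in> p) \<and> (\<forall>a\<in>p. \<forall>x\<in>K. x * a \<in> p)
    \<and> 1 \<notin> p \<and> (\<forall>a\<in>K. \<forall>b\<in>K. a * b \<in> p \<longrightarrow> a \<in> p \<or> b \<in> p)"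

lemma primeideal_iff: "primeideal p R \<longleftrightarrow> prime_ideal p"
proof
  assume "primeideal p R"
  then interpret primeideal p R .
  show "prime_ideal p"
    unfolding prime_ideal_def
  proof (intro conjI ballI impI subsetI)
    show "1 \<notin> p"
      using I_notcarr one_imp_carrier by auto
    show "0 \<in> p" using additive_subgroup.zero_closed[OF is_additive_subgroup] by simp
    show "x \<in> K" if "x \<in> p" for x using that Icarr by simp
    show "a + b \<in> p" if "a \<in> p" "b \<in> p" for a b using additive_subgroup.a_closed[OF is_additive_subgroup that] by simp
    show "x * a \<in> p" if "a \<in> p" "x \<in> K" for a x using I_l_closed[of a x] that by simp
    show "a \<in> p \<or> b \<in> p" if "a \<in> K" "b \<in> K" "a * b \<in> p" for a b
      using I_prime[of a b] that by simp
  qed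
next
  assume p: "prime_ideal p"
  interpret R: cring R by (rule cring_R)
  have neg: "\<ominus>\<^bsub>R\<^esub> x = - x" if "x \<in> K" for x
    using R.minus_equality[of "- x" x] that kspan_uminus[OF that]
    by (metis R_simps(1,3,5) add.right_inverse add.left_inverse)
  have neg_p: "- x \<in> p" if "x \<in> p" for x
  proof -
    have "- 1 * x \<in> p"
      using p that kspan_uminus[OF K_1] unfolding prime_ideal_def by blast
    then show ?thesis by simp
  qed
  have id: "ideal p R"
  proof (rule idealI[OF R.ring_axioms])
    show "subgroup p (add_monoid R)"
    proof (rule group.subgroupI)
      show "group (add_monoid R)" by (rule R.a_group)
      fix a assume "a \<in> p"
      then show "inv\<^bsub>add_monoid R\<^esub> a \<in> p"
        using neg[of a] neg_p[of a] p by (auto simp: a_inv_def prime_ideal_def)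
    qed (use p in \<open>auto simp: prime_ideal_def\<close>)
  qed (use p in \<open>auto simp: prime_ideal_def mult.commute\<close>)
  show "primeideal p R"
    by (rule primeidealI[OF id cring_R]) (use p K_1 in \<open>auto simp: prime_ideal_def\<close>)
qed

lemma prime_idealD:
  assumes "prime_ideal p"
  shows "a \<in> p \<Longrightarrow> a \<in> K" "0 \<in> p" "a \<in> p \<Longrightarrow> b \<in> p \<Longrightarrow> a + b \<in> p"
    "a \<in> p \<Longrightarrow> x \<in> K \<Longrightarrow> x * a \<in> p" "1 \<notin> p"
    "a * b \<in> p \<Longrightarrow> a \<in> K \<Longrightarrow> b \<in> K \<Longrightarrow> a \<in> p \<or> b \<in> p"
  using assms unfolding prime_ideal_def by blast+

lemma prime_ideal_sum:
  "prime_ideal p \<Longrightarrow> (\<And>i. i \<in> I \<Longrightarrow> f i \<in> p) \<Longrightarrow> sum f I \<in> p"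
  by (induction I rule: infinite_finite_induct) (auto intro: prime_idealD)

lemma prime_ideal_powerD:
  assumes "prime_ideal p" "x \<in> K" "x ^ n \<in> p"
  shows "x \<in> p"
  using assms(3)
proof (induction n)
  case 0
  then show ?case using prime_idealD(5)[OF assms(1)] by simp
next
  case (Suc n)
  then show ?case using prime_idealD(6)[OF assms(1), of x "x ^ n"] assms(2) K_power by auto
qed

lemma prime_ideal_prod_mset:
  assumes "prime_ideal p" "prod_mset ms \<in> p" "\<And>x. x \<in># ms \<Longrightarrow> x \<in> K"
  shows "\<exists>x\<in>#ms. x \<in> p"
  using assms(2,3)
proof (induction ms)
  case empty
  then show ?case using prime_idealD(5)[OF assms(1)] by simp
next
  case (add x ms)
  have "prod_mset ms \<in> K"
    using add.prems(2) by (induction ms) (auto intro: K_mult K_1)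
  then show ?case
    using add prime_idealD(6)[OF assms(1), of x "prod_mset ms"] by auto
qed

text \<open>Its monomial lies outside \<open>facet_prime i\<close> and has positive height over
  every other facet; multiplying by its powers replaces localization at that prime.\<close>

definition facet_pt :: "nat \<Rightarrow> (nat \<Rightarrow>\<^sub>0 int)" where
  "facet_pt i = (SOME s. s \<in> M \<and> \<sigma> i s = 0 \<and> (\<forall>j\<in>F - {i}. 0 < \<sigma> j s))"

lemma facet_pt:
  assumes "i \<in> F"
  shows "facet_pt i \<in> M" "\<sigma> i (facet_pt i) = 0" "\<And>j. j \<in> F \<Longrightarrow> j \<noteq> i \<Longrightarrow> 0 < \<sigma> j (facet_pt i)"
    "facet_pt i \<in> S"
proof -
  have ex: "\<exists>s. s \<in> M \<and> \<sigma> i s = 0 \<and> (\<forall>j\<in>F - {i}. 0 < \<sigma> j s)"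
    using facet_point[OF assms] by blast
  have *: "facet_pt i \<in> M \<and> \<sigma> i (facet_pt i) = 0 \<and> (\<forall>j\<in>F - {i}. 0 < \<sigma> j (facet_pt i))"
    unfolding facet_pt_def by (rule someI_ex[OF ex])
  then show "facet_pt i \<in> M" "\<sigma> i (facet_pt i) = 0" "\<And>j. j \<in> F \<Longrightarrow> j \<noteq> i \<Longrightarrow> 0 < \<sigma> j (facet_pt i)"
    by auto
  then show "facet_pt i \<in> S"
    unfolding S_iff by (metis less_imp_le order_refl)
qed

lemma abs_bound: "j \<in> F \<Longrightarrow> - (\<Sum>j\<in>F. \<bar>\<sigma> j a\<bar>) \<le> \<sigma> j a"
  using member_le_sum[of j F "\<lambda>j. \<bar>\<sigma> j a\<bar>"] finite_F by force

text \<open>Stated with \<open>eventually\<close> so that one exponent serves all the finitely many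
  terms of a polynomial.\<close>

lemma eventually_push_facet:
  assumes "a \<in> M" "i \<in> F" "0 \<le> \<sigma> i a"
  shows "eventually (\<lambda>n. a + frag_cmul (int n) (facet_pt i) \<in> S) sequentially"
proof (rule eventually_sequentiallyI[of "nat (\<Sum>j\<in>F. \<bar>\<sigma> j a\<bar>)"])
  fix n assume n: "nat (\<Sum>j\<in>F. \<bar>\<sigma> j a\<bar>) \<le> n"
  have "0 \<le> \<sigma> j (a + frag_cmul (int n) (facet_pt i))" if j: "j \<in> F" for j
  proof (cases "j = i")
    case False
    have "int n * 1 \<le> int n * \<sigma> j (facet_pt i)"
      using facet_pt(3)[OF assms(2) j False] by (intro mult_left_mono) auto
    then show ?thesis
      using n abs_bound[OF j, of a] j by simp
  qed (use assms facet_pt[OF assms(2)] in simp)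
  then show "a + frag_cmul (int n) (facet_pt i) \<in> S"
    using assms facet_pt(1)[OF assms(2)] by (simp add: S_iff M_closed)
qed

lemma unit_height_point:
  assumes "i \<in> F"
  obtains e where "e \<in> S" "\<sigma> i e = 1"
proof -
  obtain a where a: "a \<in> M" "\<sigma> i a = 1"
    using facet_primitive[OF assms] by blast
  have "\<exists>n. a + frag_cmul (int n) (facet_pt i) \<in> S"
    using eventually_happens'[OF _ eventually_push_facet[OF a(1) assms]] a by simp
  then show ?thesis
    using that a assms facet_pt(2)[OF assms] by auto
qed

definition interior_pt :: "nat \<Rightarrow>\<^sub>0 int" where
  "interior_pt = (SOME w. w \<in> S \<and> (\<forall>j\<in>F. 1 \<le> \<sigma> j w))"

lemma interior_pt: "interior_pt \<in> S" "\<And>j. j \<in> F \<Longrightarrow> 1 \<le> \<sigma> j interior_pt"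
proof -
  have "\<forall>i\<in>F. \<exists>e. e \<in> S \<and> \<sigma> i e = 1"
    using unit_height_point by blast
  then obtain e where e: "\<And>i. i \<in> F \<Longrightarrow> e i \<in> S \<and> \<sigma> i (e i) = 1"
    by metis
  have "sum e F \<in> S"
    using e by (intro S_sum) auto
  moreover have "1 \<le> \<sigma> j (sum e F)" if j: "j \<in> F" for j
  proof -
    have "\<forall>i\<in>F. 0 \<le> \<sigma> j (e i)" using e j S_nonneg by blast
    then show ?thesis
      using member_le_sum[of j F "\<lambda>i. \<sigma> j (e i)"] finite_F e j by simp
  qed
  ultimately have "\<exists>w. w \<in> S \<and> (\<forall>j\<in>F. 1 \<le> \<sigma> j w)" by blast
  from someI_ex[OF this] show "interior_pt \<in> S" "\<And>j. j \<in> F \<Longrightarrow> 1 \<le> \<sigma> j interior_pt"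
    by (auto simp: interior_pt_def)
qed

lemma eventually_push_positive:
  assumes "a \<in> M" "w \<in> S" "\<And>j. j \<in> F \<Longrightarrow> 0 < \<sigma> j w"
  shows "eventually (\<lambda>n. a + frag_cmul (int n) w \<in> S) sequentially"
proof (rule eventually_sequentiallyI[of "nat (\<Sum>j\<in>F. \<bar>\<sigma> j a\<bar>)"])
  fix n assume n: "nat (\<Sum>j\<in>F. \<bar>\<sigma> j a\<bar>) \<le> n"
  have "0 \<le> \<sigma> j (a + frag_cmul (int n) w)" if j: "j \<in> F" for j
  proof -
    have "int n * 1 \<le> int n * \<sigma> j w"
      using assms(3)[OF j] by (intro mult_left_mono) auto
    then show ?thesis
      using n abs_bound[OF j, of a] j by simp
  qed
  then show "a + frag_cmul (int n) w \<in> S"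
    using assms S_M by (simp add: S_iff M_closed)
qed

text \<open>The group algebra of \<open>M\<close> is the localization of \<open>K\<close> at its
  monomials; multiples of an interior point serve as denominators.\<close>

lemma clear_denominators:
  assumes "f \<in> kspan M"
  obtains c where "c \<in> S" "xpow c * f \<in> K"
proof -
  have "eventually (\<lambda>n. \<forall>a\<in>Poly_Mapping.keys f. a + frag_cmul (int n) interior_pt \<in> S) sequentially"
    using assms interior_pt
    by (intro eventually_ball_finite ballI eventually_push_positive) (force simp: kspan_def)+
  then obtain n where n: "\<forall>a\<in>Poly_Mapping.keys f. a + frag_cmul (int n) interior_pt \<in> S"
    using eventually_happens' by force
  let ?c = "frag_cmul (int n) interior_pt"
  have "xpow ?c * f \<in> K"
    by (rule kspan_mult[of "xpow ?c" "{?c}" f "Poly_Mapping.keys f"]) (use n in \<open>auto simp: kspan_def add.commute\<close>)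
  then show ?thesis
    using that[OF S_cmul[OF interior_pt(1), of "int n"]] by simp
qed

lemma clear_denominator:
  assumes "b \<in> M"
  obtains c where "c \<in> S" "c + b \<in> S"
proof -
  have "(xpow b :: 'k laurent) \<in> kspan M" using assms by (simp add: kspan_single_iff)
  then obtain c where "c \<in> S" "xpow c * xpow b \<in> K"
    using clear_denominators by blast
  then show ?thesis using that by (simp add: mult_single)
qed

section \<open>Monomial primes of the facets\<close>

definition facet_prime :: "nat \<Rightarrow> 'k laurent set" where
  "facet_prime i = kspan {a \<in> S. 0 < \<sigma> i a}"

lemma val_nonneg: "f \<in> K \<Longrightarrow> f \<noteq> 0 \<Longrightarrow> i \<in> F \<Longrightarrow> 0 \<le> val (\<sigma> i) f"
  by (auto simp: val_ge_iff kspan_def intro: S_nonneg)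

lemma facet_prime_iff:
  assumes "f \<in> K" "f \<noteq> 0"
  shows "f \<in> facet_prime i \<longleftrightarrow> 0 < val (\<sigma> i) f"
  using assms val_ge_iff[OF assms(2), of 1 "\<sigma> i"] by (force simp: facet_prime_def kspan_def)

lemma prime_ideal_facet_prime:
  assumes i: "i \<in> F"
  shows "prime_ideal (facet_prime i)"
  unfolding prime_ideal_def
proof (intro conjI ballI impI)
  show "facet_prime i \<subseteq> K"
    by (auto simp: facet_prime_def kspan_def)
  show "1 \<notin> facet_prime i"
    using i by (simp add: facet_prime_def kspan_def)
  show "x * a \<in> facet_prime i" if "a \<in> facet_prime i" "x \<in> K" for a x
    unfolding facet_prime_def
    by (rule kspan_mult[OF that(2) that(1)[unfolded facet_prime_def]])
      (use i S_nonneg in \<open>auto intro: S_add add_nonneg_pos\<close>)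
  show "a \<in> facet_prime i \<or> b \<in> facet_prime i" if ab: "a \<in> K" "b \<in> K" "a * b \<in> facet_prime i" for a b
  proof (cases "a = 0 \<or> b = 0")
    case False
    then have "0 < val (\<sigma> i) (a * b)"
      using ab facet_prime_iff[of "a * b" i] K_mult by auto
    then show ?thesis
      using False ab val_mult[OF sigma_additive[OF i], of a b] facet_prime_iff[of a i] facet_prime_iff[of b i]
      by auto
  qed (auto simp: facet_prime_def)
qed (auto simp: facet_prime_def intro: kspan_add)

lemma xpow_facet_prime_iff: "xpow a \<in> facet_prime i \<longleftrightarrow> a \<in> S \<and> 0 < \<sigma> i a"
  by (simp add: facet_prime_def kspan_single_iff)

lemma facet_prime_subsetI:
  assumes "prime_ideal p" "\<And>b. b \<in> S \<Longrightarrow> 0 < \<sigma> i b \<Longrightarrow> xpow b \<in> p"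
  shows "facet_prime i \<subseteq> p"
proof
  fix f assume f: "f \<in> facet_prime i"
  have "Poly_Mapping.single b c \<in> p" if "b \<in> S" "0 < \<sigma> i b" for b c
  proof -
    have "Poly_Mapping.single 0 c * xpow b \<in> p"
      using that assms by (intro prime_idealD(4)) (auto intro: kspan_single S_0)
    then show ?thesis by (simp add: mult_single)
  qed
  then have "(\<Sum>a\<in>Poly_Mapping.keys f. Poly_Mapping.single a (Poly_Mapping.lookup f a)) \<in> p"
    using f by (intro prime_ideal_sum assms) (auto simp: facet_prime_def kspan_def)
  then show "f \<in> p"
    unfolding sum_singles[of f, symmetric] .
qed

text \<open>These primes survive when all monomials are inverted; every other height one prime will
  be a facet prime.\<close>

definition monomial_free :: "'k laurent set \<Rightarrow> bool" where
  "monomial_free p \<longleftrightarrow> (\<forall>a\<in>S. xpow a \<notin> p)"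

lemma monomial_free_cancel:
  assumes "prime_ideal p" "monomial_free p" "h \<in> K" "c \<in> S" "xpow c * h \<in> p"
  shows "h \<in> p"
  using assms prime_idealD(6)[OF assms(1,5)] by (auto simp: monomial_free_def)

text \<open>If \<open>q\<close> were monomial-free, some \<open>f\<close> in \<open>q\<close> could
  be divided by a monomial of height \<open>val (\<sigma> i) f\<close>, leaving an element of
  \<open>q\<close> of height zero. A monomial \<open>a\<close> in \<open>q\<close> instead divides a
  power of every \<open>b\<close> of positive height, up to a power of \<open>facet_pt i\<close>,
  which is not in \<open>q\<close>.\<close>

lemma prime_subset_facet_prime:
  assumes q: "prime_ideal q" "q \<noteq> {0}" "q \<subseteq> facet_prime i" and i: "i \<in> F"
  shows "q = facet_prime i"
proof (cases "monomial_free q")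
  case True
  obtain f where f: "f \<in> q" "f \<noteq> 0"
    using q(1,2) prime_idealD(2) by blast
  have fK: "f \<in> K" using f(1) q(1) prime_idealD(1) by blast
  have vf: "0 < val (\<sigma> i) f"
    using facet_prime_iff[OF fK f(2)] f(1) q(3) by blast
  obtain e where e: "e \<in> S" "\<sigma> i e = 1"
    using unit_height_point[OF i] by blast
  define b0 where "b0 = - frag_cmul (val (\<sigma> i) f) e"
  have b0: "b0 \<in> M" "\<sigma> i b0 = - val (\<sigma> i) f"
    using e i S_M by (auto simp: b0_def intro: M_closed)
  have "\<forall>a\<in>Poly_Mapping.keys f. eventually (\<lambda>n. a + b0 + frag_cmul (int n) (facet_pt i) \<in> S) sequentially"
  proof
    fix a assume a: "a \<in> Poly_Mapping.keys f"
    then have "a \<in> M" using fK S_M by (auto simp: kspan_def)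
    then show "eventually (\<lambda>n. a + b0 + frag_cmul (int n) (facet_pt i) \<in> S) sequentially"
      using b0 i val_le[OF a, of "\<sigma> i"] by (intro eventually_push_facet) (auto intro: M_closed)
  qed
  then have "eventually (\<lambda>n. \<forall>a\<in>Poly_Mapping.keys f. a + b0 + frag_cmul (int n) (facet_pt i) \<in> S) sequentially"
    by (intro eventually_ball_finite) auto
  then obtain n where n: "\<forall>a\<in>Poly_Mapping.keys f. a + b0 + frag_cmul (int n) (facet_pt i) \<in> S"
    using eventually_happens' by force
  let ?b = "b0 + frag_cmul (int n) (facet_pt i)"
  have bM: "?b \<in> M" using b0 facet_pt(1)[OF i] by (auto intro: M_closed)
  have bK: "xpow ?b * f \<in> K"
    by (rule kspan_mult[of "xpow ?b" "{?b}" f "Poly_Mapping.keys f"]) (use n in \<open>auto simp: kspan_def add_ac\<close>)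
  obtain c where c: "c \<in> S" "c + ?b \<in> S"
    using clear_denominator[OF bM] by blast
  have "xpow (c + ?b) * f \<in> q"
    by (rule prime_idealD(4)[OF q(1) f(1)]) (use c in simp)
  then have "xpow c * (xpow ?b * f) \<in> q"
    by (simp add: mult.assoc[symmetric] mult_single)
  then have "xpow ?b * f \<in> q"
    by (rule monomial_free_cancel[OF q(1) True bK c(1)])
  then have "xpow ?b * f \<in> facet_prime i" using q(3) by blast
  then have "0 < val (\<sigma> i) (xpow ?b * f)"
    using facet_prime_iff[OF bK] f(2) by simp
  then show ?thesis
    using val_mult[OF sigma_additive[OF i], of "xpow ?b" f] f(2) b0 i facet_pt(2)[OF i] by simp
next
  case False
  then obtain a where a: "a \<in> S" "xpow a \<in> q" by (auto simp: monomial_free_def)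
  have "facet_prime i \<subseteq> q"
  proof (rule facet_prime_subsetI[OF q(1)])
    fix b assume b: "b \<in> S" "0 < \<sigma> i b"
    define m where "m = \<sigma> i a"
    have m: "0 \<le> m" using S_nonneg[OF a(1) i] by (simp add: m_def)
    have "m * 1 \<le> m * \<sigma> i b" using b m by (intro mult_left_mono) auto
    then have "0 \<le> \<sigma> i (frag_cmul m b - a)" using i by (simp add: m_def)
    then have "\<exists>n. (frag_cmul m b - a) + frag_cmul (int n) (facet_pt i) \<in> S"
      using a b i S_M by (intro eventually_happens'[OF _ eventually_push_facet]) (auto intro: M_closed)
    then obtain n where n: "(frag_cmul m b - a) + frag_cmul (int n) (facet_pt i) \<in> S" by blast
    have "xpow ((frag_cmul m b - a) + frag_cmul (int n) (facet_pt i)) * xpow a \<in> q"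
      by (rule prime_idealD(4)[OF q(1) a(2)]) (use n in simp)
    then have "xpow b ^ nat m * xpow (facet_pt i) ^ n \<in> q"
      using m by (simp add: mult_single xpow_power algebra_simps)
    moreover have "xpow (facet_pt i) ^ n \<notin> q"
      using prime_ideal_powerD[OF q(1), of "xpow (facet_pt i)" n] facet_pt[OF i] q(3) xpow_facet_prime_iff[of "facet_pt i" i]
      by auto
    ultimately have "xpow b ^ nat m \<in> q"
      using prime_idealD(6)[OF q(1)] b facet_pt(4)[OF i] K_power by (metis xpow_K_iff)
    then show "xpow b \<in> q"
      using prime_ideal_powerD[OF q(1)] b by simp
  qed
  then show ?thesis using q(3) by blast
qed

lemma facet_prime_nonzero: "i \<in> F \<Longrightarrow> facet_prime i \<noteq> {0}"
  using unit_height_point[of i] xpow_facet_prime_iff by (metis monom_nonzero singletonD zero_less_one)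

lemma height_one_primes_iff:
  "p \<in> height_one_primes R \<longleftrightarrow> prime_ideal p \<and> p \<noteq> {0} \<and> (\<forall>q. prime_ideal q \<and> q \<subseteq> p \<longrightarrow> q = {0} \<or> q = p)"
  by (simp add: height_one_primes_def primeideal_iff)

lemma facet_prime_height_one:
  assumes "i \<in> F"
  shows "facet_prime i \<in> height_one_primes R"
  unfolding height_one_primes_iff
proof (intro conjI allI impI)
  fix q assume "prime_ideal q \<and> q \<subseteq> facet_prime i"
  then show "q = {0} \<or> q = facet_prime i"
    using prime_subset_facet_prime[OF _ _ _ assms, of q] by argo
qed (rule prime_ideal_facet_prime[OF assms] facet_prime_nonzero[OF assms])+

text \<open>Otherwise every facet has a monomial of positive height outside \<open>p\<close>. Their
  product is outside \<open>p\<close> and interior, so one of its powers is a multiple of the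
  monomial in \<open>p\<close>.\<close>

lemma height_one_prime_cases:
  assumes p: "p \<in> height_one_primes R" "\<not> monomial_free p"
  shows "\<exists>i\<in>F. p = facet_prime i"
proof -
  have pp: "prime_ideal p" using p by (simp add: height_one_primes_iff)
  obtain a where a: "a \<in> S" "xpow a \<in> p" using p by (auto simp: monomial_free_def)
  have "\<exists>i\<in>F. facet_prime i \<subseteq> p"
  proof (rule ccontr)
    assume "\<not> ?thesis"
    then have "\<forall>i\<in>F. \<exists>b. b \<in> S \<and> 0 < \<sigma> i b \<and> xpow b \<notin> p"
      using facet_prime_subsetI[OF pp] by blast
    then obtain b where b: "\<And>i. i \<in> F \<Longrightarrow> b i \<in> S \<and> 0 < \<sigma> i (b i) \<and> xpow (b i) \<notin> p"
      by metis
    have "sum b G \<in> S \<and> xpow (sum b G) \<notin> p" if "finite G" "G \<subseteq> F" for G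
      using that
    proof (induction G rule: finite_induct)
      case empty
      then show ?case using prime_idealD(5)[OF pp] S_0 by simp
    next
      case (insert i G)
      have "xpow (b i + sum b G) = xpow (b i) * (xpow (sum b G) :: 'k laurent)"
        by (simp add: mult_single)
      then show ?case
        using insert b[of i] prime_idealD(6)[OF pp, of "xpow (b i)" "xpow (sum b G)"] by (auto intro: S_add)
    qed
    then have w: "sum b F \<in> S" "xpow (sum b F) \<notin> p" using finite_F by auto
    have "0 < \<sigma> j (sum b F)" if "j \<in> F" for j
      using that b finite_F S_nonneg
      by (simp add: sum_pos2[of F j])
    then obtain n where n: "- a + frag_cmul (int n) (sum b F) \<in> S"
      using eventually_happens'[OF _ eventually_push_positive[of "- a" "sum b F"]] w(1) a S_M M_closed by force
    have "xpow (- a + frag_cmul (int n) (sum b F)) * xpow a \<in> p"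
      by (rule prime_idealD(4)[OF pp a(2)]) (use n in simp)
    then have "xpow (sum b F) ^ n \<in> p"
      by (simp add: mult_single xpow_power)
    then show False
      using prime_ideal_powerD[OF pp] w by simp
  qed
  then obtain i where i: "i \<in> F" "facet_prime i \<subseteq> p" by blast
  then have "facet_prime i = p"
    using p(1) prime_ideal_facet_prime[OF i(1)] facet_prime_nonzero[OF i(1)]
    unfolding height_one_primes_iff by blast
  then show ?thesis using i by blast
qed

end

section \<open>Primes containing no monomial\<close>

lemma prime_elem_xpow_mult: "prime_elem q \<Longrightarrow> prime_elem (xpow a * q :: 'k::field laurent)"
  by (auto simp: prime_elem_def)

lemma prime_elem_dvd_prime_elem:
  fixes p q :: "'k::field laurent"
  assumes "prime_elem p" "prime_elem q" "q dvd p"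
  shows "p dvd q"
proof -
  obtain e where e: "p = q * e" using assms(3) by auto
  then have "p dvd q * e" by simp
  then have "p dvd q \<or> p dvd e" by (rule prime_elem_dvd_multD[OF assms(1)])
  moreover have "\<not> p dvd e"
    using e assms(1) prime_elem_not_unit[OF assms(2)] by auto
  ultimately show ?thesis by blast
qed

lemma pord_cong:
  assumes "p dvd q" "q dvd p"
  shows "pord p f = pord q f"
proof -
  have "p ^ n dvd f \<longleftrightarrow> q ^ n dvd f" for n
    using dvd_power_same[OF assms(1), of n] dvd_power_same[OF assms(2), of n] dvd_trans by blast
  then show ?thesis by (simp add: pord_def)
qed

lemma val_power:
  fixes f :: "'k::field laurent"
  assumes "Modules.additive \<tau>" "f \<noteq> 0"
  shows "val \<tau> (f ^ n) = int n * val \<tau> f"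
  by (induction n) (use assms in \<open>simp_all add: val_1 val_mult algebra_simps\<close>)

lemma val_prod:
  fixes f :: "'i \<Rightarrow> 'k::field laurent"
  assumes "Modules.additive \<tau>" "\<And>i. i \<in> I \<Longrightarrow> f i \<noteq> 0"
  shows "val \<tau> (prod f I) = (\<Sum>i\<in>I. val \<tau> (f i))"
  using assms(2)
  by (induction I rule: infinite_finite_induct) (simp_all add: val_1[OF assms(1)] val_mult[OF assms(1)])

context toric_cone
begin

definition principal_prime :: "'k laurent \<Rightarrow> 'k laurent set" where
  "principal_prime q = {f \<in> K. q dvd f}"

lemma K_quotient:
  assumes "f * g \<in> kspan M" "f \<in> kspan M" "f \<noteq> 0"
  shows "g \<in> kspan M"
  by (rule kspan_quotient[OF T_additive assms])

text \<open>\<open>kspan_factor\<close> moves the divisor into the group algebra and an interior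
  monomial moves it on into \<open>K\<close>. Both shifts are units of the Laurent ring, so
  primality is not affected.\<close>

lemma associate_in_K:
  assumes "f \<in> kspan M" "f \<noteq> 0" "q dvd f"
  obtains b where "xpow b * q \<in> K"
proof -
  obtain g where g: "f = q * g" using assms(3) by auto
  obtain a where "xpow a * q \<in> kspan M"
    using kspan_factor[OF T_additive, of q g] assms g by metis
  then obtain c where "xpow c * (xpow a * q) \<in> K"
    using clear_denominators by metis
  then have "xpow (c + a) * q \<in> K"
    by (simp add: mult.assoc[symmetric] mult_single)
  then show ?thesis by (rule that)
qed

lemma prime_ideal_principal_prime:
  assumes "prime_elem q"
  shows "prime_ideal (principal_prime q)" "monomial_free (principal_prime q)"
proof -
  show "prime_ideal (principal_prime q)"
    unfolding prime_ideal_def principal_prime_def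
    using assms prime_elem_not_unit[OF assms] K_mult prime_elem_dvd_multD[OF assms]
    by (auto intro: kspan_add)
  have "\<not> q dvd xpow a" for a
    using dvd_trans[of q "xpow a" 1] prime_elem_not_unit[OF assms] by auto
  then show "monomial_free (principal_prime q)"
    by (auto simp: monomial_free_def principal_prime_def)
qed

text \<open>The cofactor of \<open>q\<close> lies only in the group algebra; the monomial that
  clears its denominators is cancelled because \<open>p\<close> contains no monomial.\<close>

lemma principal_prime_subset:
  assumes p: "prime_ideal p" "monomial_free p" and q: "q \<in> p" "q \<noteq> 0"
  shows "principal_prime q \<subseteq> p"
proof
  fix g assume g: "g \<in> principal_prime q"
  then obtain h where h: "g = q * h" by (auto simp: principal_prime_def)
  have qK: "q \<in> K" using p q prime_idealD(1) by blast
  have "h \<in> kspan M"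
    using K_quotient[of q h] g qK q(2) h K_kspan_M by (simp add: principal_prime_def)
  then obtain c where c: "c \<in> S" "xpow c * h \<in> K"
    using clear_denominators by blast
  have "(xpow c * h) * q \<in> p"
    by (rule prime_idealD(4)[OF p(1) q(1) c(2)])
  then have "xpow c * g \<in> p"
    using h by (simp add: mult_ac)
  then show "g \<in> p"
    using monomial_free_cancel[OF p _ c(1)] g by (simp add: principal_prime_def)
qed

text \<open>The prime factors of an element of \<open>p\<close> have associates in \<open>K\<close>,
  whose product is a multiple of that element up to a monomial denominator; \<open>p\<close> cancels
  the denominator and so contains one of the associates.\<close>

lemma monomial_free_contains_prime_elem:
  assumes p: "prime_ideal p" "monomial_free p" "p \<noteq> {0}"
  obtains q where "q \<in> p" "prime_elem q"
proof -
  obtain f where f: "f \<in> p" "f \<noteq> 0"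
    using p prime_idealD(2) by blast
  have fK: "f \<in> K" using f p prime_idealD(1) by blast
  obtain u ms where ums: "f = u * prod_mset ms" "u dvd 1" "\<And>q. q \<in># ms \<Longrightarrow> prime_elem q"
    using laurent_prime_factorization[OF f(2)] by blast
  have "\<exists>b. xpow b * q \<in> K" if "q \<in># ms" for q
  proof -
    have "q dvd f" using that ums(1) by (simp add: dvd_prod_mset)
    then show ?thesis using associate_in_K[OF K_kspan_M[OF fK] f(2)] by blast
  qed
  then obtain b where b: "\<And>q. q \<in># ms \<Longrightarrow> xpow (b q) * q \<in> K" by metis
  define ms' where "ms' = image_mset (\<lambda>q. xpow (b q) * q) ms"
  have "\<exists>B. prod_mset (image_mset (\<lambda>q. xpow (b q) * q) ms) = xpow B * (prod_mset ms :: 'k laurent)" for ms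
  proof (induction ms)
    case empty
    then show ?case by (auto intro: exI[of _ 0])
  next
    case (add q ms)
    then obtain B where "prod_mset (image_mset (\<lambda>q. xpow (b q) * q) ms) = xpow B * prod_mset ms" by blast
    then have "prod_mset (image_mset (\<lambda>q. xpow (b q) * q) (add_mset q ms)) = (xpow (b q) * xpow B) * prod_mset (add_mset q ms)"
      by (simp add: mult_ac)
    then show ?case by (auto simp: mult_single)
  qed
  then obtain B where B: "prod_mset ms' = xpow B * prod_mset ms" unfolding ms'_def by blast
  have ms'K: "q \<in> K" if "q \<in># ms'" for q
    using that b by (auto simp: ms'_def)
  have prodK: "prod_mset ms' \<in> K"
    using ms'K by (induction ms') (auto intro: K_mult K_1)
  obtain v where v: "u * v = 1" using ums(2) by (metis dvdE)
  define v' where "v' = xpow B * v"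
  have eq: "prod_mset ms' = v' * f"
  proof -
    have "v' * f = xpow B * (u * v) * prod_mset ms"
      unfolding v'_def ums(1) by (simp only: mult_ac)
    then show ?thesis unfolding v B by simp
  qed
  then have "v' \<in> kspan M"
    using K_quotient[of f v'] K_kspan_M[OF fK] K_kspan_M[OF prodK] f(2) by (simp add: mult.commute)
  then obtain c where c: "c \<in> S" "xpow c * v' \<in> K"
    using clear_denominators by blast
  have "(xpow c * v') * f \<in> p"
    by (rule prime_idealD(4)[OF p(1) f(1) c(2)])
  then have "xpow c * prod_mset ms' \<in> p"
    by (simp add: eq mult.assoc)
  then have "prod_mset ms' \<in> p"
    by (rule monomial_free_cancel[OF p(1,2) prodK c(1)])
  then obtain q where "q \<in># ms'" "q \<in> p"
    using prime_ideal_prod_mset[OF p(1)] ms'K by blast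
  then show ?thesis
    using that ums(3) by (auto simp: ms'_def prime_elem_xpow_mult)
qed

lemma monomial_free_subset: "monomial_free p \<Longrightarrow> q \<subseteq> p \<Longrightarrow> monomial_free q"
  by (auto simp: monomial_free_def)

lemma principal_prime_height_one:
  assumes "prime_elem q" "q \<in> K"
  shows "principal_prime q \<in> height_one_primes R"
  unfolding height_one_primes_iff
proof (intro conjI allI impI)
  have "q \<in> principal_prime q" "q \<noteq> 0" using assms by (auto simp: principal_prime_def)
  then show "principal_prime q \<noteq> {0}" by blast
  show "prime_ideal (principal_prime q)" by (rule prime_ideal_principal_prime[OF assms(1)])
  fix r assume r: "prime_ideal r \<and> r \<subseteq> principal_prime q"
  then have mf: "monomial_free r"
    using prime_ideal_principal_prime(2)[OF assms(1)] monomial_free_subset by blast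
  show "r = {0} \<or> r = principal_prime q"
  proof (rule disjCI)
    assume nz: "r \<noteq> principal_prime q"
    show "r = {0}"
    proof (rule ccontr)
      assume "r \<noteq> {0}"
      then obtain q' where q': "q' \<in> r" "prime_elem q'"
        using monomial_free_contains_prime_elem[of r] r mf by blast
      then have "q dvd q'" using r by (auto simp: principal_prime_def)
      then have "q' dvd q" using prime_elem_dvd_prime_elem assms q' by blast
      then have "principal_prime q \<subseteq> principal_prime q'"
        by (auto simp: principal_prime_def intro: dvd_trans)
      moreover have "principal_prime q' \<subseteq> r"
        using q' r mf by (intro principal_prime_subset) auto
      ultimately show False using nz r by blast
    qed
  qed
qed

lemma height_one_monomial_free:
  assumes p: "p \<in> height_one_primes R" "monomial_free p"
  shows "\<exists>q\<in>K. prime_elem q \<and> p = principal_prime q"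
proof -
  have pp: "prime_ideal p" "p \<noteq> {0}" using p by (auto simp: height_one_primes_iff)
  obtain q where q: "q \<in> p" "prime_elem q"
    using monomial_free_contains_prime_elem[OF pp(1) p(2) pp(2)] by blast
  have qK: "q \<in> K" using q pp prime_idealD(1) by blast
  have "principal_prime q \<subseteq> p"
    using q by (intro principal_prime_subset pp p) auto
  then have "principal_prime q = p"
    using p(1) principal_prime_height_one[OF q(2) qK] unfolding height_one_primes_iff by blast
  then show ?thesis using q qK by blast
qed

subsection \<open>Vanishing orders\<close>

text \<open>\<open>D\<close> is a filtration in which multiplication by \<open>p\<close> raises the
  index by one. The zeroth ideal power is the whole carrier, hence the hypothesis on
  \<open>D 0\<close>.\<close>

lemma ideal_pow_subset:
  assumes "K \<subseteq> D 0" "\<And>n a b. a \<in> D n \<Longrightarrow> b \<in> p \<Longrightarrow> a * b \<in> D (Suc n)"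
    "\<And>n a b. a \<in> D n \<Longrightarrow> b \<in> D n \<Longrightarrow> a + b \<in> D n"
  shows "p [^]\<^bsub>ideals_set R\<^esub> (n :: nat) \<subseteq> D n"
proof (induction n)
  case 0
  then show ?case using assms(1) by (simp add: nat_pow_def ideals_set_def)
next
  case (Suc n)
  have "x \<in> D (Suc n)" if "x \<in> ideal_prod R (p [^]\<^bsub>ideals_set R\<^esub> n) p" for x
    using that
  proof (induction rule: ideal_prod.induct)
    case (prod i j)
    then show ?case using Suc assms(2) by auto
  next
    case (sum s1 s2)
    then show ?case using assms(3) by simp
  qed
  then show ?case by (auto simp: nat_pow_def ideals_set_def)
qed

lemma ideal_pow_mem:
  assumes "a \<in> p" "g \<in> K"
  shows "a ^ n * g \<in> p [^]\<^bsub>ideals_set R\<^esub> (n :: nat)"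
  using assms(2)
proof (induction n arbitrary: g)
  case 0
  then show ?case by (simp add: nat_pow_def ideals_set_def)
next
  case (Suc n)
  have "(a ^ n * g) \<otimes>\<^bsub>R\<^esub> a \<in> ideal_prod R (p [^]\<^bsub>ideals_set R\<^esub> n) p"
    by (rule ideal_prod.prod[OF Suc.IH[OF Suc.prems] assms(1)])
  then show ?case by (simp add: nat_pow_def ideals_set_def mult_ac)
qed

lemma ideal_pow_sum:
  assumes "finite A" "\<And>i. i \<in> A \<Longrightarrow> f i \<in> p [^]\<^bsub>ideals_set R\<^esub> (n :: nat)" "0 \<in> p"
  shows "sum f A \<in> p [^]\<^bsub>ideals_set R\<^esub> n"
  using assms(1,2)
proof (induction A rule: finite_induct)
  case empty
  then show ?case using ideal_pow_mem[OF assms(3), of 0 n] by simp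
next
  case (insert i A)
  have "x + y \<in> p [^]\<^bsub>ideals_set R\<^esub> n"
    if "x \<in> p [^]\<^bsub>ideals_set R\<^esub> n" "y \<in> p [^]\<^bsub>ideals_set R\<^esub> n" for x y
  proof (cases n)
    case 0
    then show ?thesis using that by (simp add: nat_pow_def ideals_set_def kspan_add)
  next
    case (Suc k)
    then show ?thesis
      using that ideal_prod.sum[of x R "p [^]\<^bsub>ideals_set R\<^esub> k" p y] by (simp add: nat_pow_def ideals_set_def)
  qed
  then show ?case using insert by simp
qed

lemma vanishing_orderI:
  assumes "\<And>n. f \<in> symbolic_power R p n \<longleftrightarrow> n \<le> v"
  shows "vanishing_order R p f = v"
  unfolding vanishing_order_def assms by (rule Greatest_equality) auto

text \<open>Multiplying by an element outside the prime does not change the multiplicity of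
  \<open>q\<close>. Conversely a monomial, never in the prime, clears the denominators of the
  cofactor of \<open>q ^ n\<close>.\<close>

lemma symbolic_power_principal_prime:
  assumes q: "prime_elem q" "q \<in> K"
  shows "symbolic_power R (principal_prime q) n = {f \<in> K. q ^ n dvd f}"
proof -
  have sub: "principal_prime q [^]\<^bsub>ideals_set R\<^esub> n \<subseteq> {f. q ^ n dvd f}"
    by (rule ideal_pow_subset) (auto simp: principal_prime_def mult.commute[of q] intro: mult_dvd_mono)
  have cancel: "q ^ n dvd x" if "q ^ n dvd s * x" "\<not> q dvd s" for s x
  proof (cases "x = 0")
    case False
    have "s \<noteq> 0" using that by auto
    then have "n \<le> pord q s + pord q x"
      using that False pord_mult[OF q(1), of s x] power_dvd_iff_le_pord[OF q(1), of "s * x" n] by simp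
    then show ?thesis
      using pord_eq_0[OF q(1) that(2)] power_dvd_iff_le_pord[OF q(1) False] by simp
  qed simp
  have ex: "\<exists>s\<in>K - principal_prime q. s * f \<in> principal_prime q [^]\<^bsub>ideals_set R\<^esub> n"
    if f: "f \<in> K" "q ^ n dvd f" for f
  proof -
    obtain h where h: "f = q ^ n * h" using f(2) by auto
    have "q \<noteq> 0" using q by auto
    then have "h \<in> kspan M"
      using K_quotient[of "q ^ n" h] f(1) h K_power[OF q(2)] K_kspan_M by simp
    then obtain c where c: "c \<in> S" "xpow c * h \<in> K"
      using clear_denominators by blast
    have "q ^ n * (xpow c * h) \<in> principal_prime q [^]\<^bsub>ideals_set R\<^esub> n"
      using q c by (intro ideal_pow_mem) (auto simp: principal_prime_def)
    then have "xpow c * f \<in> principal_prime q [^]\<^bsub>ideals_set R\<^esub> n"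
      by (simp add: h mult_ac)
    moreover have "xpow c \<in> K - principal_prime q"
      using c prime_ideal_principal_prime(2)[OF q(1)] by (auto simp: monomial_free_def)
    ultimately show ?thesis by blast
  qed
  show ?thesis
  proof (intro equalityI subsetI)
    fix x assume "x \<in> symbolic_power R (principal_prime q) n"
    then obtain s where "x \<in> K" "s \<in> K" "s \<notin> principal_prime q"
      "s * x \<in> principal_prime q [^]\<^bsub>ideals_set R\<^esub> n"
      by (auto simp: symbolic_power_def)
    then show "x \<in> {f \<in> K. q ^ n dvd f}"
      using sub cancel[of s x] by (auto simp: principal_prime_def)
  next
    fix x assume "x \<in> {f \<in> K. q ^ n dvd f}"
    then show "x \<in> symbolic_power R (principal_prime q) n"
      using ex[of x] by (simp add: symbolic_power_def)
  qed
qed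

lemma vanishing_order_principal_prime:
  assumes "prime_elem q" "q \<in> K" "f \<in> K" "f \<noteq> 0"
  shows "vanishing_order R (principal_prime q) f = pord q f"
  by (rule vanishing_orderI) (simp add: symbolic_power_principal_prime assms power_dvd_iff_le_pord)

text \<open>A term of height at least \<open>n\<close> is the power \<open>n\<close> of a monomial
  of height one times a term of nonnegative height. A common power of \<open>facet_pt i\<close>,
  which lies outside the prime, brings the second factors into \<open>K\<close>.\<close>

lemma symbolic_power_facet_prime:
  assumes i: "i \<in> F"
  shows "symbolic_power R (facet_prime i) n = {f \<in> K. f = 0 \<or> int n \<le> val (\<sigma> i) f}"
proof -
  note ad = sigma_additive[OF i]
  define D :: "nat \<Rightarrow> 'k laurent set" where "D n = kspan {a \<in> S. int n \<le> \<sigma> i a}" for n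
  have D_iff: "f \<in> D n \<longleftrightarrow> f = 0 \<or> int n \<le> val (\<sigma> i) f" if "f \<in> K" for f n
    using that val_ge_iff[of f "int n" "\<sigma> i"] by (cases "f = 0") (auto simp: D_def kspan_def)
  have sub: "facet_prime i [^]\<^bsub>ideals_set R\<^esub> n \<subseteq> D n"
  proof (rule ideal_pow_subset)
    show "K \<subseteq> D 0" using i by (auto simp: D_def kspan_def intro: S_nonneg)
    show "a * b \<in> D (Suc n)" if "a \<in> D n" "b \<in> facet_prime i" for n a b
      unfolding D_def
      by (rule kspan_mult[OF that[unfolded D_def facet_prime_def]]) (use i in \<open>auto intro: S_add\<close>)
  qed (auto simp: D_def intro: kspan_add)
  have cancel: "x \<in> D n" if "s * x \<in> D n" "s \<in> K" "s \<notin> facet_prime i" "x \<in> K" for s x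
  proof (cases "x = 0")
    case False
    have s0: "s \<noteq> 0" using that(3) by (auto simp: facet_prime_def)
    then have "val (\<sigma> i) s \<le> 0" using facet_prime_iff that by force
    then show ?thesis
      using that(1) D_iff[OF that(4)] D_iff[OF K_mult[OF that(2,4)]] False s0 val_mult[OF ad s0 False] by simp
  qed (simp add: D_def)
  have ex: "\<exists>s\<in>K - facet_prime i. s * f \<in> facet_prime i [^]\<^bsub>ideals_set R\<^esub> n"
    if f: "f \<in> D n" for f
  proof -
    obtain e where e: "e \<in> S" "\<sigma> i e = 1" using unit_height_point[OF i] by blast
    have "\<forall>a\<in>Poly_Mapping.keys f. eventually (\<lambda>k. a - frag_cmul (int n) e + frag_cmul (int k) (facet_pt i) \<in> S) sequentially"
    proof
      fix a assume "a \<in> Poly_Mapping.keys f"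
      then have "a \<in> S" "int n \<le> \<sigma> i a" using f by (auto simp: D_def kspan_def)
      then show "eventually (\<lambda>k. a - frag_cmul (int n) e + frag_cmul (int k) (facet_pt i) \<in> S) sequentially"
        using e i S_M by (intro eventually_push_facet) (auto intro: M_closed)
    qed
    then have "eventually (\<lambda>k. \<forall>a\<in>Poly_Mapping.keys f. a - frag_cmul (int n) e + frag_cmul (int k) (facet_pt i) \<in> S) sequentially"
      by (intro eventually_ball_finite) auto
    then obtain k where k: "\<forall>a\<in>Poly_Mapping.keys f. a - frag_cmul (int n) e + frag_cmul (int k) (facet_pt i) \<in> S"
      using eventually_happens' by force
    let ?c = "frag_cmul (int k) (facet_pt i)"
    let ?t = "\<lambda>a. xpow e ^ n * Poly_Mapping.single (a - frag_cmul (int n) e + ?c) (Poly_Mapping.lookup f a)"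
    have "(\<Sum>a\<in>Poly_Mapping.keys f. ?t a) \<in> facet_prime i [^]\<^bsub>ideals_set R\<^esub> n"
      using k e by (intro ideal_pow_sum ideal_pow_mem kspan_single) (auto simp: xpow_facet_prime_iff facet_prime_nonzero prime_idealD(2)[OF prime_ideal_facet_prime[OF i]])
    moreover have "(\<Sum>a\<in>Poly_Mapping.keys f. ?t a)
        = xpow ?c * (\<Sum>a\<in>Poly_Mapping.keys f. Poly_Mapping.single a (Poly_Mapping.lookup f a))"
      by (simp add: sum_distrib_left xpow_power mult_single add_ac)
    ultimately have "xpow ?c * f \<in> facet_prime i [^]\<^bsub>ideals_set R\<^esub> n"
      unfolding sum_singles[of f, symmetric] by simp
    moreover have "xpow ?c \<in> K - facet_prime i"
      using facet_pt[OF i] i by (auto simp: xpow_facet_prime_iff S_cmul)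
    ultimately show ?thesis by blast
  qed
  have "symbolic_power R (facet_prime i) n = {f \<in> K. f \<in> D n}"
  proof (intro equalityI subsetI)
    fix x assume "x \<in> symbolic_power R (facet_prime i) n"
    then obtain s where "x \<in> K" "s \<in> K" "s \<notin> facet_prime i"
      "s * x \<in> facet_prime i [^]\<^bsub>ideals_set R\<^esub> n"
      by (auto simp: symbolic_power_def)
    then show "x \<in> {f \<in> K. f \<in> D n}"
      using sub cancel[of s x] by auto
  next
    fix x assume "x \<in> {f \<in> K. f \<in> D n}"
    then show "x \<in> symbolic_power R (facet_prime i) n"
      using ex[of x] by (simp add: symbolic_power_def)
  qed
  then show ?thesis using D_iff by (auto simp del: R_simps)
qed

lemma vanishing_order_facet_prime:
  assumes "i \<in> F" "f \<in> K" "f \<noteq> 0"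
  shows "vanishing_order R (facet_prime i) f = nat (val (\<sigma> i) f)"
  by (rule vanishing_orderI) (use assms val_nonneg[OF assms(2,3,1)] in \<open>auto simp: symbolic_power_facet_prime\<close>)

end

section \<open>Ranks of abelian groups\<close>

text \<open>Gaussian elimination by cross-multiplication: a pivot \<open>b\<close> with nonzero
  entry \<open>j\<close> clears that entry in all other rows without division.\<close>

lemma integer_relation:
  fixes x :: "'i \<Rightarrow> 'j \<Rightarrow> int"
  assumes "finite J" "finite A" "card J < card A"
  shows "\<exists>c. (\<exists>a\<in>A. c a \<noteq> 0) \<and> (\<forall>j\<in>J. (\<Sum>a\<in>A. c a * x a j) = 0)"
  using assms
proof (induction J arbitrary: A x rule: finite_induct)
  case empty
  then obtain a where "a \<in> A" by fastforce
  then show ?case by (intro exI[of _ "\<lambda>_. 1"]) auto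
next
  case (insert j J)
  show ?case
  proof (cases "\<forall>a\<in>A. x a j = 0")
    case True
    have "card J < card A" using insert by simp
    then obtain c where "\<exists>a\<in>A. c a \<noteq> 0" "\<forall>j\<in>J. (\<Sum>a\<in>A. c a * x a j) = 0"
      using insert.IH[OF insert.prems(1), of x] by blast
    then show ?thesis using True by (intro exI[of _ c]) auto
  next
    case False
    then obtain b where b: "b \<in> A" "x b j \<noteq> 0" by blast
    define A' where "A' = A - {b}"
    have A': "finite A'" "card J < card A'" "A = insert b A'" "b \<notin> A'"
      using insert b by (auto simp: A'_def)
    define x' where "x' a k = x b j * x a k - x a j * x b k" for a k
    obtain c where c: "\<exists>a\<in>A'. c a \<noteq> 0" "\<forall>k\<in>J. (\<Sum>a\<in>A'. c a * x' a k) = 0"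
      using insert.IH[OF A'(1,2), of x'] by blast
    define d where "d a = (if a = b then - (\<Sum>a\<in>A'. c a * x a j) else x b j * c a)" for a
    have "(\<Sum>a\<in>A. d a * x a k) = (\<Sum>a\<in>A'. c a * x' a k)" for k
    proof -
      have "(\<Sum>a\<in>A'. d a * x a k) = (\<Sum>a\<in>A'. x b j * c a * x a k)"
        using A'(4) by (intro sum.cong) (auto simp: d_def)
      then have "(\<Sum>a\<in>A. d a * x a k) = (\<Sum>a\<in>A'. x b j * c a * x a k) - (\<Sum>a\<in>A'. c a * x a j) * x b k"
        using A' by (simp add: d_def)
      also have "\<dots> = (\<Sum>a\<in>A'. x b j * c a * x a k - c a * x a j * x b k)"
        by (simp add: sum_distrib_right sum_subtractf)
      also have "\<dots> = (\<Sum>a\<in>A'. c a * x' a k)"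
        by (intro sum.cong) (auto simp: x'_def algebra_simps)
      finally show ?thesis .
    qed
    moreover have "x' a j = 0" for a by (simp add: x'_def)
    ultimately have "\<forall>k\<in>insert j J. (\<Sum>a\<in>A. d a * x a k) = 0" using c(2) by simp
    moreover have "\<exists>a\<in>A. d a \<noteq> 0"
      using c(1) b A' by (auto simp: d_def)
    ultimately show ?thesis by blast
  qed
qed

lemma finprod_free_Abelian_group:
  assumes "finite A" "\<And>a. a \<in> A \<Longrightarrow> Poly_Mapping.keys (f a) \<subseteq> J"
  shows "(\<Otimes>\<^bsub>free_Abelian_group J\<^esub>a\<in>A. f a) = sum f A"
proof -
  interpret comm_group "free_Abelian_group J" by (rule abelian_free_Abelian_group)
  show ?thesis
    using assms
  proof (induction A rule: finite_induct)
    case (insert a A)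
    have "f \<in> A \<rightarrow> carrier (free_Abelian_group J)" "f a \<in> carrier (free_Abelian_group J)"
      using insert.prems by auto
    then show ?case
      using insert finprod_insert[OF insert.hyps(1,2), of f] by simp
  qed simp
qed

lemma has_rank_free_Abelian_group:
  assumes "finite J"
  shows "has_rank (free_Abelian_group J) (card J)"
  unfolding has_rank_def
proof (intro conjI allI impI)
  have relation: "(\<Otimes>\<^bsub>free_Abelian_group J\<^esub>x\<in>S. x [^]\<^bsub>free_Abelian_group J\<^esub> c x) = (\<Sum>x\<in>S. frag_cmul (c x) x)"
    if fin: "finite S" "S \<subseteq> carrier (free_Abelian_group J)" for S and c :: "('a \<Rightarrow>\<^sub>0 int) \<Rightarrow> int"
  proof -
    have sub: "Poly_Mapping.keys x \<subseteq> J" if "x \<in> S" for x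
      using subsetD[OF fin(2) that] by simp
    have "(\<Otimes>\<^bsub>free_Abelian_group J\<^esub>x\<in>S. x [^]\<^bsub>free_Abelian_group J\<^esub> c x)
        = (\<Sum>x\<in>S. x [^]\<^bsub>free_Abelian_group J\<^esub> c x)"
      using sub by (intro finprod_free_Abelian_group fin(1)) auto
    then show ?thesis using sub by simp
  qed
  have "int_independent (free_Abelian_group J) (frag_of ` J)"
    unfolding int_independent_def
  proof (intro conjI allI impI ballI)
    fix c :: "('a \<Rightarrow>\<^sub>0 int) \<Rightarrow> int" and x
    assume "(\<Otimes>\<^bsub>free_Abelian_group J\<^esub>x\<in>frag_of ` J. x [^]\<^bsub>free_Abelian_group J\<^esub> c x) = \<one>\<^bsub>free_Abelian_group J\<^esub>"
      and x: "x \<in> frag_of ` J"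
    then have "(\<Sum>x\<in>frag_of ` J. frag_cmul (c x) x) = 0"
      using assms by (subst (asm) relation) auto
    then have 0: "(\<Sum>j\<in>J. frag_cmul (c (frag_of j)) (frag_of j)) = 0"
      by (subst (asm) sum.reindex) (auto simp: inj_on_def frag_of_eq)
    obtain j where j: "j \<in> J" "x = frag_of j" using x by blast
    have "c (frag_of j) = Poly_Mapping.lookup (\<Sum>j\<in>J. frag_cmul (c (frag_of j)) (frag_of j)) j"
      using j assms by (simp add: lookup_sum sum.delta if_distrib cong: if_cong)
    then show "c x = 0" using 0 j by simp
  qed (use assms in auto)
  moreover have "card (frag_of ` J :: ('a \<Rightarrow>\<^sub>0 int) set) = card J"
    by (rule card_image) (auto simp: inj_on_def frag_of_eq)
  ultimately show "\<exists>S. int_independent (free_Abelian_group J) S \<and> card S = card J" by blast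
  fix S assume S: "int_independent (free_Abelian_group J) S"
  then have fin: "finite S" "S \<subseteq> carrier (free_Abelian_group J)" by (auto simp: int_independent_def)
  show "card S \<le> card J"
  proof (rule ccontr)
    assume "\<not> ?thesis"
    then obtain c where c: "\<exists>a\<in>S. c a \<noteq> 0" "\<forall>j\<in>J. (\<Sum>a\<in>S. c a * Poly_Mapping.lookup a j) = 0"
      using integer_relation[OF assms fin(1), of "\<lambda>a j. Poly_Mapping.lookup a j"] by force
    have "(\<Sum>a\<in>S. frag_cmul (c a) a) = 0"
    proof (rule poly_mapping_eqI)
      fix j
      have "Poly_Mapping.lookup a j = 0" if "a \<in> S" "j \<notin> J" for a
        using subsetD[OF fin(2) that(1)] that(2) by (auto simp: in_keys_iff)
      then show "Poly_Mapping.lookup (\<Sum>a\<in>S. frag_cmul (c a) a) j = Poly_Mapping.lookup 0 j"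
        using c(2) by (cases "j \<in> J") (simp_all add: lookup_sum)
    qed
    then show False
      using S c(1) relation[OF fin] by (auto simp: int_independent_def)
  qed
qed

lemma hom_finprod:
  assumes "\<phi> \<in> hom G H" "comm_group G" "comm_group H" "finite A" "f \<in> A \<rightarrow> carrier G"
  shows "\<phi> (\<Otimes>\<^bsub>G\<^esub>a\<in>A. f a) = (\<Otimes>\<^bsub>H\<^esub>a\<in>A. \<phi> (f a))"
proof -
  interpret G: comm_group G by fact
  interpret H: comm_group H by fact
  interpret group_hom G H \<phi> by unfold_locales (rule assms(1))
  show ?thesis
    using assms(4,5)
  proof (induction A rule: finite_induct)
    case (insert a A)
    then have "f \<in> A \<rightarrow> carrier G" "f a \<in> carrier G" by auto
    then show ?case
      using insert by (simp add: G.finprod_insert H.finprod_insert Pi_iff)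
  qed simp
qed

lemma int_independent_iso:
  assumes \<phi>: "\<phi> \<in> iso G H" and G: "comm_group G" and H: "comm_group H" and S: "int_independent G S"
  shows "int_independent H (\<phi> ` S)" "card (\<phi> ` S) = card S"
proof -
  interpret G: comm_group G by fact
  interpret H: comm_group H by fact
  have hom: "\<phi> \<in> hom G H" and bij: "bij_betw \<phi> (carrier G) (carrier H)"
    using \<phi> by (auto simp: iso_def)
  interpret group_hom G H \<phi> by unfold_locales (rule hom)
  have fin: "finite S" "S \<subseteq> carrier G" using S by (auto simp: int_independent_def)
  have SG: "x \<in> carrier G" if "x \<in> S" for x using fin(2) that by blast
  have inj: "inj_on \<phi> (carrier G)" using bij by (simp add: bij_betw_def)
  have injS: "inj_on \<phi> S" using inj fin(2) by (rule inj_on_subset)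
  show "card (\<phi> ` S) = card S" by (rule card_image[OF injS])
  show "int_independent H (\<phi> ` S)"
    unfolding int_independent_def
  proof (intro conjI allI impI ballI)
    show "finite (\<phi> ` S)" "\<phi> ` S \<subseteq> carrier H" using fin by auto
    fix c :: "_ \<Rightarrow> int" and y
    assume "(\<Otimes>\<^bsub>H\<^esub>y\<in>\<phi> ` S. y [^]\<^bsub>H\<^esub> c y) = \<one>\<^bsub>H\<^esub>" and y: "y \<in> \<phi> ` S"
    moreover have "(\<Otimes>\<^bsub>H\<^esub>y\<in>\<phi> ` S. y [^]\<^bsub>H\<^esub> c y) = (\<Otimes>\<^bsub>H\<^esub>x\<in>S. \<phi> x [^]\<^bsub>H\<^esub> c (\<phi> x))"
      using SG by (intro H.finprod_reindex injS) auto
    moreover have "(\<Otimes>\<^bsub>H\<^esub>x\<in>S. \<phi> x [^]\<^bsub>H\<^esub> c (\<phi> x)) = (\<Otimes>\<^bsub>H\<^esub>x\<in>S. \<phi> (x [^]\<^bsub>G\<^esub> c (\<phi> x)))"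
      using SG by (intro H.finprod_cong') (auto simp: hom_int_pow)
    moreover have "\<dots> = \<phi> (\<Otimes>\<^bsub>G\<^esub>x\<in>S. x [^]\<^bsub>G\<^esub> c (\<phi> x))"
      using fin(1) SG by (intro hom_finprod[symmetric] hom G H) auto
    ultimately have "\<phi> (\<Otimes>\<^bsub>G\<^esub>x\<in>S. x [^]\<^bsub>G\<^esub> c (\<phi> x)) = \<phi> \<one>\<^bsub>G\<^esub>" by simp
    moreover have "(\<Otimes>\<^bsub>G\<^esub>x\<in>S. x [^]\<^bsub>G\<^esub> c (\<phi> x)) \<in> carrier G"
      using SG by (intro G.finprod_closed) auto
    ultimately have "(\<Otimes>\<^bsub>G\<^esub>x\<in>S. x [^]\<^bsub>G\<^esub> c (\<phi> x)) = \<one>\<^bsub>G\<^esub>"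
      by (intro inj_onD[OF inj]) auto
    moreover have "\<forall>c :: _ \<Rightarrow> int. (\<Otimes>\<^bsub>G\<^esub>x\<in>S. x [^]\<^bsub>G\<^esub> c x) = \<one>\<^bsub>G\<^esub> \<longrightarrow> (\<forall>x\<in>S. c x = 0)"
      using S unfolding int_independent_def by (elim conjE)
    ultimately have "\<forall>x\<in>S. c (\<phi> x) = 0"
      by (elim allE[of _ "\<lambda>x. c (\<phi> x)"]) (erule (1) mp)
    then show "c y = 0" using y by blast
  qed
qed

lemma has_rank_iso:
  assumes "G \<cong> H" "comm_group G" "comm_group H" "has_rank H n"
  shows "has_rank G n"
proof -
  obtain \<phi> where \<phi>: "\<phi> \<in> iso G H" using assms(1) by (auto simp: is_iso_def)
  have \<psi>: "inv_into (carrier G) \<phi> \<in> iso H G"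
    using assms(2) group.iso_set_sym[OF _ \<phi>] by (simp add: comm_group_def)
  show ?thesis
    using assms(4) int_independent_iso[OF \<phi> assms(2,3)] int_independent_iso[OF \<psi> assms(3,2)]
    unfolding has_rank_def by metis
qed

section \<open>The class group of a normal toric ring\<close>

text \<open>The functionals indexed by \<open>I\<close> form a basis of the dual of the lattice, with dual basis
  \<open>m\<close>, so the classes of the remaining facet primes form a basis of the class group.\<close>

locale toric_cone_basis = toric_cone +
  fixes I :: "nat set" and m :: "nat \<Rightarrow> (nat \<Rightarrow>\<^sub>0 int)"
  assumes I_F: "I \<subseteq> F"
    and m_M: "i \<in> I \<Longrightarrow> m i \<in> sublattice T"
    and m_dual: "i \<in> I \<Longrightarrow> k \<in> I \<Longrightarrow> \<sigma> k (m i) = (if k = i then 1 else 0)"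
    and sigma_inj: "a \<in> sublattice T \<Longrightarrow> \<forall>i\<in>I. \<sigma> i a = 0 \<Longrightarrow> a = 0"
begin

abbreviation H where "H \<equiv> height_one_primes R"

abbreviation Hfree where "Hfree \<equiv> {p \<in> H. monomial_free p}"

definition gen :: "'a laurent set \<Rightarrow> 'a laurent" where
  "gen p = (SOME q. q \<in> K \<and> prime_elem q \<and> p = principal_prime q)"

lemma gen:
  assumes "p \<in> Hfree"
  shows "gen p \<in> K" "prime_elem (gen p)" "p = principal_prime (gen p)" "gen p \<noteq> 0"
proof -
  have "\<exists>q. q \<in> K \<and> prime_elem q \<and> p = principal_prime q"
    using height_one_monomial_free assms by blast
  then have *: "gen p \<in> K \<and> prime_elem (gen p) \<and> p = principal_prime (gen p)"
    unfolding gen_def by (rule someI_ex)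
  then show "gen p \<in> K" "prime_elem (gen p)" "p = principal_prime (gen p)" "gen p \<noteq> 0"
    by auto
qed

lemma facet_prime_not_monomial_free: "i \<in> F \<Longrightarrow> \<not> monomial_free (facet_prime i)"
  using unit_height_point[of i] xpow_facet_prime_iff[of _ i] unfolding monomial_free_def
  by (metis zero_less_one)

lemma inj_facet_prime: "inj_on facet_prime F"
proof (rule inj_onI)
  fix i j assume ij: "i \<in> F" "j \<in> F" "facet_prime i = facet_prime j"
  have "xpow (facet_pt i) \<notin> facet_prime i"
    using facet_pt(2)[OF ij(1)] by (simp add: xpow_facet_prime_iff)
  then show "i = j"
    using facet_pt(3,4)[OF ij(1)] ij xpow_facet_prime_iff[of "facet_pt i" j] by metis
qed

lemma H_cases: "p \<in> H \<Longrightarrow> p \<in> Hfree \<or> p \<in> facet_prime ` F"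
  using height_one_prime_cases by blast

lemma H_facet_prime: "i \<in> F \<Longrightarrow> facet_prime i \<in> H - Hfree"
  using facet_prime_height_one facet_prime_not_monomial_free by blast

lemma vanishing_order_gen:
  assumes "p \<in> Hfree" "f \<in> K" "f \<noteq> 0"
  shows "vanishing_order R p f = pord (gen p) f"
  using vanishing_order_principal_prime[OF gen(2,1)[OF assms(1)] assms(2,3)] gen(3)[OF assms(1)] by simp

lemma pord_gen_gen:
  assumes "p \<in> Hfree" "p' \<in> Hfree"
  shows "pord (gen p) (gen p') = (if p = p' then 1 else 0)"
proof (cases "p = p'")
  case True
  then show ?thesis using pord_self[OF gen(2)[OF assms(1)]] by simp
next
  case False
  have "\<not> gen p dvd gen p'"
  proof
    assume d: "gen p dvd gen p'"
    then have "gen p' dvd gen p"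
      using prime_elem_dvd_prime_elem gen(2) assms by blast
    then have "principal_prime (gen p) = principal_prime (gen p')"
      using d by (auto simp: principal_prime_def intro: dvd_trans)
    then show False using False gen(3) assms by metis
  qed
  then show ?thesis using False pord_eq_0[OF gen(2)[OF assms(1)]] by simp
qed

lemma pord_gen_xpow: "p \<in> Hfree \<Longrightarrow> pord (gen p) (xpow a) = 0"
  by (rule pord_unit[OF gen(2)]) simp_all

text \<open>For \<open>i\<close> in \<open>I\<close> the divisor of the monomial \<open>m i\<close>
  is the facet prime \<open>i\<close> plus \<open>\<sigma> j (m i)\<close> times each facet prime
  \<open>j\<close> in \<open>F - I\<close>. As it is principal, the class of \<open>i\<close> is
  minus that sum.\<close>

definition cls :: "nat \<Rightarrow> (nat \<Rightarrow>\<^sub>0 int)" where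
  "cls i = (if i \<in> I then - (\<Sum>j\<in>F - I. frag_cmul (\<sigma> j (m i)) (frag_of j)) else frag_of i)"

text \<open>The divisor of the generator of a monomial-free prime is that prime plus the facet
  primes weighted by the valuations of the generator; this fixes the class.\<close>

definition prime_cls :: "'a laurent set \<Rightarrow> (nat \<Rightarrow>\<^sub>0 int)" where
  "prime_cls p = (if monomial_free p then - (\<Sum>i\<in>F. frag_cmul (val (\<sigma> i) (gen p)) (cls i))
     else cls (the_inv_into F facet_prime p))"

abbreviation div_cls :: "('a laurent set \<Rightarrow>\<^sub>0 int) \<Rightarrow> (nat \<Rightarrow>\<^sub>0 int)" where
  "div_cls \<equiv> frag_extend prime_cls"

text \<open>What remains at facet \<open>i\<close> once the divisors of generators have been
  subtracted to remove every monomial-free prime from \<open>D\<close>.\<close>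

definition facet_coeff :: "('a laurent set \<Rightarrow>\<^sub>0 int) \<Rightarrow> nat \<Rightarrow> int" where
  "facet_coeff D i = Poly_Mapping.lookup D (facet_prime i)
     - (\<Sum>p\<in>Poly_Mapping.keys D \<inter> Hfree. Poly_Mapping.lookup D p * val (\<sigma> i) (gen p))"

lemma finite_FI: "finite I" "finite (F - I)"
  using finite_F I_F finite_subset by auto

lemma div_cls_eq:
  assumes "Poly_Mapping.keys D \<subseteq> H"
  shows "div_cls D = (\<Sum>i\<in>F. frag_cmul (facet_coeff D i) (cls i))"
proof -
  let ?t = "\<lambda>p. frag_cmul (Poly_Mapping.lookup D p) (prime_cls p)"
  have sub: "Poly_Mapping.keys D \<subseteq> (Poly_Mapping.keys D \<inter> Hfree) \<union> facet_prime ` F"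
    using assms H_cases by blast
  have "div_cls D = sum ?t ((Poly_Mapping.keys D \<inter> Hfree) \<union> facet_prime ` F)"
    unfolding frag_extend_def using sub finite_F
    by (intro sum.mono_neutral_left) (auto simp: in_keys_iff)
  also have "\<dots> = sum ?t (Poly_Mapping.keys D \<inter> Hfree) + sum ?t (facet_prime ` F)"
    using finite_F H_facet_prime by (intro sum.union_disjoint) auto
  also have "sum ?t (facet_prime ` F) = (\<Sum>i\<in>F. frag_cmul (Poly_Mapping.lookup D (facet_prime i)) (cls i))"
    by (subst sum.reindex[OF inj_facet_prime])
      (auto intro!: sum.cong simp: prime_cls_def facet_prime_not_monomial_free the_inv_into_f_f[OF inj_facet_prime])
  also have "sum ?t (Poly_Mapping.keys D \<inter> Hfree)
      = (\<Sum>i\<in>F. frag_cmul (- (\<Sum>p\<in>Poly_Mapping.keys D \<inter> Hfree. Poly_Mapping.lookup D p * val (\<sigma> i) (gen p))) (cls i))"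
  proof (rule poly_mapping_eqI)
    fix j
    let ?A = "Poly_Mapping.keys D \<inter> Hfree"
    have "Poly_Mapping.lookup (sum ?t ?A) j
        = (\<Sum>p\<in>?A. \<Sum>i\<in>F. - (Poly_Mapping.lookup D p * val (\<sigma> i) (gen p) * Poly_Mapping.lookup (cls i) j))"
      by (auto simp: lookup_sum prime_cls_def sum_distrib_left sum_negf mult.assoc intro!: sum.cong)
    also have "\<dots> = (\<Sum>i\<in>F. \<Sum>p\<in>?A. - (Poly_Mapping.lookup D p * val (\<sigma> i) (gen p) * Poly_Mapping.lookup (cls i) j))"
      by (rule sum.swap)
    finally show "Poly_Mapping.lookup (sum ?t ?A) j = Poly_Mapping.lookup
        (\<Sum>i\<in>F. frag_cmul (- (\<Sum>p\<in>?A. Poly_Mapping.lookup D p * val (\<sigma> i) (gen p))) (cls i)) j"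
      by (simp add: lookup_sum sum_distrib_right sum_negf)
  qed
  finally show ?thesis
    by (simp add: facet_coeff_def sum.distrib[symmetric] frag_cmul_distrib[symmetric])
qed

lemma keys_cls: "i \<in> F \<Longrightarrow> Poly_Mapping.keys (cls i) \<subseteq> F - I"
  using keys_sum[of "\<lambda>j. frag_cmul (\<sigma> j (m i)) (frag_of j)" "F - I"]
  by (auto simp: cls_def)

lemma keys_cls_sum: "Poly_Mapping.keys (\<Sum>i\<in>F. frag_cmul (c i) (cls i)) \<subseteq> F - I"
  using keys_sum[of "\<lambda>i. frag_cmul (c i) (cls i)" F] keys_cls by fastforce

definition dual_sum :: "(nat \<Rightarrow> int) \<Rightarrow> (nat \<Rightarrow>\<^sub>0 int)" where
  "dual_sum c = (\<Sum>i\<in>I. frag_cmul (c i) (m i))"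

lemma dual_sum_M: "dual_sum c \<in> M"
  unfolding dual_sum_def by (intro M_sum M_closed m_M)

lemma sigma_dual_sum: "k \<in> F \<Longrightarrow> \<sigma> k (dual_sum c) = (\<Sum>i\<in>I. c i * \<sigma> k (m i))"
  by (simp add: dual_sum_def)

lemma sigma_dual_sum_I: "k \<in> I \<Longrightarrow> \<sigma> k (dual_sum c) = c k"
  using I_F finite_FI by (subst sigma_dual_sum) (auto simp: m_dual if_distrib sum.delta' cong: if_cong)

lemma dual_sum_sigma: "a \<in> M \<Longrightarrow> dual_sum (\<lambda>i. \<sigma> i a) = a"
  using sigma_inj[of "dual_sum (\<lambda>i. \<sigma> i a) - a"] I_F
  by (auto simp: M_closed dual_sum_M sigma_dual_sum_I subset_iff)

lemma lookup_cls_sum: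
  assumes "j \<in> F - I"
  shows "Poly_Mapping.lookup (\<Sum>i\<in>F. frag_cmul (c i) (cls i)) j = c j - \<sigma> j (dual_sum c)"
proof -
  have l: "Poly_Mapping.lookup (cls i) j = (if i \<in> I then - \<sigma> j (m i) else if i = j then 1 else 0)" for i
  proof -
    have "Poly_Mapping.lookup (\<Sum>k\<in>F - I. frag_cmul (\<sigma> k (m i)) (frag_of k)) j
        = (\<Sum>k\<in>F - I. if k = j then \<sigma> k (m i) else 0)"
      unfolding lookup_sum by (intro sum.cong) auto
    also have "\<dots> = \<sigma> j (m i)" using assms finite_FI by simp
    finally show ?thesis by (auto simp: cls_def)
  qed
  have "(\<Sum>i\<in>F. c i * Poly_Mapping.lookup (cls i) j)
      = (\<Sum>i\<in>I. c i * Poly_Mapping.lookup (cls i) j) + (\<Sum>i\<in>F - I. c i * Poly_Mapping.lookup (cls i) j)"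
    by (subst sum.subset_diff[OF I_F finite_F]) (rule add.commute)
  also have "(\<Sum>i\<in>I. c i * Poly_Mapping.lookup (cls i) j) = - \<sigma> j (dual_sum c)"
    using assms by (simp add: l sigma_dual_sum sum_negf)
  also have "(\<Sum>i\<in>F - I. c i * Poly_Mapping.lookup (cls i) j) = (\<Sum>i\<in>F - I. if i = j then c i else 0)"
    by (intro sum.cong) (auto simp: l)
  also have "\<dots> = c j" using assms finite_FI by simp
  finally show ?thesis by (simp add: lookup_sum)
qed

text \<open>The relations among the \<open>cls i\<close> are the divisors of monomials: the heights
  over \<open>I\<close> leave \<open>dual_sum c\<close> as the only candidate, and the coefficients
  over \<open>F - I\<close> measure its failure.\<close>

lemma cls_sum_eq_0_iff:
  "(\<Sum>i\<in>F. frag_cmul (c i) (cls i)) = 0 \<longleftrightarrow> (\<exists>a\<in>M. \<forall>i\<in>F. c i = \<sigma> i a)" (is "?s = 0 \<longleftrightarrow> _")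
proof
  assume "?s = 0"
  then have "c i = \<sigma> i (dual_sum c)" if "i \<in> F" for i
    using that lookup_cls_sum[of i c] sigma_dual_sum_I[of i c] by (cases "i \<in> I") auto
  then show "\<exists>a\<in>M. \<forall>i\<in>F. c i = \<sigma> i a" using dual_sum_M by blast
next
  assume "\<exists>a\<in>M. \<forall>i\<in>F. c i = \<sigma> i a"
  then obtain a where a: "a \<in> M" "\<And>i. i \<in> F \<Longrightarrow> c i = \<sigma> i a" by blast
  then have "dual_sum c = dual_sum (\<lambda>i. \<sigma> i a)"
    using I_F by (auto simp: dual_sum_def intro!: sum.cong)
  then have "dual_sum c = a" using dual_sum_sigma a by simp
  then have "Poly_Mapping.lookup ?s j = 0" if "j \<in> F - I" for j
    using lookup_cls_sum[OF that, of c] a that by simp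
  then show "?s = 0"
    using keys_cls_sum[of c] by (metis in_keys_iff lookup_zero poly_mapping_eqI subsetD)
qed

text \<open>\<open>nat\<close> sends negative multiplicities to 0, so \<open>pos_part D\<close> and
  \<open>pos_part (- D)\<close> are numerator and denominator of a fraction realising
  \<open>D\<close> on the monomial-free primes.\<close>

definition pos_part :: "('a laurent set \<Rightarrow>\<^sub>0 int) \<Rightarrow> 'a laurent" where
  "pos_part D = (\<Prod>p\<in>Poly_Mapping.keys D \<inter> Hfree. gen p ^ nat (Poly_Mapping.lookup D p))"

lemma pos_part_K: "pos_part D \<in> K"
proof -
  have *: "prod f A \<in> K" if "\<And>p. p \<in> A \<Longrightarrow> f p \<in> K" for f :: "'a laurent set \<Rightarrow> 'a laurent" and A
    using that by (induction A rule: infinite_finite_induct) (auto intro: K_mult K_1)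
  show ?thesis
    unfolding pos_part_def by (rule *) (erule IntE, rule K_power[OF gen(1)])
qed

lemma pos_part_nonzero: "pos_part D \<noteq> 0"
  unfolding pos_part_def using gen(4) by (subst prod_zero_iff) auto

lemma val_pos_part:
  assumes "i \<in> F"
  shows "val (\<sigma> i) (pos_part D)
    = (\<Sum>p\<in>Poly_Mapping.keys D \<inter> Hfree. int (nat (Poly_Mapping.lookup D p)) * val (\<sigma> i) (gen p))"
proof -
  have "val (\<sigma> i) (pos_part D)
      = (\<Sum>p\<in>Poly_Mapping.keys D \<inter> Hfree. val (\<sigma> i) (gen p ^ nat (Poly_Mapping.lookup D p)))"
    unfolding pos_part_def using gen(4) by (intro val_prod[OF sigma_additive[OF assms]]) auto
  also have "\<dots> = (\<Sum>p\<in>Poly_Mapping.keys D \<inter> Hfree. int (nat (Poly_Mapping.lookup D p)) * val (\<sigma> i) (gen p))"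
    using gen(4) by (intro sum.cong refl val_power[OF sigma_additive[OF assms]]) blast
  finally show ?thesis .
qed

lemma pord_pos_part:
  assumes p: "p \<in> Hfree"
  shows "pord (gen p) (pos_part D) = nat (Poly_Mapping.lookup D p)"
proof -
  let ?A = "Poly_Mapping.keys D \<inter> Hfree"
  have "pord (gen p) (pos_part D) = (\<Sum>p'\<in>?A. pord (gen p) (gen p' ^ nat (Poly_Mapping.lookup D p')))"
    unfolding pos_part_def using gen(4) by (intro pord_prod gen(2)[OF p]) auto
  also have "\<dots> = (\<Sum>p'\<in>?A. if p' = p then nat (Poly_Mapping.lookup D p') else 0)"
  proof (intro sum.cong refl)
    fix p' assume "p' \<in> ?A"
    then have p': "p' \<in> Hfree" by blast
    show "pord (gen p) (gen p' ^ nat (Poly_Mapping.lookup D p')) = (if p' = p then nat (Poly_Mapping.lookup D p') else 0)"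
      using pord_power[OF gen(2)[OF p] gen(4)[OF p']] pord_gen_gen[OF p p'] by auto
  qed
  also have "\<dots> = nat (Poly_Mapping.lookup D p)"
    using p by (auto simp: sum.delta' in_keys_iff)
  finally show ?thesis .
qed

lemma val_pos_part_diff:
  assumes "i \<in> F"
  shows "val (\<sigma> i) (pos_part D) - val (\<sigma> i) (pos_part (- D))
    = (\<Sum>p\<in>Poly_Mapping.keys D \<inter> Hfree. Poly_Mapping.lookup D p * val (\<sigma> i) (gen p))"
proof -
  have "int (nat x) * v - int (nat (- x)) * v = x * v" for x v :: int
    by (cases "0 \<le> x") auto
  then show ?thesis
    using assms by (simp add: val_pos_part sum_subtractf[symmetric])
qed

text \<open>The quotient is a unit \<open>u\<close> with inverse \<open>v\<close>. Keys of
  \<open>u\<close> and \<open>v\<close> with sum zero bound valuations that add up to zero, so the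
  same exponent \<open>a\<close> attains the valuation of \<open>u\<close> for every facet.\<close>

lemma unit_val:
  assumes "f \<in> kspan M" "g \<in> kspan M" "f \<noteq> 0" "g \<noteq> 0" "f dvd g" "g dvd f"
  obtains a where "a \<in> M" "\<And>i. i \<in> F \<Longrightarrow> val (\<sigma> i) g = val (\<sigma> i) f + \<sigma> i a"
proof -
  obtain u where u: "g = f * u" using assms(5) by auto
  obtain v where v: "f = g * v" using assms(6) by auto
  have "f * (u * v) = f * 1" using u v by (metis mult.assoc mult.right_neutral)
  then have uv: "u * v = 1" using assms(3) by simp
  then have nz: "u \<noteq> 0" "v \<noteq> 0" by auto
  have uM: "u \<in> kspan M" using K_quotient assms u by blast
  have "0 \<in> Poly_Mapping.keys (u * v)" by (simp add: uv)
  then obtain a b where ab: "a \<in> Poly_Mapping.keys u" "b \<in> Poly_Mapping.keys v" "0 = a + b"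
    using keys_mult[of u v] by blast
  have "val (\<sigma> i) u = \<sigma> i a" if i: "i \<in> F" for i
  proof -
    have "val (\<sigma> i) (u * v) = 0"
      unfolding uv by (rule val_1[OF sigma_additive[OF i]])
    then have "val (\<sigma> i) u + val (\<sigma> i) v = 0"
      using val_mult[OF sigma_additive[OF i] nz] by simp
    moreover have "\<sigma> i a + \<sigma> i b = 0"
      using sigma_simps(1,2)[OF i] ab(3) by metis
    ultimately show ?thesis
      using val_le[OF ab(1), of "\<sigma> i"] val_le[OF ab(2), of "\<sigma> i"] by linarith
  qed
  then have "val (\<sigma> i) g = val (\<sigma> i) f + \<sigma> i a" if "i \<in> F" for i
    using val_mult[OF sigma_additive[OF that] assms(3) nz(1)] u that by simp
  moreover have "a \<in> M" using ab(1) uM by (auto simp: kspan_def)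
  ultimately show ?thesis using that by blast
qed

text \<open>Every prime dividing \<open>f\<close> is, up to a monomial, an element of
  \<open>K\<close> and hence associated to some \<open>gen p\<close>, at which the orders
  agree.\<close>

lemma dvd_if_pord_gen:
  assumes "f \<in> K" "g \<in> K" "f \<noteq> 0" "g \<noteq> 0" "\<And>p. p \<in> Hfree \<Longrightarrow> pord (gen p) f = pord (gen p) g"
  shows "f dvd g"
proof (rule dvd_if_pord_le[OF assms(3,4)])
  fix q assume q: "prime_elem q" "q dvd f"
  obtain b where b: "xpow b * q \<in> K"
    using associate_in_K[OF K_kspan_M[OF assms(1)] assms(3) q(2)] by blast
  let ?q = "xpow b * q"
  have pq: "prime_elem ?q" using q(1) by (rule prime_elem_xpow_mult)
  define p where "p = principal_prime ?q"
  have "p \<in> Hfree"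
    using principal_prime_height_one[OF pq b] prime_ideal_principal_prime(2)[OF pq] by (simp add: p_def)
  note gp = gen[OF this]
  have "?q \<in> p" by (simp add: p_def principal_prime_def b)
  then have "?q \<in> principal_prime (gen p)" by (simp only: gp(3)[symmetric])
  then have 1: "gen p dvd q" by (simp add: principal_prime_def)
  have "gen p \<in> principal_prime (gen p)" using gp(1) by (simp add: principal_prime_def)
  then have "gen p \<in> p" by (simp only: gp(3)[symmetric])
  then have "gen p \<in> principal_prime ?q" by (simp only: p_def)
  then have "q dvd gen p" by (simp add: principal_prime_def)
  note this 1
  then have "pord q h = pord (gen p) h" for h by (rule pord_cong)
  then show "pord q f \<le> pord q g"
    using assms(5)[OF \<open>p \<in> Hfree\<close>] by simp
qed

lemma principal_divisors_iff:
  assumes D: "Poly_Mapping.keys D \<subseteq> H"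
  shows "D \<in> principal_divisors R \<longleftrightarrow> div_cls D = 0"
proof
  let ?l = "Poly_Mapping.lookup D"
  assume "D \<in> principal_divisors R"
  then obtain f g where fg: "f \<in> K" "f \<noteq> 0" "g \<in> K" "g \<noteq> 0"
    and div: "\<And>p. p \<in> H \<Longrightarrow> ?l p = int (vanishing_order R p f) - int (vanishing_order R p g)"
    by (auto simp: principal_divisors_def)
  \<comment> \<open>After cross-multiplication the orders at all monomial-free primes agree, so
    \<open>f'\<close> and \<open>g'\<close> differ by a unit of the group algebra, which supplies
    the required lattice point.\<close>
  define f' where "f' = f * pos_part (- D)"
  define g' where "g' = g * pos_part D"
  have nz: "f' \<noteq> 0" "g' \<noteq> 0" using fg pos_part_nonzero by (auto simp: f'_def g'_def)
  have K': "f' \<in> K" "g' \<in> K" using fg pos_part_K K_mult by (auto simp: f'_def g'_def)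
  have "pord (gen p) f' = pord (gen p) g'" if p: "p \<in> Hfree" for p
    using div[of p] p fg vanishing_order_gen[OF p] pord_mult[OF gen(2)[OF p]] pos_part_nonzero
    by (simp add: f'_def g'_def pord_pos_part)
  then have "f' dvd g'" "g' dvd f'"
    using K' nz by (auto intro: dvd_if_pord_gen)
  then obtain a where a: "a \<in> M" "\<And>i. i \<in> F \<Longrightarrow> val (\<sigma> i) f' = val (\<sigma> i) g' + \<sigma> i a"
    using unit_val[of g' f'] K' nz K_kspan_M by blast
  have "facet_coeff D i = \<sigma> i a" if i: "i \<in> F" for i
  proof -
    have "?l (facet_prime i) = val (\<sigma> i) f - val (\<sigma> i) g"
      using div[of "facet_prime i"] H_facet_prime[OF i] fg val_nonneg i
      by (simp add: vanishing_order_facet_prime)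
    moreover have "val (\<sigma> i) f' = val (\<sigma> i) f + val (\<sigma> i) (pos_part (- D))"
      "val (\<sigma> i) g' = val (\<sigma> i) g + val (\<sigma> i) (pos_part D)"
      using val_mult[OF sigma_additive[OF i]] fg pos_part_nonzero by (auto simp: f'_def g'_def)
    ultimately show ?thesis
      using a(2)[OF i] val_pos_part_diff[OF i, of D] by (simp add: facet_coeff_def)
  qed
  then show "div_cls D = 0"
    using a(1) by (auto simp: div_cls_eq[OF D] cls_sum_eq_0_iff)
next
  let ?l = "Poly_Mapping.lookup D"
  assume "div_cls D = 0"
  then obtain a where a: "a \<in> M" "\<And>i. i \<in> F \<Longrightarrow> facet_coeff D i = \<sigma> i a"
    by (auto simp: div_cls_eq[OF D] cls_sum_eq_0_iff)
  \<comment> \<open>\<open>c\<close> only moves both elements into \<open>K\<close> and cancels in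
    the fraction; \<open>a\<close> accounts for the facet coefficients.\<close>
  obtain c where c: "c \<in> S" "c + a \<in> S" using clear_denominator[OF a(1)] by blast
  define f where "f = xpow (c + a) * pos_part D"
  define g where "g = xpow c * pos_part (- D)"
  have fg: "f \<in> K" "f \<noteq> 0" "g \<in> K" "g \<noteq> 0"
    using c pos_part_nonzero pos_part_K by (auto simp: f_def g_def intro: K_mult)
  have "?l p = int (vanishing_order R p f) - int (vanishing_order R p g)" if p: "p \<in> H" for p
    using H_cases[OF p]
  proof
    assume p: "p \<in> Hfree"
    show ?thesis
      using vanishing_order_gen[OF p] fg pord_mult[OF gen(2)[OF p]] pos_part_nonzero
      by (simp add: f_def g_def pord_pos_part[OF p] pord_gen_xpow[OF p])
  next
    assume "p \<in> facet_prime ` F"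
    then obtain i where i: "i \<in> F" "p = facet_prime i" by blast
    have "val (\<sigma> i) f = \<sigma> i c + \<sigma> i a + val (\<sigma> i) (pos_part D)"
      "val (\<sigma> i) g = \<sigma> i c + val (\<sigma> i) (pos_part (- D))"
      unfolding f_def g_def
      using val_mult[OF sigma_additive[OF i(1)] monom_nonzero pos_part_nonzero] i(1) by simp_all
    moreover have "vanishing_order R p f = nat (val (\<sigma> i) f)" "vanishing_order R p g = nat (val (\<sigma> i) g)"
      using vanishing_order_facet_prime[OF i(1)] fg i(2) by auto
    ultimately show ?thesis
      using a(2)[OF i(1)] val_pos_part_diff[OF i(1), of D] i(2)
        val_nonneg[OF fg(1,2) i(1)] val_nonneg[OF fg(3,4) i(1)]
      by (simp add: facet_coeff_def)
  qed
  then show "D \<in> principal_divisors R"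
    using D fg by (auto simp: principal_divisors_def divisor_group_def)
qed

theorem class_group_rank: "has_rank (class_group R) (card (F - I))"
proof -
  let ?A = "divisor_group R" and ?B = "free_Abelian_group (F - I)"
  interpret A: comm_group ?A unfolding divisor_group_def by (rule abelian_free_Abelian_group)
  interpret B: comm_group ?B by (rule abelian_free_Abelian_group)
  have "div_cls \<in> hom ?A ?B"
    using keys_cls_sum by (auto simp: hom_def divisor_group_def frag_extend_add div_cls_eq)
  then interpret h: group_hom ?A ?B div_cls by unfold_locales
  have surj: "div_cls ` carrier ?A = carrier ?B"
  proof (intro equalityI subsetI)
    fix x assume x: "x \<in> carrier ?B"
    have "\<exists>y\<in>carrier ?A. div_cls y = x"
    proof (rule free_Abelian_group_induct[of x "F - I"])
      show "Poly_Mapping.keys x \<subseteq> F - I" using x by simp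
      show "\<exists>y\<in>carrier ?A. div_cls y = 0"
        by (intro bexI[of _ 0]) (auto simp: divisor_group_def)
    next
      fix x y assume "\<exists>z\<in>carrier ?A. div_cls z = x" "\<exists>z\<in>carrier ?A. div_cls z = y"
      then obtain x' y' where xy: "x' \<in> carrier ?A" "div_cls x' = x" "y' \<in> carrier ?A" "div_cls y' = y"
        by (elim bexE)
      have "x' - y' \<in> carrier ?A"
        using xy(1,3) keys_diff[of x' y'] unfolding divisor_group_def carrier_free_Abelian_group_iff by blast
      moreover have "div_cls (x' - y') = x - y"
        using xy by (simp add: frag_extend_diff)
      ultimately show "\<exists>z\<in>carrier ?A. div_cls z = x - y" by (rule bexI[rotated])
    next
      fix j assume j: "j \<in> F - I"
      then have "div_cls (frag_of (facet_prime j)) = frag_of j"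
        by (simp add: prime_cls_def cls_def facet_prime_not_monomial_free the_inv_into_f_f[OF inj_facet_prime])
      then show "\<exists>z\<in>carrier ?A. div_cls z = frag_of j"
        using j H_facet_prime[of j] by (intro bexI[of _ "frag_of (facet_prime j)"]) (auto simp: divisor_group_def)
    qed
    then show "x \<in> div_cls ` carrier ?A" by blast
  qed (use h.hom_closed in blast)
  have ker: "kernel ?A ?B div_cls = principal_divisors R"
  proof -
    have "D \<in> kernel ?A ?B div_cls \<longleftrightarrow> D \<in> principal_divisors R" for D
    proof (cases "D \<in> carrier ?A")
      case True
      then have "Poly_Mapping.keys D \<subseteq> H" by (simp add: divisor_group_def)
      then show ?thesis using True principal_divisors_iff by (simp add: kernel_def)
    next
      case False
      then show ?thesis by (simp add: kernel_def principal_divisors_def)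
    qed
    then show ?thesis by blast
  qed
  have iso: "class_group R \<cong> ?B"
    using h.FactGroup_iso[OF surj] by (simp add: class_group_def ker)
  have grp: "group (class_group R)"
    unfolding class_group_def ker[symmetric] by (rule normal.factorgroup_is_group[OF h.normal_kernel])
  have "comm_group (class_group R)"
    using B.iso_imp_comm_group group.iso_sym[OF grp iso] grp group.is_monoid by blast
  then show ?thesis
    using has_rank_iso[OF iso _ B.comm_group_axioms] has_rank_free_Abelian_group finite_FI by blast
qed

end

section \<open>Lattice points of the three kinds of polytopes\<close>

definition ind :: "nat set \<Rightarrow> vec" where
  "ind W = (\<Sum>i\<in>W. unit_vec i)"

lemma lookup_ind: "finite W \<Longrightarrow> Poly_Mapping.lookup (ind W) j = (if j \<in> W then 1 else 0)"
  by (simp add: ind_def lookup_sum lookup_single when_def)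

lemma ind_inject:
  assumes fin: "finite A" "finite B"
  shows "ind A = ind B \<longleftrightarrow> A = B"
proof
  assume eq: "ind A = ind B"
  have "j \<in> A \<longleftrightarrow> j \<in> B" for j
    using lookup_ind[OF fin(1), of j] lookup_ind[OF fin(2), of j] unfolding eq by (auto split: if_splits)
  then show "A = B" by blast
qed simp

lemma ind_lattice:
  assumes "W \<subseteq> {..<d}"
  shows "ind W \<in> lattice d"
proof -
  have fin: "finite W" using assms finite_subset by blast
  have "j \<in> Poly_Mapping.keys (ind W) \<longleftrightarrow> j \<in> W" for j
    unfolding in_keys_iff lookup_ind[OF fin] by simp
  then have "Poly_Mapping.keys (ind W) = W" by blast
  then show ?thesis
    using assms by (simp add: lattice_def real_space_def lookup_ind[OF fin])
qed

text \<open>Equality of two sums of 0/1 vectors: the intersection is where the sum is 2, the union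
  where it is positive.\<close>

definition same_sum :: "nat set \<Rightarrow> nat set \<Rightarrow> nat set \<Rightarrow> nat set \<Rightarrow> bool" where
  "same_sum A B C D \<longleftrightarrow> A \<inter> B = C \<inter> D \<and> A \<union> B = C \<union> D"

lemma ind_add_eq_iff:
  assumes "finite A" "finite B" "finite C" "finite D"
  shows "ind A + ind B = ind C + ind D \<longleftrightarrow> same_sum A B C D"
proof
  assume eq: "ind A + ind B = ind C + ind D"
  have e: "Poly_Mapping.lookup (ind A + ind B) j = Poly_Mapping.lookup (ind C + ind D) j" for j
    using eq by simp
  have "(j \<in> A \<inter> B \<longleftrightarrow> j \<in> C \<inter> D) \<and> (j \<in> A \<union> B \<longleftrightarrow> j \<in> C \<union> D)" for j
    using e[of j] unfolding lookup_add assms[THEN lookup_ind]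
    by (cases "j \<in> A"; cases "j \<in> B"; cases "j \<in> C"; cases "j \<in> D") simp_all
  then show "same_sum A B C D" by (auto simp: same_sum_def)
next
  assume s: "same_sum A B C D"
  show "ind A + ind B = ind C + ind D"
  proof (rule poly_mapping_eqI)
    fix j
    have "(j \<in> A \<inter> B \<longleftrightarrow> j \<in> C \<inter> D)" "(j \<in> A \<union> B \<longleftrightarrow> j \<in> C \<union> D)"
      using s unfolding same_sum_def by blast+
    then show "Poly_Mapping.lookup (ind A + ind B) j = Poly_Mapping.lookup (ind C + ind D) j"
      unfolding lookup_add assms[THEN lookup_ind]
      by (cases "j \<in> A"; cases "j \<in> B"; cases "j \<in> C"; cases "j \<in> D") simp_all
  qed
qed

lemma lookup_scaleR: "Poly_Mapping.lookup (r *\<^sub>R x) i = r * Poly_Mapping.lookup (x :: vec) i"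
proof -
  have "finite {i. r * Poly_Mapping.lookup x i \<noteq> 0}"
    by (rule finite_subset[OF _ finite_lookup[of x]]) auto
  then show ?thesis by (simp add: scaleR_poly_mapping_def)
qed

text \<open>A 0/1 point of a convex hull of 0/1 points is one of them: the distance to it in the
  1-norm is an affine function on the unit cube.\<close>

lemma convex_hull_ind:
  assumes V: "\<And>W. W \<in> \<W> \<Longrightarrow> W \<subseteq> {..<d}" and x: "x \<in> convex hull (ind ` \<W>)" "x \<in> lattice d"
  shows "x \<in> ind ` \<W>"
proof -
  have fin: "finite W" if "W \<in> \<W>" for W
    using V[OF that] finite_subset by blast
  have "convex {y :: vec. \<forall>i. 0 \<le> Poly_Mapping.lookup y i \<and> Poly_Mapping.lookup y i \<le> 1}"
  proof (rule convexI)
    fix y z :: vec and u v :: real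
    assume yz: "y \<in> {y. \<forall>i. 0 \<le> Poly_Mapping.lookup y i \<and> Poly_Mapping.lookup y i \<le> 1}"
      "z \<in> {y. \<forall>i. 0 \<le> Poly_Mapping.lookup y i \<and> Poly_Mapping.lookup y i \<le> 1}" and uv: "0 \<le> u" "0 \<le> v" "u + v = 1"
    have "u * Poly_Mapping.lookup y i + v * Poly_Mapping.lookup z i \<le> u * 1 + v * 1" for i
      using yz uv by (intro add_mono mult_left_mono) auto
    then show "u *\<^sub>R y + v *\<^sub>R z \<in> {y. \<forall>i. 0 \<le> Poly_Mapping.lookup y i \<and> Poly_Mapping.lookup y i \<le> 1}"
      using yz uv by (auto simp: lookup_add lookup_scaleR)
  qed
  moreover have "ind ` \<W> \<subseteq> {y. \<forall>i. 0 \<le> Poly_Mapping.lookup y i \<and> Poly_Mapping.lookup y i \<le> 1}"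
    using fin by (auto simp: lookup_ind)
  ultimately have x01: "0 \<le> Poly_Mapping.lookup x i" "Poly_Mapping.lookup x i \<le> 1" for i
    using x(1) hull_minimal[of "ind ` \<W>" _ convex] by blast+
  have xi: "Poly_Mapping.lookup x i = 0 \<or> Poly_Mapping.lookup x i = 1" for i
  proof -
    have "Poly_Mapping.lookup x i \<in> \<int>" using x(2) by (simp add: lattice_def)
    then obtain k where k: "Poly_Mapping.lookup x i = of_int k" by (auto elim: Ints_cases)
    then have "0 \<le> k" "k \<le> 1" using x01[of i] by auto
    then have "k = 0 \<or> k = 1" by auto
    then show ?thesis using k by auto
  qed
  define X where "X = {i. Poly_Mapping.lookup x i = 1}"
  have Xd: "X \<subseteq> {..<d}"
    using x(2) by (auto simp: X_def lattice_def real_space_def in_keys_iff subset_iff)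
  then have finX: "finite X" using finite_subset by blast
  have "Poly_Mapping.lookup x k = Poly_Mapping.lookup (ind X) k" for k
    using xi[of k] unfolding lookup_ind[OF finX] by (auto simp: X_def)
  then have x_eq: "x = ind X"
    by (rule poly_mapping_eqI)
  define l where "l y = (\<Sum>i<d. if i \<in> X then 1 - Poly_Mapping.lookup y i else Poly_Mapping.lookup y i)" for y :: vec
  have aff: "l (u *\<^sub>R y + v *\<^sub>R z) = u * l y + v * l z" if "u + v = 1" for u v y z
  proof -
    have u: "u = 1 - v" using that by simp
    show ?thesis
      unfolding l_def sum_distrib_left sum.distrib[symmetric] lookup_add lookup_scaleR u
      by (intro sum.cong refl) (auto simp: algebra_simps)
  qed
  show ?thesis
  proof (rule ccontr)
    assume nx: "x \<notin> ind ` \<W>"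
    have "1 \<le> l (ind W)" if W: "W \<in> \<W>" for W
    proof -
      have "W \<noteq> X" using nx x_eq W by auto
      then obtain j where j: "j \<in> W \<longleftrightarrow> j \<notin> X" by blast
      then have jd: "j \<in> {..<d}" using V[OF W] Xd by blast
      have "(if j \<in> X then 1 - Poly_Mapping.lookup (ind W) j else Poly_Mapping.lookup (ind W) j) \<le> l (ind W)"
        unfolding l_def using fin[OF W] by (intro member_le_sum jd) (auto simp: lookup_ind)
      then show ?thesis using j fin[OF W] by (auto simp: lookup_ind split: if_splits)
    qed
    then have "ind ` \<W> \<subseteq> {y. 1 \<le> l y}" by auto
    moreover have "convex {y. 1 \<le> l y}"
    proof (rule convexI)
      fix y z u v assume yz: "y \<in> {y. 1 \<le> l y}" "z \<in> {y. 1 \<le> l y}" and uv: "0 \<le> u" "0 \<le> v" "u + v = (1::real)"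
      have "u * 1 + v * 1 \<le> u * l y + v * l z"
        using yz uv by (intro add_mono mult_left_mono) auto
      then show "u *\<^sub>R y + v *\<^sub>R z \<in> {y. 1 \<le> l y}" using aff uv by simp
    qed
    ultimately have "1 \<le> l x"
      using x(1) hull_minimal[of "ind ` \<W>" _ convex] by blast
    moreover have "l x = 0"
      unfolding l_def x_eq by (intro sum.neutral) (auto simp: lookup_ind[OF finX])
    ultimately show False by simp
  qed
qed

definition lattice_points :: "polytope_in \<Rightarrow> vec set" where
  "lattice_points P = snd P \<inter> lattice (fst P)"

text \<open>The inequalities of \<open>order_polytope\<close> make coordinates weakly decrease
  upwards in the order, so the places with value one form a lower set.\<close>

definition down_sets :: "nat \<Rightarrow> (nat \<times> nat) set \<Rightarrow> nat set set" where
  "down_sets d r = {W. W \<subseteq> {..<d} \<and> (\<forall>i<d. \<forall>j\<in>W. (i, j) \<in> r \<longrightarrow> i \<in> W)}"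

lemma lattice_points_order_polytope: "lattice_points (order_polytope d r) = ind ` down_sets d r"
proof (intro equalityI subsetI)
  fix x assume "x \<in> lattice_points (order_polytope d r)"
  then have x: "x \<in> lattice d" "\<And>i j. i < d \<Longrightarrow> j < d \<Longrightarrow> (i, j) \<in> r \<Longrightarrow> i \<noteq> j \<Longrightarrow> Poly_Mapping.lookup x i \<ge> Poly_Mapping.lookup x j"
    "\<And>i. i < d \<Longrightarrow> 0 \<le> Poly_Mapping.lookup x i \<and> Poly_Mapping.lookup x i \<le> 1"
    by (auto simp: lattice_points_def order_polytope_def)
  have xi: "Poly_Mapping.lookup x i = 0 \<or> Poly_Mapping.lookup x i = 1" for i
  proof (cases "i < d")
    case True
    have "Poly_Mapping.lookup x i \<in> \<int>" using x(1) by (simp add: lattice_def)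
    then obtain k where k: "Poly_Mapping.lookup x i = of_int k" by (auto elim: Ints_cases)
    then have "0 \<le> k" "k \<le> 1" using x(3)[OF True] by auto
    then have "k = 0 \<or> k = 1" by auto
    then show ?thesis using k by auto
  next
    case False
    then show ?thesis using x(1) by (auto simp: lattice_def real_space_def in_keys_iff subset_iff)
  qed
  define X where "X = {i. Poly_Mapping.lookup x i = 1}"
  have Xd: "X \<subseteq> {..<d}"
    using x(1) by (auto simp: X_def lattice_def real_space_def in_keys_iff subset_iff)
  then have finX: "finite X" using finite_subset by blast
  have "Poly_Mapping.lookup x k = Poly_Mapping.lookup (ind X) k" for k
    using xi[of k] unfolding lookup_ind[OF finX] by (auto simp: X_def)
  then have x_eq: "x = ind X"
    by (rule poly_mapping_eqI)
  have "i \<in> X" if "i < d" "j \<in> X" "(i, j) \<in> r" for i j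
    using x(2)[of i j] xi[of i] that Xd by (cases "i = j") (auto simp: X_def)
  then show "x \<in> ind ` down_sets d r"
    using x_eq Xd by (auto simp: down_sets_def)
next
  fix x assume "x \<in> ind ` down_sets d r"
  then obtain W where W: "W \<in> down_sets d r" "x = ind W" by blast
  then have "W \<subseteq> {..<d}" by (simp add: down_sets_def)
  then have "finite W" using finite_subset by blast
  then show "x \<in> lattice_points (order_polytope d r)"
    using W ind_lattice[OF \<open>W \<subseteq> {..<d}\<close>]
    by (auto simp: lattice_points_def order_polytope_def lookup_ind down_sets_def lattice_def)
qed

lemma lattice_points_convex_hull:
  assumes "\<And>W. W \<in> \<W> \<Longrightarrow> W \<subseteq> {..<d}"
  shows "lattice_points (d, convex hull (ind ` \<W>)) = ind ` \<W>"
  using convex_hull_ind[OF assms] ind_lattice assms hull_subset[of "ind ` \<W>" convex]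
  by (auto simp: lattice_points_def)

lemma lattice_polytope_convex_hull:
  assumes "\<And>W. W \<in> \<W> \<Longrightarrow> W \<subseteq> {..<d}"
  shows "lattice_polytope (d, convex hull (ind ` \<W>))"
proof -
  have "finite \<W>"
    by (rule finite_subset[of _ "Pow {..<d}"]) (use assms in auto)
  then show ?thesis
    using assms ind_lattice unfolding lattice_polytope_def by (auto intro!: exI[of _ "ind ` \<W>"])
qed

lemma stable_set_polytope_eq: "stable_set_polytope d E = (d, convex hull (ind ` {W. stable_set d E W}))"
proof -
  have "{\<Sum>i\<in>W. unit_vec i | W. stable_set d E W} = ind ` {W. stable_set d E W}"
    unfolding ind_def by blast
  then show ?thesis by (simp add: stable_set_polytope_def)
qed

lemma edge_polytope_eq:
  assumes "simple_graph d E"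
  shows "edge_polytope d E = (d, convex hull (ind ` E))"
proof -
  have "{unit_vec i + unit_vec j | i j. {i, j} \<in> E} = ind ` E"
  proof (intro equalityI subsetI)
    fix x assume "x \<in> {unit_vec i + unit_vec j | i j. {i, j} \<in> E}"
    then obtain i j where ij: "x = unit_vec i + unit_vec j" "{i, j} \<in> E" by blast
    then have "i \<noteq> j" using assms by (auto simp: simple_graph_def)
    then show "x \<in> ind ` E" using ij by (intro image_eqI[of _ _ "{i, j}"]) (auto simp: ind_def)
  next
    fix x assume "x \<in> ind ` E"
    then obtain e where e: "e \<in> E" "x = ind e" by blast
    then obtain i j where "e = {i, j}" "i \<noteq> j"
      using assms by (auto simp: simple_graph_def card_2_iff)
    then show "x \<in> {unit_vec i + unit_vec j | i j. {i, j} \<in> E}"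
      using e by (auto simp: ind_def)
  qed
  then show ?thesis by (simp add: edge_polytope_def)
qed

lemma lattice_points_stable_set_polytope:
  "lattice_points (stable_set_polytope d E) = ind ` {W. stable_set d E W}"
  unfolding stable_set_polytope_eq by (rule lattice_points_convex_hull) (simp add: stable_set_def)

lemma lattice_points_edge_polytope:
  "simple_graph d E \<Longrightarrow> lattice_points (edge_polytope d E) = ind ` E"
  unfolding edge_polytope_eq by (rule lattice_points_convex_hull) (simp add: simple_graph_def)

section \<open>Unimodular equivalence and sums of lattice points\<close>

text \<open>All that is kept of a unimodular equivalence: which pairs of lattice points have equal
  sums. Dimension and ambient lattice are forgotten.\<close>

definition sum_equiv :: "nat set set \<Rightarrow> nat set set \<Rightarrow> bool" where
  "sum_equiv \<A> \<B> \<longleftrightarrow> (\<exists>\<phi>. bij_betw \<phi> \<A> \<B> \<and> (\<forall>A\<in>\<A>. \<forall>B\<in>\<A>. \<forall>C\<in>\<A>. \<forall>D\<in>\<A>.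
    same_sum A B C D \<longleftrightarrow> same_sum (\<phi> A) (\<phi> B) (\<phi> C) (\<phi> D)))"

lemma sum_equiv_sym:
  assumes "sum_equiv \<A> \<B>"
  shows "sum_equiv \<B> \<A>"
proof -
  obtain \<phi> where \<phi>: "bij_betw \<phi> \<A> \<B>" and s: "\<And>A B C D. A \<in> \<A> \<Longrightarrow> B \<in> \<A> \<Longrightarrow> C \<in> \<A> \<Longrightarrow> D \<in> \<A> \<Longrightarrow>
    same_sum A B C D \<longleftrightarrow> same_sum (\<phi> A) (\<phi> B) (\<phi> C) (\<phi> D)"
    using assms unfolding sum_equiv_def by blast
  have "bij_betw (inv_into \<A> \<phi>) \<B> \<A>" using \<phi> by (rule bij_betw_inv_into)
  moreover have "inv_into \<A> \<phi> B \<in> \<A>" "\<phi> (inv_into \<A> \<phi> B) = B" if "B \<in> \<B>" for B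
    using that \<phi> bij_betw_inv_into_right[OF \<phi> that] by (auto simp: bij_betw_def inv_into_into)
  ultimately show ?thesis
    unfolding sum_equiv_def using s by (intro exI[of _ "inv_into \<A> \<phi>"]) auto
qed

text \<open>Equal sums mean equal midpoints. Midpoints stay in the affine hull, where the affine map
  respects them and is injective.\<close>

lemma unimodularly_equivalent_sum_equiv:
  assumes eq: "unimodularly_equivalent P Q"
    and P: "lattice_points P = ind ` \<A>" "\<And>A. A \<in> \<A> \<Longrightarrow> finite A"
    and Q: "lattice_points Q = ind ` \<B>" "\<And>B. B \<in> \<B> \<Longrightarrow> finite B"
  shows "sum_equiv \<A> \<B>"
proof -
  obtain d P' where P': "P = (d, P')" by (cases P)
  obtain e Q' where Q': "Q = (e, Q')" by (cases Q)
  obtain \<phi> where aff: "affine_on (affine hull P') \<phi>"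
    and bij: "bij_betw \<phi> (affine hull P') (affine hull Q')"
    and bijl: "bij_betw \<phi> (affine hull P' \<inter> lattice d) (affine hull Q' \<inter> lattice e)"
    and im: "\<phi> ` P' = Q'"
    using eq by (auto simp: unimodularly_equivalent_def P' Q')
  have LP: "P' \<inter> lattice d = ind ` \<A>" and LQ: "Q' \<inter> lattice e = ind ` \<B>"
    using P Q by (auto simp: lattice_points_def P' Q')
  have subP: "P' \<subseteq> affine hull P'" and subQ: "Q' \<subseteq> affine hull Q'" by (rule hull_subset)+
  have inj: "inj_on \<phi> (affine hull P')" using bij by (simp add: bij_betw_def)
  have "\<phi> ` (P' \<inter> lattice d) = Q' \<inter> lattice e"
  proof (intro equalityI subsetI)
    fix y assume "y \<in> \<phi> ` (P' \<inter> lattice d)"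
    then obtain x where x: "x \<in> P'" "x \<in> lattice d" "y = \<phi> x" by blast
    then have "y \<in> affine hull Q' \<inter> lattice e"
      using bijl subP by (auto simp: bij_betw_def)
    then show "y \<in> Q' \<inter> lattice e" using im x by blast
  next
    fix y assume y: "y \<in> Q' \<inter> lattice e"
    then have "y \<in> \<phi> ` (affine hull P' \<inter> lattice d)"
      using bijl subQ by (auto simp: bij_betw_def)
    then obtain x where x: "x \<in> affine hull P'" "x \<in> lattice d" "y = \<phi> x" by blast
    obtain x' where x': "x' \<in> P'" "y = \<phi> x'" using y im by blast
    then have "x = x'" using inj x subP by (metis inj_onD subsetD)
    then show "y \<in> \<phi> ` (P' \<inter> lattice d)" using x x' by blast
  qed
  then have \<phi>im: "\<phi> ` ind ` \<A> = ind ` \<B>" by (simp add: LP LQ)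
  have in_aff: "ind A \<in> affine hull P'" if "A \<in> \<A>" for A
    using that LP subP by blast
  have half: "\<phi> ((1/2) *\<^sub>R x + (1/2) *\<^sub>R y) = (1/2) *\<^sub>R (\<phi> x + \<phi> y)"
    if "x \<in> affine hull P'" "y \<in> affine hull P'" for x y
    using aff that unfolding affine_on_def by (simp add: scaleR_add_right)
  have half_in: "(1/2) *\<^sub>R x + (1/2) *\<^sub>R y \<in> affine hull P'"
    if "x \<in> affine hull P'" "y \<in> affine hull P'" for x y
    using affine_affine_hull[of P'] that unfolding affine_def by simp
  have sums: "a + b = c + d' \<longleftrightarrow> \<phi> a + \<phi> b = \<phi> c + \<phi> d'"
    if m: "a \<in> affine hull P'" "b \<in> affine hull P'" "c \<in> affine hull P'" "d' \<in> affine hull P'" for a b c d'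
  proof -
    have scale: "(1/2) *\<^sub>R x = (1/2) *\<^sub>R y \<longleftrightarrow> x = y" for x y :: vec
      by simp
    have "a + b = c + d' \<longleftrightarrow> (1/2) *\<^sub>R a + (1/2) *\<^sub>R b = (1/2) *\<^sub>R c + (1/2) *\<^sub>R d'"
      unfolding scaleR_add_right[symmetric] scale ..
    also have "\<dots> \<longleftrightarrow> \<phi> ((1/2) *\<^sub>R a + (1/2) *\<^sub>R b) = \<phi> ((1/2) *\<^sub>R c + (1/2) *\<^sub>R d')"
      using inj_on_eq_iff[OF inj half_in[OF m(1,2)] half_in[OF m(3,4)]] by simp
    also have "\<dots> \<longleftrightarrow> \<phi> a + \<phi> b = \<phi> c + \<phi> d'"
      unfolding half[OF m(1,2)] half[OF m(3,4)] scale ..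
    finally show ?thesis .
  qed
  define \<psi> where "\<psi> A = (SOME B. B \<in> \<B> \<and> \<phi> (ind A) = ind B)" for A
  have \<psi>: "\<psi> A \<in> \<B> \<and> \<phi> (ind A) = ind (\<psi> A)" if "A \<in> \<A>" for A
  proof -
    have "\<exists>B. B \<in> \<B> \<and> \<phi> (ind A) = ind B" using \<phi>im that by blast
    then show ?thesis unfolding \<psi>_def by (rule someI_ex)
  qed
  have "bij_betw \<psi> \<A> \<B>"
    unfolding bij_betw_def
  proof
    show "inj_on \<psi> \<A>"
    proof (rule inj_onI)
      fix A A' assume AA: "A \<in> \<A>" "A' \<in> \<A>" "\<psi> A = \<psi> A'"
      then have "\<phi> (ind A) = \<phi> (ind A')" using \<psi> by metis
      then have "ind A = ind A'" using inj in_aff AA by (meson inj_onD)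
      then show "A = A'" using ind_inject P(2) AA by blast
    qed
    show "\<psi> ` \<A> = \<B>"
    proof (intro equalityI subsetI)
      fix B assume B: "B \<in> \<B>"
      have "ind B \<in> \<phi> ` ind ` \<A>" unfolding \<phi>im using B by (rule imageI)
      then obtain A where A: "A \<in> \<A>" "ind B = \<phi> (ind A)" by blast
      then have "ind B = ind (\<psi> A)" using \<psi>[OF A(1)] by simp
      then have "\<psi> A = B" using ind_inject[OF Q(2)[OF B] Q(2), of "\<psi> A"] \<psi>[OF A(1)] by blast
      then show "B \<in> \<psi> ` \<A>" using A by blast
    qed (use \<psi> in blast)
  qed
  moreover have "same_sum A B C D \<longleftrightarrow> same_sum (\<psi> A) (\<psi> B) (\<psi> C) (\<psi> D)"
    if "A \<in> \<A>" "B \<in> \<A>" "C \<in> \<A>" "D \<in> \<A>" for A B C D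
    using sums[of "ind A" "ind B" "ind C" "ind D"] in_aff that \<psi> P(2) Q(2)
    by (simp add: ind_add_eq_iff)
  ultimately show ?thesis unfolding sum_equiv_def by blast
qed

lemma unimodularly_equivalent_refl: "unimodularly_equivalent P P"
  by (auto simp: unimodularly_equivalent_def affine_on_def intro!: exI[of _ "\<lambda>x. x"] bij_betw_id[unfolded id_def])

text \<open>A class contains the polytope it comes from only if that is a lattice polytope. In the
  applications \<open>Q\<close> is a stable set or edge polytope, so an order polytope always stands
  on the left.\<close>

lemma unimodular_class_eqD:
  assumes "unimodular_class P = unimodular_class Q" "lattice_polytope Q"
  shows "unimodularly_equivalent P Q"
  using assms unimodularly_equivalent_refl[of Q] by (auto simp: unimodular_class_def)

section \<open>Invariants distinguishing the three families\<close>

text \<open>An edge polytope has at most six lattice points with a given union of supports on four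
  vertices, so no point is the sum of four disjoint pairs.\<close>

lemma no_eight_edges:
  assumes "distinct [A1, B1, A2, B2, A3, B3, A4, B4]"
    and "\<And>X. X \<in> {A1, B1, A2, B2, A3, B3, A4, B4} \<Longrightarrow> card X = 2"
    and "same_sum A1 B1 A2 B2" "same_sum A1 B1 A3 B3" "same_sum A1 B1 A4 B4"
  shows False
proof -
  let ?U = "A1 \<union> B1" and ?L = "[A1, B1, A2, B2, A3, B3, A4, B4]"
  have "card A1 = 2" "card B1 = 2" using assms(2) by auto
  then have fin: "finite ?U" and U4: "card ?U \<le> 4"
    using card_Un_le[of A1 B1] card.infinite[of A1] card.infinite[of B1] by auto
  note U = assms(3-5)[unfolded same_sum_def, THEN conjunct2]
  have "A1 \<subseteq> ?U" "B1 \<subseteq> ?U" by blast+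
  moreover have "A2 \<subseteq> ?U" "B2 \<subseteq> ?U" unfolding U(1) by blast+
  moreover have "A3 \<subseteq> ?U" "B3 \<subseteq> ?U" unfolding U(2) by blast+
  moreover have "A4 \<subseteq> ?U" "B4 \<subseteq> ?U" unfolding U(3) by blast+
  ultimately have sub: "X \<subseteq> ?U" if "X \<in> {A1, B1, A2, B2, A3, B3, A4, B4}" for X
    using that by (elim insertE emptyE) (simp_all only:)
  have "set ?L \<subseteq> {X. X \<subseteq> ?U \<and> card X = 2}"
  proof
    fix X assume "X \<in> set ?L"
    then have X: "X \<in> {A1, B1, A2, B2, A3, B3, A4, B4}" by simp
    then have "X \<subseteq> ?U" by (rule sub)
    then show "X \<in> {X. X \<subseteq> ?U \<and> card X = 2}" using assms(2)[OF X] by simp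
  qed
  then have le: "card (set ?L) \<le> card {X. X \<subseteq> ?U \<and> card X = 2}"
    using fin by (intro card_mono) auto
  have eq: "card {X. X \<subseteq> ?U \<and> card X = 2} = card ?U choose 2"
    using n_subsets[OF fin] by simp
  have "card ?U * (card ?U - 1) \<le> 4 * (4 - 1)"
    using U4 by (intro mult_le_mono) simp_all
  then have "card ?U choose 2 \<le> 6"
    unfolding choose_two using div_le_mono[of _ 12 2] by fastforce
  then have "card (set ?L) \<le> 6" using le unfolding eq by (rule le_trans[rotated])
  then show False
    using distinct_card[OF assms(1)] by simp
qed

text \<open>The eight sets stand for the four antipodal pairs of a cube; the bijection carries them
  to eight distinct edges in four pairs with equal sums.\<close>

lemma edge_family_no_cube:
  assumes "sum_equiv \<A> E" "\<And>e. e \<in> E \<Longrightarrow> card e = 2"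
    and "distinct [A1, B1, A2, B2, A3, B3, A4, B4]"
    and "set [A1, B1, A2, B2, A3, B3, A4, B4] \<subseteq> \<A>"
    and "same_sum A1 B1 A2 B2" "same_sum A1 B1 A3 B3" "same_sum A1 B1 A4 B4"
  shows False
proof -
  obtain \<phi> where \<phi>: "bij_betw \<phi> \<A> E" and s: "\<And>A B C D. A \<in> \<A> \<Longrightarrow> B \<in> \<A> \<Longrightarrow> C \<in> \<A> \<Longrightarrow> D \<in> \<A> \<Longrightarrow>
    same_sum A B C D \<longleftrightarrow> same_sum (\<phi> A) (\<phi> B) (\<phi> C) (\<phi> D)"
    using assms(1) unfolding sum_equiv_def by blast
  have m: "A1 \<in> \<A>" "B1 \<in> \<A>" "A2 \<in> \<A>" "B2 \<in> \<A>" "A3 \<in> \<A>" "B3 \<in> \<A>" "A4 \<in> \<A>" "B4 \<in> \<A>"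
    using assms(4) by simp_all
  have "inj_on \<phi> (set [A1, B1, A2, B2, A3, B3, A4, B4])"
    using \<phi> assms(4) inj_on_subset unfolding bij_betw_def by blast
  then have "distinct (map \<phi> [A1, B1, A2, B2, A3, B3, A4, B4])"
    using assms(3) distinct_map by blast
  then have d: "distinct [\<phi> A1, \<phi> B1, \<phi> A2, \<phi> B2, \<phi> A3, \<phi> B3, \<phi> A4, \<phi> B4]"
    by (simp only: list.map)
  have "\<phi> X \<in> E" if "X \<in> \<A>" for X
    using \<phi> that by (rule bij_betwE[THEN bspec])
  then have c: "card X = 2" if "X \<in> {\<phi> A1, \<phi> B1, \<phi> A2, \<phi> B2, \<phi> A3, \<phi> B3, \<phi> A4, \<phi> B4}" for X
    using that assms(2) \<open>\<And>X. X \<in> \<A> \<Longrightarrow> \<phi> X \<in> E\<close> m by (elim insertE emptyE) simp_all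
  show False
    by (rule no_eight_edges[OF d c s[OF m(1-4), THEN iffD1, OF assms(5)]
      s[OF m(1,2,5,6), THEN iffD1, OF assms(6)] s[OF m(1,2,7,8), THEN iffD1, OF assms(7)]])
qed

text \<open>The point \<open>{}\<close> of a stable set polytope has the singletons as its only neighbours, and they
  satisfy no linear relation.\<close>

lemma stable_family_no_square:
  assumes eq: "sum_equiv \<A> \<S>"
    and \<S>: "{} \<in> \<S>" "\<And>W X. W \<in> \<S> \<Longrightarrow> X \<subseteq> W \<Longrightarrow> X \<in> \<S>"
    and square: "\<And>v. v \<in> \<A> \<Longrightarrow> \<exists>k1\<in>\<A>. \<exists>k2\<in>\<A>. \<exists>k3\<in>\<A>. \<exists>k4\<in>\<A>. k1 \<noteq> k2 \<and> k1 \<noteq> k3 \<and> same_sum k1 k4 k2 k3 \<and>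
      (\<forall>k\<in>{k1, k2, k3, k4}. k \<noteq> v \<and> (\<forall>C\<in>\<A>. \<forall>D\<in>\<A>. same_sum v k C D \<longrightarrow> C = v \<or> D = v))"
  shows False
proof -
  obtain \<phi> where \<phi>: "bij_betw \<phi> \<A> \<S>" and s: "\<And>A B C D. A \<in> \<A> \<Longrightarrow> B \<in> \<A> \<Longrightarrow> C \<in> \<A> \<Longrightarrow> D \<in> \<A> \<Longrightarrow>
    same_sum A B C D \<longleftrightarrow> same_sum (\<phi> A) (\<phi> B) (\<phi> C) (\<phi> D)"
    using eq unfolding sum_equiv_def by blast
  have inj: "inj_on \<phi> \<A>" and im: "\<phi> ` \<A> = \<S>" using \<phi> by (auto simp: bij_betw_def)
  obtain v where v: "v \<in> \<A>" "\<phi> v = {}" using im \<S>(1) by (metis imageE)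
  let ?cond = "\<lambda>k1 k2 k3 k4. k1 \<noteq> k2 \<and> k1 \<noteq> k3 \<and> same_sum k1 k4 k2 k3 \<and>
      (\<forall>k\<in>{k1, k2, k3, k4}. k \<noteq> v \<and> (\<forall>C\<in>\<A>. \<forall>D\<in>\<A>. same_sum v k C D \<longrightarrow> C = v \<or> D = v))"
  obtain k1 k2 k3 k4 where kA: "k1 \<in> \<A>" "k2 \<in> \<A>" "k3 \<in> \<A>" "k4 \<in> \<A>" and cond: "?cond k1 k2 k3 k4"
    using square[OF v(1)] by (elim bexE) (rule that, assumption+)
  have k: "k1 \<in> \<A>" "k2 \<in> \<A>" "k3 \<in> \<A>" "k4 \<in> \<A>" "k1 \<noteq> k2" "k1 \<noteq> k3" "same_sum k1 k4 k2 k3"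
    using kA cond by simp_all
  have all: "\<forall>k\<in>{k1, k2, k3, k4}. k \<noteq> v \<and> (\<forall>C\<in>\<A>. \<forall>D\<in>\<A>. same_sum v k C D \<longrightarrow> C = v \<or> D = v)"
    using cond by (elim conjE)
  have u: "C = v \<or> D = v" if "k \<in> {k1, k2, k3, k4}" "C \<in> \<A>" "D \<in> \<A>" "same_sum v k C D" for k C D
    using bspec[OF all that(1)] that(2-4) by simp
  have nv: "k \<noteq> v" if "k \<in> {k1, k2, k3, k4}" for k
    using bspec[OF all that] by simp
  \<comment> \<open>Splitting an element \<open>a\<close> off \<open>\<phi> k\<close> decomposes the
    sum of \<open>{}\<close> and \<open>\<phi> k\<close>. Uniqueness of the sum at \<open>v\<close>
    forces the remainder to be empty.\<close>
  have single: "\<exists>a. \<phi> k = {a}" if kk: "k \<in> {k1, k2, k3, k4}" for k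
  proof -
    have kA: "k \<in> \<A>" using kk k by (elim insertE emptyE) simp_all
    have "\<phi> k \<noteq> {}" using inj_onD[OF inj _ kA v(1)] nv[OF kk] v(2) by metis
    then obtain a where a: "a \<in> \<phi> k" by blast
    have "{a} \<in> \<phi> ` \<A>" "\<phi> k - {a} \<in> \<phi> ` \<A>"
      unfolding im using \<S>(2)[of "\<phi> k"] im kA a by blast+
    then obtain C D where CD: "C \<in> \<A>" "D \<in> \<A>" "\<phi> C = {a}" "\<phi> D = \<phi> k - {a}" by (metis imageE)
    have "same_sum v k C D"
      unfolding s[OF v(1) kA CD(1,2)] CD v(2) using a by (auto simp: same_sum_def)
    then have "C = v \<or> D = v" by (rule u[OF kk CD(1,2)])
    then show ?thesis using CD v(2) a by auto
  qed
  obtain a1 a2 a3 a4 where a: "\<phi> k1 = {a1}" "\<phi> k2 = {a2}" "\<phi> k3 = {a3}" "\<phi> k4 = {a4}"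
    using single[of k1] single[of k2] single[of k3] single[of k4] by blast
  have "same_sum {a1} {a4} {a2} {a3}"
    using k(7) unfolding s[OF k(1,4,2,3)] a .
  then have "a1 = a2 \<or> a1 = a3" by (auto simp: same_sum_def)
  then have "\<phi> k1 = \<phi> k2 \<or> \<phi> k1 = \<phi> k3" using a by auto
  then show False using inj_onD[OF inj _ k(1,2)] inj_onD[OF inj _ k(1,3)] k(5,6) by blast
qed

text \<open>In a lattice of sets, two points whose sum has no other decomposition are comparable,
  because \<open>A + B = (A \<inter> B) + (A \<union> B)\<close>.\<close>

lemma unique_sum_comparable:
  assumes \<phi>: "bij_betw \<phi> \<A> \<D>" and s: "\<And>A B C D. A \<in> \<A> \<Longrightarrow> B \<in> \<A> \<Longrightarrow> C \<in> \<A> \<Longrightarrow> D \<in> \<A> \<Longrightarrow>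
      same_sum A B C D \<longleftrightarrow> same_sum (\<phi> A) (\<phi> B) (\<phi> C) (\<phi> D)"
    and \<D>: "\<And>X Y. X \<in> \<D> \<Longrightarrow> Y \<in> \<D> \<Longrightarrow> X \<inter> Y \<in> \<D> \<and> X \<union> Y \<in> \<D>"
    and AB: "A \<in> \<A>" "B \<in> \<A>" and u: "\<And>C D. C \<in> \<A> \<Longrightarrow> D \<in> \<A> \<Longrightarrow> same_sum A B C D \<Longrightarrow> C = A \<or> C = B"
  shows "\<phi> A \<subseteq> \<phi> B \<or> \<phi> B \<subseteq> \<phi> A"
proof -
  have im: "\<phi> ` \<A> = \<D>" using \<phi> by (simp add: bij_betw_def)
  have "\<phi> A \<inter> \<phi> B \<in> \<phi> ` \<A>" "\<phi> A \<union> \<phi> B \<in> \<phi> ` \<A>"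
    using \<D>[of "\<phi> A" "\<phi> B"] im AB by blast+
  then obtain C D where CD: "C \<in> \<A>" "D \<in> \<A>" "\<phi> C = \<phi> A \<inter> \<phi> B" "\<phi> D = \<phi> A \<union> \<phi> B" by (metis imageE)
  have "same_sum A B C D"
    unfolding s[OF AB CD(1,2)] CD by (auto simp: same_sum_def)
  then have "C = A \<or> C = B" by (rule u[OF CD(1,2)])
  then show ?thesis using CD(3) by blast
qed

subsection \<open>Order polytopes and the path on four vertices\<close>

text \<open>Two adjacent inner vertices \<open>p\<close>, \<open>q\<close> of an induced path \<open>u\<close>, \<open>p\<close>, \<open>q\<close>, \<open>z\<close> cannot lie on the same side
  of the image \<open>x0\<close> of the empty stable set.\<close>

lemma path_same_side_aux:
  fixes x0 xp xq xu xz xpz xuq xuz :: "'a set"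
  assumes ne: "xp \<noteq> x0" "xu \<noteq> x0" "xz \<noteq> x0" "xpz \<noteq> xq"
    and "x0 \<subseteq> xu \<or> xu \<subseteq> x0" "x0 \<subseteq> xz \<or> xz \<subseteq> x0" "xp \<subseteq> xu \<or> xu \<subseteq> xp" "xq \<subseteq> xz \<or> xz \<subseteq> xq"
    and "xpz \<subseteq> xuq \<or> xuq \<subseteq> xpz"
    and pz: "x0 \<inter> xpz = xp \<inter> xz" "x0 \<union> xpz = xp \<union> xz"
    and uq: "x0 \<inter> xuq = xu \<inter> xq" "x0 \<union> xuq = xu \<union> xq"
    and uz: "x0 \<inter> xuz = xu \<inter> xz" "x0 \<union> xuz = xu \<union> xz"
    and up: "x0 \<subseteq> xp" "xp \<subseteq> xq"
  shows False
proof -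
  \<comment> \<open>The letters after \<open>x\<close> list the vertices of the stable set whose
    image is meant; \<open>x0\<close> is the image of \<open>{}\<close>. If \<open>xu\<close> were
    above \<open>x0\<close>, then \<open>xu \<inter> xq = x0\<close>; as \<open>xp\<close> lies
    between \<open>x0\<close> and \<open>xq\<close> and is comparable to \<open>xu\<close>, one of
    \<open>xp\<close>, \<open>xu\<close> would equal \<open>x0\<close>.\<close>
  have u: "xu \<subseteq> x0"
  proof (rule ccontr)
    assume "\<not> xu \<subseteq> x0"
    then have "x0 \<subseteq> xu" using assms(5) by blast
    then have "xu \<inter> xq = x0" using uq up by blast
    then show False using assms(7) ne up by blast
  qed
  have uqi: "x0 \<inter> xuq = xu" "x0 \<union> xuq = xq" using uq u up by blast+
  show False
  proof (cases "xz \<subseteq> x0")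
    \<comment> \<open>Both \<open>xu\<close> and \<open>xz\<close> lie below \<open>x0\<close> and
      have union \<open>x0\<close>. Comparing \<open>xpz\<close> with \<open>xuq\<close> inside
      \<open>x0\<close> makes them comparable, so one of them is all of \<open>x0\<close>.\<close>
    case True
    then have "x0 \<inter> xpz = xz" "x0 \<union> xpz = xp" using pz up by blast+
    moreover have "xu \<union> xz = x0" using uz u True by blast
    ultimately show False using uqi assms(9) ne u True by blast
  next
    \<comment> \<open>\<open>xpz\<close> contains \<open>x0\<close> and \<open>xuq\<close> does not,
      so \<open>xuq\<close> is the smaller of the two; joined with \<open>x0\<close> it gives
      \<open>xq\<close> inside \<open>xpz\<close>, hence the excluded equality of these two.\<close>
    case False
    then have z: "x0 \<subseteq> xz" using assms(6) by blast
    then have pz0: "xp \<inter> xz = x0" using pz up by blast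
    then have zq: "xz \<subseteq> xq" using assms(8) ne up by blast
    have "x0 \<subseteq> xpz" using pz pz0 by blast
    then have "xpz = xp \<union> xz" using pz by blast
    then show False using uqi assms(9) ne zq up \<open>x0 \<subseteq> xpz\<close> u by blast
  qed
qed

text \<open>If \<open>xq\<close> lies below \<open>xp\<close>, the path is read from the other end,
  which swaps \<open>p\<close> with \<open>q\<close> and \<open>u\<close> with
  \<open>z\<close>.\<close>

lemma path_same_side_up:
  fixes x0 xp xq xu xz xpz xuq xuz :: "'a set"
  assumes ne: "xp \<noteq> x0" "xq \<noteq> x0" "xu \<noteq> x0" "xz \<noteq> x0" "xpz \<noteq> xq" "xuq \<noteq> xp"
    and cmp: "x0 \<subseteq> xu \<or> xu \<subseteq> x0" "x0 \<subseteq> xz \<or> xz \<subseteq> x0" "xp \<subseteq> xu \<or> xu \<subseteq> xp" "xq \<subseteq> xz \<or> xz \<subseteq> xq"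
      "xp \<subseteq> xq \<or> xq \<subseteq> xp" "xpz \<subseteq> xuq \<or> xuq \<subseteq> xpz"
    and pz: "x0 \<inter> xpz = xp \<inter> xz" "x0 \<union> xpz = xp \<union> xz"
    and uq: "x0 \<inter> xuq = xu \<inter> xq" "x0 \<union> xuq = xu \<union> xq"
    and uz: "x0 \<inter> xuz = xu \<inter> xz" "x0 \<union> xuz = xu \<union> xz"
    and up: "x0 \<subseteq> xp" "x0 \<subseteq> xq"
  shows False
  using cmp(5)
proof
  assume "xp \<subseteq> xq"
  then show False
    by (rule path_same_side_aux[OF ne(1,3,4,5) cmp(1,2,3,4,6) pz uq uz up(1)])
next
  assume le: "xq \<subseteq> xp"
  have pz': "x0 \<inter> xpz = xz \<inter> xp" "x0 \<union> xpz = xz \<union> xp"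
    by (simp_all only: pz Int_commute[of xp] Un_commute[of xp])
  have uq': "x0 \<inter> xuq = xq \<inter> xu" "x0 \<union> xuq = xq \<union> xu"
    by (simp_all only: uq Int_commute[of xu] Un_commute[of xu])
  have uz': "x0 \<inter> xuz = xz \<inter> xu" "x0 \<union> xuz = xz \<union> xu"
    by (simp_all only: uz Int_commute[of xu] Un_commute[of xu])
  show False
    by (rule path_same_side_aux[OF ne(2,4,3,6) cmp(2,1,4,3) cmp(6)[THEN disj_comms(1)[THEN iffD1]] uq' pz' uz' up(2) le])
qed

text \<open>Complementation reverses inclusions and exchanges the two halves of each sum relation,
  so the lower side reduces to the upper one.\<close>

lemma path_same_side:
  fixes x0 xp xq xu xz xpz xuq xuz :: "'a set"
  assumes ne: "xp \<noteq> x0" "xq \<noteq> x0" "xu \<noteq> x0" "xz \<noteq> x0" "xpz \<noteq> xq" "xuq \<noteq> xp"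
    and cmp: "x0 \<subseteq> xu \<or> xu \<subseteq> x0" "x0 \<subseteq> xz \<or> xz \<subseteq> x0" "xp \<subseteq> xu \<or> xu \<subseteq> xp" "xq \<subseteq> xz \<or> xz \<subseteq> xq"
      "xp \<subseteq> xq \<or> xq \<subseteq> xp" "xpz \<subseteq> xuq \<or> xuq \<subseteq> xpz"
    and pz: "x0 \<inter> xpz = xp \<inter> xz" "x0 \<union> xpz = xp \<union> xz"
    and uq: "x0 \<inter> xuq = xu \<inter> xq" "x0 \<union> xuq = xu \<union> xq"
    and uz: "x0 \<inter> xuz = xu \<inter> xz" "x0 \<union> xuz = xu \<union> xz"
    and side: "x0 \<subseteq> xp \<and> x0 \<subseteq> xq \<or> xp \<subseteq> x0 \<and> xq \<subseteq> x0"
  shows False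
  using side
proof
  assume "x0 \<subseteq> xp \<and> x0 \<subseteq> xq"
  then show False
    using path_same_side_up[OF ne cmp pz uq uz] by (elim conjE)
next
  assume down: "xp \<subseteq> x0 \<and> xq \<subseteq> x0"
  have c: "A \<subseteq> B \<or> B \<subseteq> A \<Longrightarrow> - A \<subseteq> - B \<or> - B \<subseteq> - A" for A B :: "'a set"
    by (simp only: Compl_subset_Compl_iff disj_commute)
  have n: "A \<noteq> B \<Longrightarrow> - A \<noteq> - B" for A B :: "'a set"
    by (simp only: Compl_eq_Compl_iff not_False_eq_True)
  have e: "- A \<inter> - B = - C \<inter> - D" "- A \<union> - B = - C \<union> - D"
    if "A \<inter> B = C \<inter> D" "A \<union> B = C \<union> D" for A B C D :: "'a set"
    using that by (simp_all only: Compl_Un[symmetric] Compl_Int[symmetric])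
  have d: "- x0 \<subseteq> - xp" "- x0 \<subseteq> - xq"
    using down by (simp_all only: Compl_subset_Compl_iff)
  show False
    by (rule path_same_side_up[OF ne[THEN n] cmp[THEN c] e[OF pz] e[OF uq] e[OF uz] d])
qed

section \<open>The three witnesses\<close>

text \<open>Two minimal elements below the single element 2 below three maximal ones. The three give
  a cube of down-sets, and the antichains below and above 2 give squares on both sides.\<close>

definition stack :: "(nat \<times> nat) set" where
  "stack = {(i, j). i < 6 \<and> j < 6 \<and> (i = j \<or> i < 2 \<and> 2 \<le> j \<or> i = 2 \<and> 3 \<le> j)}"

text \<open>The triangle 0, 1, 2 with one outer vertex on each side. The outer vertices form a
  stable set and give a cube; each side of the triangle is the middle of an induced path between two
  outer vertices. Numbering the triangle first makes the natural order a perfect elimination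
  ordering.\<close>

definition sun :: "nat set set" where
  "sun = {{0, 1}, {0, 2}, {1, 2}, {0, 3}, {2, 3}, {0, 4}, {1, 4}, {1, 5}, {2, 5}}"

text \<open>The complete tripartite graph whose parts \<open>{0, 1}\<close>, \<open>{2, 3}\<close>,
  \<open>{4, 5}\<close> are the fibres of division by 2.\<close>

definition octahedron :: "nat set set" where
  "octahedron = {{i, j} | i j. i < 6 \<and> j < 6 \<and> i div 2 \<noteq> j div 2}"

abbreviation bits :: "nat set \<Rightarrow> nat" where
  "bits W \<equiv> \<Sum>i\<in>W. 2 ^ i"

lemma distinct_if_bits: "distinct (map bits Ws) \<Longrightarrow> distinct Ws"
  by (simp add: distinct_map)

section \<open>Separation of the order polytope of \<open>stack\<close>\<close>

lemma down_sets_stack: "W \<in> down_sets 6 stack \<longleftrightarrow> W \<subseteq> {0, 1} \<or> {0, 1, 2} \<subseteq> W \<and> W \<subseteq> {..<6}"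
proof
  assume W: "W \<in> down_sets 6 stack"
  then have sub: "W \<subseteq> {..<6}" and dn: "\<And>i j. i < 6 \<Longrightarrow> j \<in> W \<Longrightarrow> (i, j) \<in> stack \<Longrightarrow> i \<in> W"
    by (auto simp: down_sets_def)
  show "W \<subseteq> {0, 1} \<or> {0, 1, 2} \<subseteq> W \<and> W \<subseteq> {..<6}"
  proof (cases "W \<subseteq> {0, 1}")
    case False
    then obtain j where j: "j \<in> W" "j \<noteq> 0" "j \<noteq> 1" by blast
    then have "j < 6" "2 \<le> j" using sub by auto
    then have "0 \<in> W" "1 \<in> W" using dn[of 0 j] dn[of 1 j] j by (auto simp: stack_def)
    moreover have "2 \<in> W" using dn[of 2 j] j \<open>j < 6\<close> \<open>2 \<le> j\<close> by (cases "j = 2") (auto simp: stack_def)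
    ultimately show ?thesis using sub by blast
  qed simp
next
  assume "W \<subseteq> {0, 1} \<or> {0, 1, 2} \<subseteq> W \<and> W \<subseteq> {..<6}"
  then show "W \<in> down_sets 6 stack"
  proof
    assume "W \<subseteq> {0, 1}"
    then show ?thesis unfolding down_sets_def stack_def by fastforce
  next
    assume W: "{0, 1, 2} \<subseteq> W \<and> W \<subseteq> {..<6}"
    have "i \<in> W" if "j \<in> W" "(i, j) \<in> stack" for i j
    proof -
      have "i = j \<or> i = 0 \<or> i = 1 \<or> i = 2" using that(2) by (auto simp: stack_def)
      then show ?thesis using W that(1) by blast
    qed
    then show ?thesis using W unfolding down_sets_def by blast
  qed
qed

text \<open>Since 2 is comparable to everything, the sum of a down-set inside \<open>{0, 1}\<close>
  and one containing \<open>{0, 1, 2}\<close> decomposes only into nested sets, hence in one way.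
  Whichever kind \<open>v\<close> is, the other kind contains a square.\<close>

lemma stack_not_stable:
  assumes "sum_equiv (down_sets 6 stack) {W. stable_set d E W}"
  shows False
proof (rule stable_family_no_square[OF assms])
  show "{} \<in> {W. stable_set d E W}" by (simp add: stable_set_def)
  show "X \<in> {W. stable_set d E W}" if "W \<in> {W. stable_set d E W}" "X \<subseteq> W" for W X
    using that unfolding stable_set_def by blast
  let ?A = "down_sets 6 stack"
  have unique: "C = v \<and> D = w \<or> C = w \<and> D = v"
    if v: "v \<subseteq> {0, 1}" and w: "{0, 1, 2} \<subseteq> w" and CD: "C \<in> ?A" "D \<in> ?A" "same_sum v w C D" for v w C D
  proof -
    have eq: "C \<inter> D = v" "C \<union> D = w"
      using CD(3) v w unfolding same_sum_def by blast+
    have no2: "2 \<notin> X" if "X \<subseteq> {0, 1}" for X :: "nat set" using that by auto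
    have cases: "X \<subseteq> {0, 1} \<or> {0, 1, 2} \<subseteq> X" if "X \<in> ?A" for X
      using that unfolding down_sets_stack by blast
    have "2 \<notin> v" "2 \<in> w" using no2[OF v] w by auto
    then have "2 \<in> C \<union> D" "2 \<notin> C \<inter> D" unfolding eq by simp_all
    then have "C \<subseteq> {0, 1} \<and> {0, 1, 2} \<subseteq> D \<or> D \<subseteq> {0, 1} \<and> {0, 1, 2} \<subseteq> C"
      using cases[OF CD(1)] cases[OF CD(2)] no2[of C] no2[of D] by (elim disjE) simp_all
    then show ?thesis
    proof (elim disjE conjE)
      assume "C \<subseteq> {0, 1}" "{0, 1, 2} \<subseteq> D"
      then have "C \<subseteq> D" by blast
      then show ?thesis using eq by blast
    next
      assume "D \<subseteq> {0, 1}" "{0, 1, 2} \<subseteq> C"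
      then have "D \<subseteq> C" by blast
      then show ?thesis using eq by blast
    qed
  qed
  fix v assume "v \<in> ?A"
  then consider "v \<subseteq> {0, 1}" | "{0, 1, 2} \<subseteq> v" unfolding down_sets_stack by blast
  then show "\<exists>k1\<in>?A. \<exists>k2\<in>?A. \<exists>k3\<in>?A. \<exists>k4\<in>?A. k1 \<noteq> k2 \<and> k1 \<noteq> k3 \<and> same_sum k1 k4 k2 k3 \<and>
      (\<forall>k\<in>{k1, k2, k3, k4}. k \<noteq> v \<and> (\<forall>C\<in>?A. \<forall>D\<in>?A. same_sum v k C D \<longrightarrow> C = v \<or> D = v))"
  proof cases
    case 1
    let ?k = "{0, 1, 2} :: nat set"
    have m: "?k \<in> ?A" "insert 3 ?k \<in> ?A" "insert 4 ?k \<in> ?A" "insert 3 (insert 4 ?k) \<in> ?A"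
      by (auto simp: down_sets_stack)
    have "3 \<notin> ?k" "4 \<notin> ?k" by auto
    then have n: "?k \<noteq> insert 3 ?k" "?k \<noteq> insert 4 ?k" by blast+
    have ss: "same_sum ?k (insert 3 (insert 4 ?k)) (insert 3 ?k) (insert 4 ?k)"
      by (auto simp: same_sum_def)
    have uniq: "k \<noteq> v \<and> (\<forall>C\<in>?A. \<forall>D\<in>?A. same_sum v k C D \<longrightarrow> C = v \<or> D = v)"
      if "{0, 1, 2} \<subseteq> k" for k
    proof -
      have "2 \<notin> v" using 1 by auto
      then show ?thesis using that unique[OF 1 that] by blast
    qed
    have all: "\<forall>k\<in>{?k, insert 3 ?k, insert 4 ?k, insert 3 (insert 4 ?k)}.
        k \<noteq> v \<and> (\<forall>C\<in>?A. \<forall>D\<in>?A. same_sum v k C D \<longrightarrow> C = v \<or> D = v)"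
      by (intro ballI uniq) auto
    show ?thesis
      by (rule bexI[OF _ m(1)], rule bexI[OF _ m(2)], rule bexI[OF _ m(3)], rule bexI[OF _ m(4)])
        (intro conjI n ss all)
  next
    case 2
    have m: "{} \<in> ?A" "{0} \<in> ?A" "{1} \<in> ?A" "{0, 1} \<in> ?A"
      by (auto simp: down_sets_stack)
    have n: "{} \<noteq> {0 :: nat}" "{} \<noteq> {1 :: nat}" by blast+
    have ss: "same_sum {} {0, 1} {0} {1}" by (auto simp: same_sum_def)
    have uniq: "k \<noteq> v \<and> (\<forall>C\<in>?A. \<forall>D\<in>?A. same_sum v k C D \<longrightarrow> C = v \<or> D = v)"
      if k: "k \<subseteq> {0, 1}" for k
    proof -
      have "2 \<notin> k" using k by auto
      moreover have "same_sum k v C D" if "same_sum v k C D" for C D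
        using that unfolding same_sum_def by blast
      ultimately show ?thesis using 2 unique[OF k 2] by blast
    qed
    have all: "\<forall>k\<in>{{}, {0}, {1}, {0, 1}}.
        k \<noteq> v \<and> (\<forall>C\<in>?A. \<forall>D\<in>?A. same_sum v k C D \<longrightarrow> C = v \<or> D = v)"
      by (intro ballI uniq) auto
    show ?thesis
      by (rule bexI[OF _ m(1)], rule bexI[OF _ m(2)], rule bexI[OF _ m(3)], rule bexI[OF _ m(4)])
        (intro conjI n ss all)
  qed
qed

text \<open>The cube consists of the sets between \<open>{0, 1, 2}\<close> and
  \<open>{..<6}\<close>, paired as complements over the antichain 3, 4, 5.\<close>

lemma stack_not_edge:
  assumes "sum_equiv (down_sets 6 stack) E" "simple_graph d E"
  shows False
proof (rule edge_family_no_cube[OF assms(1)])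
  show "card e = 2" if "e \<in> E" for e using assms(2) that by (simp add: simple_graph_def)
  show "distinct [{0, 1, 2}, {0, 1, 2, 3, 4, 5}, {0, 1, 2, 3}, {0, 1, 2, 4, 5 :: nat},
      {0, 1, 2, 4}, {0, 1, 2, 3, 5}, {0, 1, 2, 5}, {0, 1, 2, 3, 4}]"
    by (rule distinct_if_bits) simp
  show "set [{0, 1, 2}, {0, 1, 2, 3, 4, 5}, {0, 1, 2, 3}, {0, 1, 2, 4, 5 :: nat},
      {0, 1, 2, 4}, {0, 1, 2, 3, 5}, {0, 1, 2, 5}, {0, 1, 2, 3, 4}] \<subseteq> down_sets 6 stack"
    by (simp add: down_sets_stack)
qed (auto simp: same_sum_def)

section \<open>Separation of the stable set polytope of the 3-sun\<close>

lemma simple_graph_sun: "simple_graph 6 sun"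
  by (simp add: simple_graph_def sun_def card_insert_if)

lemma sun_not_edge:
  assumes "sum_equiv {W. stable_set 6 sun W} E" "simple_graph d E"
  shows False
proof (rule edge_family_no_cube[OF assms(1)])
  show "card e = 2" if "e \<in> E" for e using assms(2) that by (simp add: simple_graph_def)
  show "distinct [{}, {3, 4, 5}, {3}, {4, 5 :: nat}, {4}, {3, 5}, {5}, {3, 4}]"
    by (rule distinct_if_bits) simp
  have "stable_set 6 sun W" if W: "W \<subseteq> {3, 4, 5}" for W
  proof -
    have no: "{u, v} \<notin> sun" if "u \<in> {3, 4, 5}" "v \<in> {3, 4, 5}" for u v
      using that by (auto simp: sun_def doubleton_eq_iff)
    have "{3, 4, 5} \<subseteq> {..<6 :: nat}" by simp
    then have "W \<subseteq> {..<6}" using W by (rule subset_trans[rotated])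
    then show ?thesis
      unfolding stable_set_def by (intro conjI ballI no subsetD[OF W])
  qed
  then show "set [{}, {3, 4, 5}, {3}, {4, 5 :: nat}, {4}, {3, 5}, {5}, {3, 4}] \<subseteq> {W. stable_set 6 sun W}"
    by simp
qed (auto simp: same_sum_def)

lemma same_sum_empty_singletonD:
  assumes "same_sum {} {v} C D"
  shows "C = {} \<or> C = {v}"
proof -
  have "C \<subseteq> {v}" using assms unfolding same_sum_def by blast
  then show ?thesis by (rule subset_singletonD)
qed

text \<open>Comparabilities come from unique sums: \<open>{}\<close> with a singleton, two adjacent
  singletons, and \<open>{p, z}\<close> with \<open>{u, q}\<close>, since a split of the four path
  vertices into two stable sets is a 2-colouring of a connected path.\<close>

lemma induced_path_not_same_side:
  assumes \<phi>: "bij_betw \<phi> {W. stable_set d E W} \<D>" and s: "\<And>A B C D. stable_set d E A \<Longrightarrow> stable_set d E B \<Longrightarrow>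
      stable_set d E C \<Longrightarrow> stable_set d E D \<Longrightarrow> same_sum A B C D \<longleftrightarrow> same_sum (\<phi> A) (\<phi> B) (\<phi> C) (\<phi> D)"
    and \<D>: "\<And>X Y. X \<in> \<D> \<Longrightarrow> Y \<in> \<D> \<Longrightarrow> X \<inter> Y \<in> \<D> \<and> X \<union> Y \<in> \<D>"
    and path: "{u, p} \<in> E" "{p, q} \<in> E" "{q, z} \<in> E" "distinct [u, p, q, z]"
    and stable: "stable_set d E {p, z}" "stable_set d E {u, q}" "stable_set d E {u, z}"
  shows "\<not> (\<phi> {} \<subseteq> \<phi> {p} \<and> \<phi> {} \<subseteq> \<phi> {q} \<or> \<phi> {p} \<subseteq> \<phi> {} \<and> \<phi> {q} \<subseteq> \<phi> {})"
proof
  assume side: "\<phi> {} \<subseteq> \<phi> {p} \<and> \<phi> {} \<subseteq> \<phi> {q} \<or> \<phi> {p} \<subseteq> \<phi> {} \<and> \<phi> {q} \<subseteq> \<phi> {}"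
  have mono: "stable_set d E X" if "stable_set d E W" "X \<subseteq> W" for X W
    using that unfolding stable_set_def by blast
  have st: "stable_set d E {}" "stable_set d E {p}" "stable_set d E {q}" "stable_set d E {u}" "stable_set d E {z}"
    using mono[OF stable(1)] mono[OF stable(2)] by auto
  have cmp: "\<phi> A \<subseteq> \<phi> B \<or> \<phi> B \<subseteq> \<phi> A"
    if A: "stable_set d E A" and B: "stable_set d E B"
      and u: "\<And>C D. stable_set d E C \<Longrightarrow> stable_set d E D \<Longrightarrow> same_sum A B C D \<Longrightarrow> C = A \<or> C = B" for A B
  proof (rule unique_sum_comparable[OF \<phi> _ \<D>])
    show "A \<in> {W. stable_set d E W}" "B \<in> {W. stable_set d E W}" using A B by simp_all
    show "C = A \<or> C = B" if "C \<in> {W. stable_set d E W}" "D \<in> {W. stable_set d E W}" "same_sum A B C D" for C D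
      using that by (intro u) simp_all
    show "same_sum A B C D \<longleftrightarrow> same_sum (\<phi> A) (\<phi> B) (\<phi> C) (\<phi> D)"
      if "A \<in> {W. stable_set d E W}" "B \<in> {W. stable_set d E W}" "C \<in> {W. stable_set d E W}" "D \<in> {W. stable_set d E W}" for A B C D
      using that by (intro s) simp_all
  qed
  have inj: "\<phi> A \<noteq> \<phi> B" if "stable_set d E A" "stable_set d E B" "A \<noteq> B" for A B
    using \<phi> that unfolding bij_betw_def by (auto dest: inj_onD)
  have c0: "\<phi> {} \<subseteq> \<phi> {v} \<or> \<phi> {v} \<subseteq> \<phi> {}" if "stable_set d E {v}" for v
    by (rule cmp[OF st(1) that]) (erule same_sum_empty_singletonD)
  have ce: "\<phi> {v} \<subseteq> \<phi> {w} \<or> \<phi> {w} \<subseteq> \<phi> {v}"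
    if vw: "stable_set d E {v}" "stable_set d E {w}" "{v, w} \<in> E" "v \<noteq> w" for v w
  proof (rule cmp)
    fix C D assume CD: "stable_set d E C" "stable_set d E D" "same_sum {v} {w} C D"
    then have un: "C \<union> D = {v, w}" "C \<inter> D = {}" using vw(4) by (auto simp: same_sum_def)
    have no: "\<not> (v \<in> C \<and> w \<in> C)" "\<not> (v \<in> D \<and> w \<in> D)"
      using CD vw(3) unfolding stable_set_def by blast+
    have sub: "C \<subseteq> {v, w}" using un(1) by blast
    show "C = {v} \<or> C = {w}"
    proof (cases "v \<in> C")
      case True
      then have "C \<subseteq> {v}" using no(1) sub by blast
      then show ?thesis using True by blast
    next
      case False
      then have "v \<in> D" using un(1) by blast
      then have "w \<in> C" using no(2) un(1) by blast
      moreover have "C \<subseteq> {w}" using False sub by blast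
      ultimately show ?thesis by blast
    qed
  qed (use vw in auto)
  have cp: "\<phi> {p, z} \<subseteq> \<phi> {u, q} \<or> \<phi> {u, q} \<subseteq> \<phi> {p, z}"
  proof (rule cmp[OF stable(1,2)])
    fix C D assume CD: "stable_set d E C" "stable_set d E D" "same_sum {p, z} {u, q} C D"
    then have un: "C \<union> D = {p, z, u, q}" "C \<inter> D = {}"
      using path(4) by (auto simp: same_sum_def)
    have no: "\<not> (u \<in> X \<and> p \<in> X)" "\<not> (p \<in> X \<and> q \<in> X)" "\<not> (q \<in> X \<and> z \<in> X)" if "stable_set d E X" for X
      using that path(1-3) unfolding stable_set_def by blast+
    show "C = {p, z} \<or> C = {u, q}"
    proof (cases "p \<in> C")
      case True
      then have "u \<notin> C" "q \<notin> C" using no[OF CD(1)] by blast+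
      moreover from this have "q \<in> D" using un by blast
      then have "z \<in> C" using no(3)[OF CD(2)] un by blast
      moreover have "C \<subseteq> {p, z, u, q}" using un(1) by blast
      ultimately have "C \<subseteq> {p, z}" "{p, z} \<subseteq> C" using True by blast+
      then show ?thesis by (intro disjI1 subset_antisym)
    next
      case False
      then have "p \<in> D" using un by blast
      then have "u \<in> C" "q \<in> C" using no[OF CD(2)] un by blast+
      moreover from this have "z \<notin> C" using no(3)[OF CD(1)] by blast
      moreover have "C \<subseteq> {p, z, u, q}" using un(1) by blast
      ultimately have "C \<subseteq> {u, q}" "{u, q} \<subseteq> C" using False by blast+
      then show ?thesis by (intro disjI2 subset_antisym)
    qed
  qed
  have sq: "\<phi> {} \<inter> \<phi> {v, w} = \<phi> {v} \<inter> \<phi> {w}" "\<phi> {} \<union> \<phi> {v, w} = \<phi> {v} \<union> \<phi> {w}"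
    if "stable_set d E {v, w}" "v \<noteq> w" for v w
  proof -
    have "same_sum {} {v, w} {v} {w}" using that(2) by (auto simp: same_sum_def)
    then have "same_sum (\<phi> {}) (\<phi> {v, w}) (\<phi> {v}) (\<phi> {w})"
      using s[OF st(1) that(1) mono[OF that(1)] mono[OF that(1)], of "{v}" "{w}"] by simp
    then show "\<phi> {} \<inter> \<phi> {v, w} = \<phi> {v} \<inter> \<phi> {w}" "\<phi> {} \<union> \<phi> {v, w} = \<phi> {v} \<union> \<phi> {w}"
      by (simp_all add: same_sum_def)
  qed
  have d: "u \<noteq> p" "p \<noteq> q" "q \<noteq> z" "u \<noteq> q" "u \<noteq> z" "p \<noteq> z" using path(4) by auto
  have pu: "{p, u} \<in> E" using path(1) by (simp add: insert_commute)
  show False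
  proof (rule path_same_side[OF inj[OF st(2,1)] inj[OF st(3,1)] inj[OF st(4,1)] inj[OF st(5,1)]
        inj[OF stable(1) st(3)] inj[OF stable(2) st(2)] c0[OF st(4)] c0[OF st(5)]
        ce[OF st(2,4) pu d(1)[symmetric]] ce[OF st(3,5) path(3) d(3)] ce[OF st(2,3) path(2) d(2)] cp
        sq[OF stable(1) d(6)] sq[OF stable(2) d(4)] sq[OF stable(3) d(5)] side])
    show "{p, z} \<noteq> {q}" "{u, q} \<noteq> {p}" using d by blast+
  qed simp_all
qed

lemma down_sets_lattice:
  "X \<in> down_sets d r \<Longrightarrow> Y \<in> down_sets d r \<Longrightarrow> X \<inter> Y \<in> down_sets d r \<and> X \<union> Y \<in> down_sets d r"
  unfolding down_sets_def by blast

text \<open>The images of the three inner singletons are comparable to that of \<open>{}\<close>, so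
  two lie on the same side of it; but every inner edge is the middle of an induced path.\<close>

lemma sun_not_order:
  assumes "sum_equiv {W. stable_set 6 sun W} (down_sets d r)"
  shows False
proof -
  obtain \<phi> where \<phi>: "bij_betw \<phi> {W. stable_set 6 sun W} (down_sets d r)"
    and s: "\<And>A B C D. stable_set 6 sun A \<Longrightarrow> stable_set 6 sun B \<Longrightarrow> stable_set 6 sun C \<Longrightarrow> stable_set 6 sun D \<Longrightarrow>
      same_sum A B C D \<longleftrightarrow> same_sum (\<phi> A) (\<phi> B) (\<phi> C) (\<phi> D)"
    using assms unfolding sum_equiv_def by auto
  have st: "stable_set 6 sun {0, 5}" "stable_set 6 sun {1, 3}" "stable_set 6 sun {2, 4}"
    "stable_set 6 sun {3, 5}" "stable_set 6 sun {3, 4}" "stable_set 6 sun {4, 5}"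
    by (auto simp: stable_set_def sun_def doubleton_eq_iff)
  note np = induced_path_not_same_side[OF \<phi> s down_sets_lattice]
  have 1: "\<not> (\<phi> {} \<subseteq> \<phi> {0} \<and> \<phi> {} \<subseteq> \<phi> {1} \<or> \<phi> {0} \<subseteq> \<phi> {} \<and> \<phi> {1} \<subseteq> \<phi> {})"
    by (rule np[of 3 0 1 5]) (use st in \<open>auto simp: sun_def doubleton_eq_iff insert_commute\<close>)
  have 2: "\<not> (\<phi> {} \<subseteq> \<phi> {1} \<and> \<phi> {} \<subseteq> \<phi> {2} \<or> \<phi> {1} \<subseteq> \<phi> {} \<and> \<phi> {2} \<subseteq> \<phi> {})"
    by (rule np[of 4 1 2 3]) (use st in \<open>auto simp: sun_def doubleton_eq_iff insert_commute\<close>)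
  have 3: "\<not> (\<phi> {} \<subseteq> \<phi> {0} \<and> \<phi> {} \<subseteq> \<phi> {2} \<or> \<phi> {0} \<subseteq> \<phi> {} \<and> \<phi> {2} \<subseteq> \<phi> {})"
    by (rule np[of 4 0 2 5]) (use st in \<open>auto simp: sun_def doubleton_eq_iff insert_commute\<close>)
  have "\<phi> {} \<subseteq> \<phi> {v} \<or> \<phi> {v} \<subseteq> \<phi> {}" if "v < 6" for v
  proof (rule unique_sum_comparable[OF \<phi> _ down_sets_lattice])
    show "{} \<in> {W. stable_set 6 sun W}" "{v} \<in> {W. stable_set 6 sun W}"
      using that by (auto simp: stable_set_def sun_def)
    show "C = {} \<or> C = {v}" if "same_sum {} {v} C D" for C D
      by (rule same_sum_empty_singletonD[OF that])
    show "same_sum A B C D \<longleftrightarrow> same_sum (\<phi> A) (\<phi> B) (\<phi> C) (\<phi> D)"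
      if "A \<in> {W. stable_set 6 sun W}" "B \<in> {W. stable_set 6 sun W}" "C \<in> {W. stable_set 6 sun W}" "D \<in> {W. stable_set 6 sun W}" for A B C D
      using that by (intro s) simp_all
  qed
  from this[of 0] this[of 1] this[of 2] 1 2 3 show False by auto
qed

section \<open>Separation of the edge polytope of the octahedron\<close>

lemma octahedron_iff: "i < 6 \<Longrightarrow> j < 6 \<Longrightarrow> {i, j} \<in> octahedron \<longleftrightarrow> i div 2 \<noteq> j div 2"
  unfolding octahedron_def by (auto simp: doubleton_eq_iff)

lemma octahedronE:
  assumes "e \<in> octahedron"
  obtains i j where "e = {i, j}" "i < 6" "j < 6" "i div 2 \<noteq> j div 2" "i \<noteq> j"
  using assms unfolding octahedron_def by auto

lemma simple_graph_octahedron: "simple_graph 6 octahedron"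
  unfolding simple_graph_def
proof
  fix e assume "e \<in> octahedron"
  then show "e \<subseteq> {..<6} \<and> card e = 2"
    by (elim octahedronE) simp
qed

text \<open>The common vertex \<open>a\<close> has multiplicity two in the sum, so both edges
  contain it and their other ends are \<open>x\<close> and \<open>y\<close>.\<close>

lemma unique_sum_adjacent:
  assumes CD: "card C = 2" "card D = 2" "same_sum {a, x} {a, y} C D" and d: "a \<noteq> x" "a \<noteq> y" "x \<noteq> (y :: nat)"
  shows "C = {a, x} \<and> D = {a, y} \<or> C = {a, y} \<and> D = {a, x}"
proof -
  have un: "C \<inter> D = {a}" "C \<union> D = {a, x, y}"
    using CD(3) d unfolding same_sum_def by auto
  have "\<exists>c. X = {a, c} \<and> c \<noteq> a" if "card X = 2" "a \<in> X" for X
    using that unfolding card_2_iff by auto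
  moreover have "a \<in> C" "a \<in> D" using un(1) by blast+
  ultimately obtain c c' where c: "C = {a, c}" "c \<noteq> a" "D = {a, c'}" "c' \<noteq> a"
    using CD(1,2) by meson
  have "c \<in> {a, x, y}" "c' \<in> {a, x, y}" using un(2) c by blast+
  then have cc: "c = x \<or> c = y" "c' = x \<or> c' = y" using c by blast+
  have "c \<noteq> c'" 
  proof
    assume "c = c'"
    then have "c \<in> {a}" using un(1) c by blast
    then show False using c by simp
  qed
  then show ?thesis using cc c by blast
qed

lemma octahedron_card: "e \<in> octahedron \<Longrightarrow> card e = 2"
  using simple_graph_octahedron by (simp add: simple_graph_def)

lemma third_part: "a < 3 \<Longrightarrow> b < 3 \<Longrightarrow> a \<noteq> b \<Longrightarrow> 3 - a - b < 3 \<and> 3 - a - b \<noteq> a \<and> 3 - a - b \<noteq> (b :: nat)"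
  by presburger

text \<open>The two vertices of the third part are joined to both ends of \<open>v\<close>. Each of
  these four edges shares just one vertex with \<open>v\<close>, so its sum with \<open>v\<close> is
  unique, and together they form a 4-cycle, whose opposite pairs have equal sums.\<close>

lemma octahedron_not_stable:
  assumes "sum_equiv octahedron {W. stable_set d E W}"
  shows False
proof (rule stable_family_no_square[OF assms])
  show "{} \<in> {W. stable_set d E W}" by (simp add: stable_set_def)
  show "X \<in> {W. stable_set d E W}" if "W \<in> {W. stable_set d E W}" "X \<subseteq> W" for W X
    using that unfolding stable_set_def by blast
  fix v assume "v \<in> octahedron"
  then obtain i j where ij: "v = {i, j}" "i < 6" "j < 6" "i div 2 \<noteq> j div 2" "i \<noteq> j"
    by (rule octahedronE)
  \<comment> \<open>The part not met by \<open>v\<close>, as the part numbers 0, 1, 2 add up to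
    3.\<close>
  define p where "p = 3 - i div 2 - j div 2"
  have "i div 2 < 3" "j div 2 < 3" using ij by auto
  then have p: "p < 3" "p \<noteq> i div 2" "p \<noteq> j div 2"
    using third_part[of "i div 2" "j div 2"] ij(4) by (simp_all add: p_def)
  define c c' where "c = 2 * p" and "c' = 2 * p + 1"
  have c: "c < 6" "c' < 6" "c div 2 = p" "c' div 2 = p" "c \<noteq> c'" using p(1) by (auto simp: c_def c'_def)
  have ne: "i \<noteq> c" "i \<noteq> c'" "j \<noteq> c" "j \<noteq> c'" using p(2,3) c(3,4) by metis+
  have m: "{i, c} \<in> octahedron" "{i, c'} \<in> octahedron" "{j, c} \<in> octahedron" "{j, c'} \<in> octahedron"
    unfolding octahedron_iff[OF ij(2) c(1)] octahedron_iff[OF ij(2) c(2)]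
      octahedron_iff[OF ij(3) c(1)] octahedron_iff[OF ij(3) c(2)] c(3,4)
    using p(2,3) by blast+
  have n: "{i, c} \<noteq> {i, c'}" "{i, c} \<noteq> {j, c}" unfolding doubleton_eq_iff using c(5) ne ij(5) by blast+
  have ss: "same_sum {i, c} {j, c'} {i, c'} {j, c}"
  proof -
    have "{i, c} \<inter> {j, c'} = {}" "{i, c'} \<inter> {j, c} = {}"
      using ne c(5) ij(5) by blast+
    moreover have "{i, c} \<union> {j, c'} = {i, c'} \<union> {j, c}" by blast
    ultimately show ?thesis unfolding same_sum_def by (intro conjI) (simp only:)+
  qed
  have u: "k \<noteq> v \<and> (\<forall>C\<in>octahedron. \<forall>D\<in>octahedron. same_sum v k C D \<longrightarrow> C = v \<or> D = v)"
    if k: "k = {a, y}" "v = {a, x}" "a \<noteq> x" "a \<noteq> y" "x \<noteq> y" for k a x y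
  proof (intro conjI ballI impI)
    show "k \<noteq> v" using k by (auto simp: doubleton_eq_iff)
    fix C D assume "C \<in> octahedron" "D \<in> octahedron" "same_sum v k C D"
    then show "C = v \<or> D = v"
      using unique_sum_adjacent[of C D a x y] octahedron_card k by blast
  qed
  have v': "v = {j, i}" using ij(1) by (simp add: insert_commute)
  have all: "\<forall>k\<in>{{i, c}, {i, c'}, {j, c}, {j, c'}}. k \<noteq> v \<and>
      (\<forall>C\<in>octahedron. \<forall>D\<in>octahedron. same_sum v k C D \<longrightarrow> C = v \<or> D = v)"
    unfolding ball_simps(5,7)
    by (rule conjI[OF u[OF refl ij(1,5) ne(1,3)] conjI[OF u[OF refl ij(1,5) ne(2,4)]
      conjI[OF u[OF refl v' ij(5)[symmetric] ne(3,1)] conjI[OF u[OF refl v' ij(5)[symmetric] ne(4,2)] TrueI]]]])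
  show "\<exists>k1\<in>octahedron. \<exists>k2\<in>octahedron. \<exists>k3\<in>octahedron. \<exists>k4\<in>octahedron.
      k1 \<noteq> k2 \<and> k1 \<noteq> k3 \<and> same_sum k1 k4 k2 k3 \<and>
      (\<forall>k\<in>{k1, k2, k3, k4}. k \<noteq> v \<and> (\<forall>C\<in>octahedron. \<forall>D\<in>octahedron. same_sum v k C D \<longrightarrow> C = v \<or> D = v))"
    by (rule bexI[OF _ m(1)], rule bexI[OF _ m(2)], rule bexI[OF _ m(3)], rule bexI[OF _ m(4)])
      (intro conjI n ss all)
qed

text \<open>For the octahedron, twice the indicator of a filter containing the image of an edge is the sum
  of two integral potentials \<open>Z\<close> of the end points. Comparability of adjacent edges makes the six
  potentials a chain, while every coordinate only separates at most two potentials from the top or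
  from the bottom.\<close>

lemma octahedron_not_order:
  assumes "sum_equiv octahedron (down_sets d r)"
  shows False
proof -
  obtain \<phi> where \<phi>: "bij_betw \<phi> octahedron (down_sets d r)"
    and s: "\<And>A B C D. A \<in> octahedron \<Longrightarrow> B \<in> octahedron \<Longrightarrow> C \<in> octahedron \<Longrightarrow> D \<in> octahedron \<Longrightarrow>
      same_sum A B C D \<longleftrightarrow> same_sum (\<phi> A) (\<phi> B) (\<phi> C) (\<phi> D)"
    using assms unfolding sum_equiv_def by blast
  define y :: "nat \<Rightarrow> nat \<Rightarrow> nat \<Rightarrow> int" where "y i v w = (if i \<in> \<phi> {v, w} then 1 else 0)" for i v w
  have y_sym: "y i v w = y i w v" for i v w by (simp add: y_def insert_commute)
  have rel: "y i v w + y i k l = y i v k + y i w l"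
    if "v < 6" "w < 6" "k < 6" "l < 6" "v div 2 \<noteq> w div 2" "k div 2 \<noteq> l div 2" "v div 2 \<noteq> k div 2" "w div 2 \<noteq> l div 2"
    for i v w k l
  proof -
    have ne: "v \<noteq> w" "k \<noteq> l" "v \<noteq> k" "w \<noteq> l" using that by auto
    have "same_sum {v, w} {k, l} {v, k} {w, l}"
      using ne unfolding same_sum_def by auto
    then have "same_sum (\<phi> {v, w}) (\<phi> {k, l}) (\<phi> {v, k}) (\<phi> {w, l})"
      using that by (subst s[symmetric]) (simp_all add: octahedron_iff)
    then have "(i \<in> \<phi> {v, w} \<and> i \<in> \<phi> {k, l} \<longleftrightarrow> i \<in> \<phi> {v, k} \<and> i \<in> \<phi> {w, l})
        \<and> (i \<in> \<phi> {v, w} \<or> i \<in> \<phi> {k, l} \<longleftrightarrow> i \<in> \<phi> {v, k} \<or> i \<in> \<phi> {w, l})"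
      unfolding same_sum_def by blast
    then show ?thesis
      unfolding y_def by (cases "i \<in> \<phi> {v, w}"; cases "i \<in> \<phi> {k, l}"; cases "i \<in> \<phi> {v, k}"; cases "i \<in> \<phi> {w, l}") simp_all
  qed
  \<comment> \<open>On a triangle \<open>v\<close>, \<open>k\<close>, \<open>l\<close> the condition
    that twice each edge value is the sum of the potentials at its ends has this solution at
    \<open>v\<close>; here \<open>k\<close> and \<open>l\<close> are the even vertices of the other
    two parts.\<close>
  define Z where "Z i v = (let k = 2 * ((v div 2 + 1) mod 3); l = 2 * ((v div 2 + 2) mod 3)
    in y i v k + y i v l - y i k l)" for i v
  have Z: "2 * y i v w = Z i v + Z i w" if vw: "v < 6" "w < 6" "v div 2 \<noteq> w div 2" for i v w
  proof -
    \<comment> \<open>The two other parts may be taken in either order. One of them is now the part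
      of \<open>w\<close>; the number of the third is 3 minus the other two.\<close>
    have "Z i v = y i v (2 * (w div 2)) + y i v (2 * (3 - v div 2 - w div 2)) - y i (2 * (w div 2)) (2 * (3 - v div 2 - w div 2))"
      if "v < 6" "w < 6" "v div 2 \<noteq> w div 2" for v w
    proof -
      have "v div 2 = 0 \<or> v div 2 = 1 \<or> v div 2 = 2" "w div 2 = 0 \<or> w div 2 = 1 \<or> w div 2 = 2"
        using that(1,2) by presburger+
      then show ?thesis
        using that(3) unfolding Z_def Let_def
        by (elim disjE) (simp_all add: y_sym[of i 2 0] y_sym[of i 4 0] y_sym[of i 4 2])
    qed
    note zz = this
    define t v0 w0 where "t = 2 * (3 - v div 2 - w div 2)" and "v0 = 2 * (v div 2)" and "w0 = 2 * (w div 2)"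
    have t: "t < 6" "v0 < 6" "w0 < 6" "t div 2 \<noteq> v div 2" "t div 2 \<noteq> w div 2" "v0 div 2 = v div 2" "w0 div 2 = w div 2"
      using vw third_part[of "v div 2" "w div 2"] by (simp_all add: t_def v0_def w0_def)
    have "Z i v = y i v w0 + y i v t - y i w0 t"
      using zz[OF vw] by (simp add: t_def w0_def)
    moreover have "Z i w = y i w v0 + y i w t - y i v0 t"
    proof -
      have "2 * (3 - w div 2 - v div 2) = t" by (simp add: t_def add.commute)
      then show ?thesis using zz[OF vw(2,1) vw(3)[symmetric]] by (simp only: v0_def)
    qed
    moreover have "y i v w + y i w0 t = y i v w0 + y i w t"
      using rel[of v w w0 t i] vw t by simp
    moreover have "y i w v + y i v0 t = y i w v0 + y i v t"
      using rel[of w v v0 t i] vw t by simp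
    ultimately show ?thesis using y_sym[of i w v] by linarith
  qed
  have common: "\<exists>k<6. k div 2 \<noteq> v div 2 \<and> k div 2 \<noteq> w div 2" if "v < 6" "w < 6" for v w :: nat
  proof -
    have "0 \<noteq> v div 2 \<and> 0 \<noteq> w div 2 \<or> 1 \<noteq> v div 2 \<and> 1 \<noteq> w div 2 \<or> 2 \<noteq> v div 2 \<and> 2 \<noteq> w div 2"
      by linarith
    then show ?thesis
      by (elim disjE) (rule exI[of _ 0], simp, rule exI[of _ 2], simp, rule exI[of _ 4], simp)
  qed
  \<comment> \<open>A common neighbour \<open>k\<close> turns the difference of two potentials into
    twice the difference of the edges \<open>{k, v}\<close> and \<open>{k, w}\<close>, whose images
    are comparable and distinct.\<close>
  have chain: "(\<forall>i. Z i v \<le> Z i w) \<or> (\<forall>i. Z i w \<le> Z i v)" and sep: "\<exists>i<d. Z i v \<noteq> Z i w"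
    if vw: "v < 6" "w < 6" "v \<noteq> w" for v w
  proof -
    obtain k where k: "k < 6" "k div 2 \<noteq> v div 2" "k div 2 \<noteq> w div 2" using common[OF vw(1,2)] by blast
    have kv: "k \<noteq> v" "k \<noteq> w" using k by auto
    have m: "{k, v} \<in> octahedron" "{k, w} \<in> octahedron" using k vw by (simp_all add: octahedron_iff)
    have Zd: "Z i v - Z i w = 2 * (y i k v - y i k w)" for i
      using Z[OF k(1) vw(1) k(2), of i] Z[OF k(1) vw(2) k(3), of i] by (simp add: right_diff_distrib)
    have "\<phi> {k, v} \<subseteq> \<phi> {k, w} \<or> \<phi> {k, w} \<subseteq> \<phi> {k, v}"
    proof (rule unique_sum_comparable[OF \<phi> s down_sets_lattice m])
      fix C D assume "C \<in> octahedron" "D \<in> octahedron" "same_sum {k, v} {k, w} C D"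
      then show "C = {k, v} \<or> C = {k, w}"
        using unique_sum_adjacent[of C D k v w] octahedron_card kv vw(3) by blast
    qed
    then show "(\<forall>i. Z i v \<le> Z i w) \<or> (\<forall>i. Z i w \<le> Z i v)"
    proof
      assume "\<phi> {k, v} \<subseteq> \<phi> {k, w}"
      then have "y i k v \<le> y i k w" for i by (auto simp: y_def)
      then have "Z i v \<le> Z i w" for i using Zd[of i] by (smt (verit))
      then show ?thesis by blast
    next
      assume "\<phi> {k, w} \<subseteq> \<phi> {k, v}"
      then have "y i k w \<le> y i k v" for i by (auto simp: y_def)
      then have "Z i w \<le> Z i v" for i using Zd[of i] by (smt (verit))
      then show ?thesis by blast
    qed
    have "{k, v} \<noteq> {k, w}" using vw(3) by (auto simp: doubleton_eq_iff)
    then have "\<phi> {k, v} \<noteq> \<phi> {k, w}"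
      using \<phi> m unfolding bij_betw_def by (auto dest: inj_onD)
    then obtain i where i: "i \<in> \<phi> {k, v} \<longleftrightarrow> i \<notin> \<phi> {k, w}" by blast
    have "\<phi> {k, v} \<subseteq> {..<d}" "\<phi> {k, w} \<subseteq> {..<d}"
      using bij_betwE[OF \<phi>] m by (auto simp: down_sets_def)
    then have "i < d" using i by blast
    moreover have "y i k v \<noteq> y i k w" using i by (auto simp: y_def)
    then have "Z i v \<noteq> Z i w" using Zd[of i] by auto
    ultimately show "\<exists>i<d. Z i v \<noteq> Z i w" by blast
  qed
  \<comment> \<open>Comparable families of potentials are ordered by their sums, which allows the
    chain to be sorted.\<close>
  define \<rho> where "\<rho> v = (\<Sum>i<d. Z i v)" for v
  have mono: "Z i v \<le> Z i w" if h: "v < 6" "w < 6" "\<rho> v \<le> \<rho> w" "i < d" for i v w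
  proof (cases "v = w")
    case False
    show ?thesis
    proof (cases "\<forall>i. Z i v \<le> Z i w")
      case not: False
      then have le: "\<forall>i. Z i w \<le> Z i v" using chain[OF h(1,2) False] by blast
      obtain i0 where i0: "i0 < d" "Z i0 v \<noteq> Z i0 w" using sep[OF h(1,2) False] by blast
      have "(\<Sum>i<d. Z i w) < (\<Sum>i<d. Z i v)"
      proof (rule sum_strict_mono_ex1)
        show "\<exists>i\<in>{..<d}. Z i w < Z i v" using i0 le by (intro bexI[of _ i0]) (auto simp: order_less_le)
      qed (use le in auto)
      then show ?thesis using h(3) by (simp add: \<rho>_def)
    qed simp
  qed simp
  define xs where "xs = sort_key \<rho> [0..<6]"
  have xs: "length xs = 6" "distinct xs" "set xs = {0..<6}" "sorted (map \<rho> xs)"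
    by (simp_all add: xs_def)
  obtain a b c a' b' c' where abc: "xs = [a, b, c, a', b', c']"
    using xs(1) by (auto simp: length_Suc_conv numeral_eq_Suc)
  have lt: "a < 6" "b < 6" "c < 6" "a' < 6" "b' < 6" "c' < 6"
    using xs(3) unfolding abc by auto
  have le: "\<rho> a \<le> \<rho> c" "\<rho> b \<le> \<rho> c" "\<rho> c \<le> \<rho> a'" "\<rho> a' \<le> \<rho> b'" "\<rho> a' \<le> \<rho> c'"
    using xs(4) unfolding abc by auto
  have adj: "v div 2 \<noteq> w div 2 \<or> w div 2 \<noteq> u div 2" if "distinct [v, w, u]" for v w u :: nat
    using that by auto
  have y01: "0 \<le> y i v w" "y i v w \<le> 1" for i v w by (auto simp: y_def)
  \<comment> \<open>A coordinate separating the third potential from the fourth. The lower three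
    vertices contain an edge, of value at least 0, so the third is at least 0; dually the fourth is
    at most 1. Their difference is positive but even.\<close>
  obtain i where i: "i < d" "Z i c \<noteq> Z i a'"
    using sep[OF lt(3,4)] xs(2) unfolding abc by auto
  have "0 \<le> Z i c"
  proof -
    have "a div 2 \<noteq> b div 2 \<or> b div 2 \<noteq> c div 2" using adj[of a b c] xs(2) unfolding abc by simp
    then show ?thesis
      using Z[OF lt(1,2), of i] Z[OF lt(2,3), of i] y01[of i a b] y01[of i b c]
        mono[OF lt(1,3) le(1) i(1)] mono[OF lt(2,3) le(2) i(1)] by linarith
  qed
  moreover have "Z i a' \<le> 1"
  proof -
    have "a' div 2 \<noteq> b' div 2 \<or> b' div 2 \<noteq> c' div 2" using adj[of a' b' c'] xs(2) unfolding abc by simp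
    then show ?thesis
      using Z[OF lt(4,5), of i] Z[OF lt(5,6), of i] y01[of i a' b'] y01[of i b' c']
        mono[OF lt(4,5) le(4) i(1)] mono[OF lt(4,6) le(5) i(1)] by linarith
  qed
  moreover have "Z i c < Z i a'"
    using mono[OF lt(3,4) le(3) i(1)] i(2) by linarith
  moreover have "even (Z i c - Z i a')"
  proof -
    obtain k where k: "k < 6" "k div 2 \<noteq> c div 2" "k div 2 \<noteq> a' div 2" using common[OF lt(3,4)] by blast
    have "Z i c - Z i a' = 2 * (y i k c - y i k a')"
      using Z[OF k(1) lt(3) k(2), of i] Z[OF k(1) lt(4) k(3), of i] by (simp add: right_diff_distrib)
    then show ?thesis by simp
  qed
  ultimately show False by presburger
qed

text \<open>An odd cycle has at least three vertices and a part only two, so each vertex of one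
  cycle has a neighbour on the other.\<close>

lemma odd_cycle_condition_octahedron: "odd_cycle_condition octahedron"
  unfolding odd_cycle_condition_def
proof (intro allI impI)
  fix c c' :: "nat list"
  assume "graph_cycle octahedron c \<and> odd (length c) \<and> graph_cycle octahedron c' \<and> odd (length c') \<and> set c \<inter> set c' = {}"
  then have c: "graph_cycle octahedron c" "graph_cycle octahedron c'" by auto
  have in6: "set l \<subseteq> {..<6}" if l: "graph_cycle octahedron l" for l
  proof
    fix v assume "v \<in> set l"
    then obtain i where "i < length l" "v = l ! i" by (auto simp: in_set_conv_nth)
    then have "{v, l ! (Suc i mod length l)} \<in> octahedron" using l by (simp add: graph_cycle_def)
    then show "v \<in> {..<6}" using simple_graph_octahedron by (auto simp: simple_graph_def)
  qed
  have "c \<noteq> []" "3 \<le> length c'" "distinct c'" using c by (auto simp: graph_cycle_def)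
  then obtain u where u: "u \<in> set c" by (cases c) auto
  have "\<exists>v\<in>set c'. v div 2 \<noteq> u div 2"
  proof (rule ccontr)
    assume "\<not> ?thesis"
    then have "set c' \<subseteq> {2 * (u div 2), 2 * (u div 2) + 1}" by force
    then have "card (set c') \<le> card {2 * (u div 2), 2 * (u div 2) + 1}" by (intro card_mono) auto
    then show False using distinct_card[OF \<open>distinct c'\<close>] \<open>3 \<le> length c'\<close> by simp
  qed
  then obtain v where v: "v \<in> set c'" "v div 2 \<noteq> u div 2" by blast
  then have "{u, v} \<in> octahedron"
    using u in6[OF c(1)] in6[OF c(2)] by (subst octahedron_iff) auto
  then show "\<exists>u\<in>set c. \<exists>v\<in>set c'. {u, v} \<in> octahedron" using u v by blast
qed

section \<open>Perfection of graphs with a perfect elimination ordering\<close>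

lemma clique_number_ge:
  assumes "finite W" "C \<subseteq> W" "\<forall>u\<in>C. \<forall>v\<in>C. u \<noteq> v \<longrightarrow> {u, v} \<in> E"
  shows "card C \<le> clique_number E W"
proof -
  have "finite {card C | C. C \<subseteq> W \<and> (\<forall>u\<in>C. \<forall>v\<in>C. u \<noteq> v \<longrightarrow> {u, v} \<in> E)}"
    by (rule finite_subset[of _ "card ` Pow W"]) (use assms(1) in auto)
  then show ?thesis
    unfolding clique_number_def using assms(2,3) by (intro Max_ge) auto
qed

lemma clique_number_attained:
  assumes "finite W"
  obtains C where "C \<subseteq> W" "\<forall>u\<in>C. \<forall>v\<in>C. u \<noteq> v \<longrightarrow> {u, v} \<in> E" "card C = clique_number E W"
proof -
  let ?S = "{card C | C. C \<subseteq> W \<and> (\<forall>u\<in>C. \<forall>v\<in>C. u \<noteq> v \<longrightarrow> {u, v} \<in> E)}"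
  have "finite ?S"
    by (rule finite_subset[of _ "card ` Pow W"]) (use assms(1) in auto)
  moreover have "card {} \<in> ?S" by (rule CollectI, rule exI[of _ "{}"]) simp
  ultimately have "clique_number E W \<in> ?S"
    unfolding clique_number_def by (intro Max_in) auto
  then show ?thesis using that by auto
qed

text \<open>Greedy colouring in the natural order: a vertex and its earlier neighbours form a
  clique, so those neighbours block fewer colours than the clique number.\<close>

lemma chordal_imp_perfect:
  assumes E: "simple_graph d E"
    and chordal: "\<And>u v w. u < w \<Longrightarrow> v < w \<Longrightarrow> u \<noteq> v \<Longrightarrow> {u, w} \<in> E \<Longrightarrow> {v, w} \<in> E \<Longrightarrow> {u, v} \<in> E"
  shows "perfect_graph d E"
  unfolding perfect_graph_def
proof (intro conjI allI impI E)
  fix W assume "W \<subseteq> {..<d}"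
  then have fin: "finite W" using finite_subset by blast
  let ?k = "clique_number E W"
  have loop: "{u} \<notin> E" for u using E by (force simp: simple_graph_def)
  have "\<exists>f :: nat \<Rightarrow> nat. f ` (W \<inter> {..<n}) \<subseteq> {..<?k} \<and>
      (\<forall>u\<in>W \<inter> {..<n}. \<forall>v\<in>W \<inter> {..<n}. {u, v} \<in> E \<longrightarrow> f u \<noteq> f v)" for n
  proof (induction n)
    case (Suc n)
    then obtain f :: "nat \<Rightarrow> nat" where f: "f ` (W \<inter> {..<n}) \<subseteq> {..<?k}"
      "\<And>u v. u \<in> W \<inter> {..<n} \<Longrightarrow> v \<in> W \<inter> {..<n} \<Longrightarrow> {u, v} \<in> E \<Longrightarrow> f u \<noteq> f v" by blast
    show ?case
    proof (cases "n \<in> W")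
      case False
      then have "W \<inter> {..<Suc n} = W \<inter> {..<n}" by (auto simp: less_Suc_eq)
      then show ?thesis using Suc by simp
    next
      case True
      define N where "N = {u \<in> W. u < n \<and> {u, n} \<in> E}"
      have finN: "finite N" using fin by (simp add: N_def)
      have "card (insert n N) \<le> ?k"
      proof (rule clique_number_ge[OF fin])
        show "insert n N \<subseteq> W" using True by (auto simp: N_def)
        show "\<forall>u\<in>insert n N. \<forall>v\<in>insert n N. u \<noteq> v \<longrightarrow> {u, v} \<in> E"
          using chordal by (auto simp: N_def insert_commute)
      qed
      moreover have "n \<notin> N" by (simp add: N_def)
      ultimately have "card (f ` N) < ?k"
        using card_image_le[OF finN, of f] finN by simp
      then have "\<not> {..<?k} \<subseteq> f ` N"
        using card_mono[of "f ` N" "{..<?k}"] finN by auto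
      then obtain col where col: "col < ?k" "col \<notin> f ` N" by blast
      let ?f = "f(n := col)"
      have "?f ` (W \<inter> {..<Suc n}) \<subseteq> {..<?k}"
        using f(1) col(1) by (auto simp: less_Suc_eq image_subset_iff)
      moreover have "?f u \<noteq> ?f v" if "u \<in> W \<inter> {..<Suc n}" "v \<in> W \<inter> {..<Suc n}" "{u, v} \<in> E" for u v
      proof -
        have "u \<noteq> v" using that loop[of u] by auto
        then have "u = n \<and> v < n \<or> v = n \<and> u < n \<or> u < n \<and> v < n"
          using that(1,2) by auto
        then consider "u = n" "v < n" | "v = n" "u < n" | "u < n" "v < n" by blast
        then show ?thesis
        proof cases
          case 1
          then have "v \<in> N" using that by (auto simp: N_def insert_commute)
          then show ?thesis using 1 col(2) by auto
        next
          case 2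
          then have "u \<in> N" using that by (auto simp: N_def)
          then show ?thesis using 2 col(2) by auto
        next
          case 3
          then show ?thesis using f(2)[of u v] that by auto
        qed
      qed
      ultimately show ?thesis by blast
    qed
  qed auto
  from this[of d] have col: "\<exists>f :: nat \<Rightarrow> nat. f ` W \<subseteq> {..<?k} \<and> (\<forall>u\<in>W. \<forall>v\<in>W. {u, v} \<in> E \<longrightarrow> f u \<noteq> f v)"
    using \<open>W \<subseteq> {..<d}\<close> by (simp add: Int_absorb2)
  show "chromatic_number E W = ?k"
    unfolding chromatic_number_def
  proof (rule Least_equality)
    show "\<exists>f :: nat \<Rightarrow> nat. f ` W \<subseteq> {..<?k} \<and> (\<forall>u\<in>W. \<forall>v\<in>W. {u, v} \<in> E \<longrightarrow> f u \<noteq> f v)" by (rule col)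
    fix k assume "\<exists>f :: nat \<Rightarrow> nat. f ` W \<subseteq> {..<k} \<and> (\<forall>u\<in>W. \<forall>v\<in>W. {u, v} \<in> E \<longrightarrow> f u \<noteq> f v)"
    then obtain f :: "nat \<Rightarrow> nat" where f: "f ` W \<subseteq> {..<k}" "\<forall>u\<in>W. \<forall>v\<in>W. {u, v} \<in> E \<longrightarrow> f u \<noteq> f v" by blast
    obtain C where C: "C \<subseteq> W" "\<forall>u\<in>C. \<forall>v\<in>C. u \<noteq> v \<longrightarrow> {u, v} \<in> E" "card C = ?k"
      using clique_number_attained[OF fin] by blast
    have "inj_on f C" using C f(2) by (intro inj_onI) (metis subsetD)
    then have "card C \<le> card {..<k}"
      using C(1) f(1) by (intro card_inj_on_le) auto
    then show "?k \<le> k" using C(3) by simp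
  qed
qed

lemma sun_iff:
  assumes "u < w"
  shows "{u, w} \<in> sun \<longleftrightarrow> w = 1 \<and> u = 0 \<or> w = 2 \<and> (u = 0 \<or> u = 1) \<or> w = 3 \<and> (u = 0 \<or> u = 2)
    \<or> w = 4 \<and> (u = 0 \<or> u = 1) \<or> w = 5 \<and> (u = 1 \<or> u = 2)"
  using assms unfolding sun_def insert_iff empty_iff doubleton_eq_iff by auto

lemma perfect_graph_sun: "perfect_graph 6 sun"
proof (rule chordal_imp_perfect[OF simple_graph_sun])
  fix u v w :: nat
  assume "u < w" "v < w" "u \<noteq> v" "{u, w} \<in> sun" "{v, w} \<in> sun"
  then have "u = 0 \<and> v = 1 \<or> u = 1 \<and> v = 0 \<or> u = 0 \<and> v = 2 \<or> u = 2 \<and> v = 0 \<or> u = 1 \<and> v = 2 \<or> u = 2 \<and> v = 1"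
    unfolding sun_iff[OF \<open>u < w\<close>] sun_iff[OF \<open>v < w\<close>] by (elim disjE conjE) simp_all
  then show "{u, v} \<in> sun"
    by (elim disjE conjE) (simp_all add: sun_def insert_commute)
qed

section \<open>Toric rings of the witnesses\<close>

definition exponent :: "nat set \<Rightarrow> (nat \<Rightarrow>\<^sub>0 int)" where
  "exponent W = (\<Sum>i\<in>W. Poly_Mapping.single i 1)"

lemma lookup_exponent: "finite W \<Longrightarrow> Poly_Mapping.lookup (exponent W) j = (if j \<in> W then 1 else 0)"
  by (simp add: exponent_def lookup_sum lookup_single when_def)

lemma lookup_map_real: "Poly_Mapping.lookup (Poly_Mapping.map real_of_int a) i = real_of_int (Poly_Mapping.lookup a i)"
  by (simp add: map.rep_eq when_def)

lemma map_real_exponent: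
  assumes "finite W"
  shows "Poly_Mapping.map real_of_int a = ind W \<longleftrightarrow> a = exponent W"
proof
  assume eq: "Poly_Mapping.map real_of_int a = ind W"
  show "a = exponent W"
  proof (rule poly_mapping_eqI)
    fix i
    have "real_of_int (Poly_Mapping.lookup a i) = (if i \<in> W then 1 else 0)"
      using arg_cong[OF eq, of "\<lambda>x. Poly_Mapping.lookup x i"] unfolding lookup_map_real lookup_ind[OF assms] .
    then show "Poly_Mapping.lookup a i = Poly_Mapping.lookup (exponent W) i"
      unfolding lookup_exponent[OF assms] by (cases "i \<in> W") simp_all
  qed
next
  assume "a = exponent W"
  then show "Poly_Mapping.map real_of_int a = ind W"
    by (intro poly_mapping_eqI) (simp add: lookup_map_real lookup_ind[OF assms] lookup_exponent[OF assms])
qed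

lemma real_space_convex_hull:
  assumes "\<And>W. W \<in> \<W> \<Longrightarrow> W \<subseteq> {..<d}"
  shows "convex hull (ind ` \<W>) \<subseteq> real_space d"
proof (rule hull_minimal)
  show "ind ` \<W> \<subseteq> real_space d"
    using ind_lattice assms unfolding lattice_def by blast
  show "convex (real_space d)"
  proof (rule convexI)
    fix x y :: vec and u v :: real
    assume "x \<in> real_space d" "y \<in> real_space d"
    then have "Poly_Mapping.lookup x i = 0" "Poly_Mapping.lookup y i = 0" if "\<not> i < d" for i
      using that by (auto simp: real_space_def in_keys_iff)
    then have "Poly_Mapping.lookup (u *\<^sub>R x + v *\<^sub>R y) i = 0" if "\<not> i < d" for i
      using that by (simp add: lookup_add lookup_scaleR)
    then show "u *\<^sub>R x + v *\<^sub>R y \<in> real_space d"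
      unfolding real_space_def by (auto simp: in_keys_iff)
  qed
qed

lemma a_inv_laurent_ring: "\<ominus>\<^bsub>laurent_ring\<^esub> h = - (h :: 'k::field laurent)"
proof -
  have "abelian_group (laurent_ring :: 'k laurent ring)"
  proof (rule abelian_groupI)
    fix x :: "'k laurent"
    show "\<exists>y\<in>carrier laurent_ring. y \<oplus>\<^bsub>laurent_ring\<^esub> x = \<zero>\<^bsub>laurent_ring\<^esub>"
      by (intro bexI[of _ "- x"]) (simp_all add: laurent_ring_def)
  qed (simp_all add: laurent_ring_def add_ac)
  then interpret abelian_group "laurent_ring :: 'k laurent ring" .
  show ?thesis
    by (rule minus_equality) (simp_all add: laurent_ring_def)
qed

text \<open>\<open>decompose\<close> is normality in a usable form: every nonzero point of the cone
  stays in it after subtraction of some generator. The degree, coordinate \<open>d\<close>, drops by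
  one each time, so the generators produce all of \<open>S\<close>.\<close>

lemma toric_ring_eq_kspan:
  fixes d :: nat
  assumes points: "lattice_points (d, P) = ind ` \<W>" "P \<subseteq> real_space d" "\<And>W. W \<in> \<W> \<Longrightarrow> W \<subseteq> {..<d}"
    and S: "0 \<in> S" "\<And>a b. a \<in> S \<Longrightarrow> b \<in> S \<Longrightarrow> a + b \<in> S"
      "\<And>W. W \<in> \<W> \<Longrightarrow> exponent W + Poly_Mapping.single d 1 \<in> S"
    and degree: "\<And>a. a \<in> S \<Longrightarrow> 0 \<le> Poly_Mapping.lookup a d"
    and decompose: "\<And>a. a \<in> S \<Longrightarrow> a \<noteq> 0 \<Longrightarrow> \<exists>W\<in>\<W>. a - (exponent W + Poly_Mapping.single d 1) \<in> S"
  shows "toric_ring TYPE('k::field) (d, P) = laurent_ring\<lparr>carrier := kspan S\<rparr>"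
proof -
  let ?L = "laurent_ring :: 'k laurent ring"
  let ?H = "range (Poly_Mapping.single 0) \<union> toric_monomials (d, P) :: 'k laurent set"
  have fin: "finite W" if "W \<in> \<W>" for W
    using points(3)[OF that] finite_subset by blast
  have mem: "Poly_Mapping.map real_of_int a \<in> P \<longleftrightarrow> (\<exists>W\<in>\<W>. a = exponent W)" for a
  proof -
    have "Poly_Mapping.map real_of_int a \<in> P \<longleftrightarrow> Poly_Mapping.map real_of_int a \<in> lattice_points (d, P)"
      using points(2) by (auto simp: lattice_points_def lattice_def lookup_map_real)
    also have "\<dots> \<longleftrightarrow> (\<exists>W\<in>\<W>. Poly_Mapping.map real_of_int a = ind W)"
      unfolding points(1) by (rule image_iff)
    also have "\<dots> \<longleftrightarrow> (\<exists>W\<in>\<W>. a = exponent W)"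
      by (intro bex_cong refl map_real_exponent fin)
    finally show ?thesis .
  qed
  have mons: "toric_monomials (d, P) = (\<lambda>W. xpow (exponent W + Poly_Mapping.single d 1) :: 'k laurent) ` \<W>"
    unfolding toric_monomials_def using mem by auto
  have "generate_ring ?L ?H = kspan S"
  proof (intro equalityI subsetI)
    fix f assume "f \<in> generate_ring ?L ?H"
    then show "f \<in> kspan S"
    proof (induction rule: generate_ring.induct)
      case one
      then show ?case using S(1) by (simp add: laurent_ring_def kspan_def)
    next
      case (incl h)
      then show ?case
        using S(1,3) unfolding mons by (auto intro: kspan_single)
    next
      case (a_inv h)
      then show ?case by (simp add: a_inv_laurent_ring kspan_uminus)
    next
      case (eng_add h1 h2)
      then show ?case by (simp add: laurent_ring_def kspan_add)
    next
      case (eng_mult h1 h2)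
      then have "h1 * h2 \<in> kspan S" using S(2) by (intro kspan_mult[of h1 S h2 S]) auto
      then show ?case by (simp add: laurent_ring_def)
    qed
  next
    fix f :: "'k laurent" assume f: "f \<in> kspan S"
    have add: "g + h \<in> generate_ring ?L ?H" if "g \<in> generate_ring ?L ?H" "h \<in> generate_ring ?L ?H" for g h
      using generate_ring.eng_add[OF that] by (simp add: laurent_ring_def)
    have mult: "g * h \<in> generate_ring ?L ?H" if "g \<in> generate_ring ?L ?H" "h \<in> generate_ring ?L ?H" for g h
      using generate_ring.eng_mult[OF that] by (simp add: laurent_ring_def)
    have const: "Poly_Mapping.single 0 c \<in> generate_ring ?L ?H" for c
      by (rule generate_ring.incl) simp
    have gen: "xpow a \<in> generate_ring ?L ?H" if "a \<in> S" for a
      using that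
    proof (induction "nat (Poly_Mapping.lookup a d)" arbitrary: a rule: less_induct)
      case less
      show ?case
      proof (cases "a = 0")
        case True
        then show ?thesis using const[of 1] by simp
      next
        case False
        then obtain W where W: "W \<in> \<W>" "a - (exponent W + Poly_Mapping.single d 1) \<in> S"
          using decompose[OF less.prems] by blast
        define b where "b = a - (exponent W + Poly_Mapping.single d 1)"
        have "d \<notin> W" using points(3)[OF W(1)] by auto
        then have "Poly_Mapping.lookup b d = Poly_Mapping.lookup a d - 1"
          by (simp add: b_def lookup_minus lookup_add lookup_exponent[OF fin[OF W(1)]])
        moreover have bS: "b \<in> S" using W(2) by (simp add: b_def)
        ultimately have "nat (Poly_Mapping.lookup b d) < nat (Poly_Mapping.lookup a d)"
          using degree[OF bS] by simp
        then have "xpow b \<in> generate_ring ?L ?H" by (rule less.hyps[OF _ bS])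
        moreover have "xpow (exponent W + Poly_Mapping.single d 1) \<in> generate_ring ?L ?H"
          using W(1) unfolding mons by (intro generate_ring.incl) blast
        ultimately have "xpow b * xpow (exponent W + Poly_Mapping.single d 1) \<in> generate_ring ?L ?H"
          by (rule mult)
        then show ?thesis by (simp add: mult_single b_def)
      qed
    qed
    have sum_mem: "sum g A \<in> generate_ring ?L ?H" if "finite A" "\<And>a. a \<in> A \<Longrightarrow> g a \<in> generate_ring ?L ?H" for g and A :: "(nat \<Rightarrow>\<^sub>0 int) set"
      using that
    proof (induction A rule: finite_induct)
      case empty
      then show ?case using const[of 0] by simp
    qed (simp add: add)
    have single_mem: "Poly_Mapping.single a c \<in> generate_ring ?L ?H" if "a \<in> S" for a c
      using mult[OF const[of c] gen[OF that]] by (simp add: mult_single)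
    have "a \<in> S" if "a \<in> Poly_Mapping.keys f" for a
      using f that unfolding kspan_def by blast
    then have "(\<Sum>a\<in>Poly_Mapping.keys f. Poly_Mapping.single a (Poly_Mapping.lookup f a)) \<in> generate_ring ?L ?H"
      by (intro sum_mem single_mem finite_keys)
    then show "f \<in> generate_ring ?L ?H"
      unfolding sum_singles[of f, symmetric] .
  qed
  then show ?thesis by (simp add: toric_ring_def)
qed

text \<open>Lists have the value 0 beyond their end, so explicit exponent vectors can be evaluated
  by the simplifier.\<close>

abbreviation lvec :: "int list \<Rightarrow> (nat \<Rightarrow>\<^sub>0 int)" where
  "lvec \<equiv> Poly_Mapping.nth"

text \<open>Coordinate 6 is the degree, that is, the exponent of the variable \<open>t\<close>.\<close>

lemma class_group_rank_3:
  fixes P :: "vec set" and T :: "((nat \<Rightarrow>\<^sub>0 int) \<Rightarrow> int) set"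
    and \<sigma> :: "nat \<Rightarrow> (nat \<Rightarrow>\<^sub>0 int) \<Rightarrow> int" and s m :: "nat \<Rightarrow> int list" and e :: "int list"
    and F I :: "nat set"
  defines "S \<equiv> {a \<in> sublattice T. \<forall>i\<in>F. 0 \<le> \<sigma> i a}"
  assumes points: "lattice_points (6, P) = ind ` \<W>" "P \<subseteq> real_space 6" "\<And>W. W \<in> \<W> \<Longrightarrow> W \<subseteq> {..<6}"
    and gens: "\<And>W. W \<in> \<W> \<Longrightarrow> exponent W + Poly_Mapping.single 6 1 \<in> S"
    and degree: "\<And>a. a \<in> S \<Longrightarrow> 0 \<le> Poly_Mapping.lookup a 6"
    and decompose: "\<And>a. a \<in> S \<Longrightarrow> a \<noteq> 0 \<Longrightarrow> \<exists>W\<in>\<W>. a - (exponent W + Poly_Mapping.single 6 1) \<in> S"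
    and T: "\<forall>\<tau>\<in>T. Modules.additive \<tau>" and \<sigma>: "\<forall>i\<in>F. Modules.additive (\<sigma> i)"
    and F: "finite F" and facet: "\<forall>i\<in>F. lvec (s i) \<in> sublattice T \<and> \<sigma> i (lvec (s i)) = 0 \<and> (\<forall>j\<in>F. j \<noteq> i \<longrightarrow> 0 < \<sigma> j (lvec (s i)))"
    and primitive: "lvec e \<in> sublattice T" "\<forall>i\<in>F. \<sigma> i (lvec e) = 1"
    and I: "I \<subseteq> F" "card (F - I) = 3"
    and dual: "\<forall>i\<in>I. lvec (m i) \<in> sublattice T \<and> (\<forall>k\<in>I. \<sigma> k (lvec (m i)) = (if k = i then 1 else 0))"
    and inj: "\<And>a. a \<in> sublattice T \<Longrightarrow> \<forall>i\<in>I. \<sigma> i a = 0 \<Longrightarrow> a = 0"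
  shows "has_rank (class_group (toric_ring TYPE('k::field) (6, P))) 3"
proof -
  have add: "a + b \<in> S" if "a \<in> S" "b \<in> S" for a b
    using that T \<sigma> sublattice_add[OF T] by (auto simp: S_def additive.add)
  have zero: "0 \<in> S"
    using sublattice_0[OF T] \<sigma> by (auto simp: S_def additive.zero)
  have R: "toric_ring TYPE('k) (6, P) = laurent_ring\<lparr>carrier := kspan S\<rparr>"
    by (rule toric_ring_eq_kspan[OF points zero add gens degree decompose])
  interpret toric_cone_basis "toric_ring TYPE('k) (6, P)" T F \<sigma> S I "\<lambda>i. lvec (m i)"
  proof unfold_locales
    show "\<exists>s\<in>sublattice T. \<sigma> i s = 0 \<and> (\<forall>j\<in>F - {i}. 0 < \<sigma> j s)" if "i \<in> F" for i
      using facet that by blast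
    show "\<exists>a\<in>sublattice T. \<sigma> i a = 1" if "i \<in> F" for i
      using primitive that by blast
    show "\<sigma> i (x + y) = \<sigma> i x + \<sigma> i y" if "i \<in> F" for i x y
      using \<sigma> that by (simp add: additive.add)
  qed (use R T F I dual inj S_def in auto)
  show ?thesis using class_group_rank I(2) by simp
qed

lemma down_sets_subset: "W \<in> down_sets d r \<Longrightarrow> W \<subseteq> {..<d}"
  by (simp add: down_sets_def)

section \<open>Class group of the order polytope of \<open>stack\<close>\<close>

definition stack_facet :: "nat \<Rightarrow> (nat \<Rightarrow>\<^sub>0 int) \<Rightarrow> int" where
  "stack_facet i a = (let x = Poly_Mapping.lookup a in
    [x 6 - x 0, x 6 - x 1, x 0 - x 2, x 1 - x 2, x 2 - x 3, x 2 - x 4, x 2 - x 5, x 3, x 4, x 5] ! i)"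

lemma stack_facet_simps:
  shows "stack_facet 0 a = coord 6 a - coord 0 a"
  and "stack_facet (Suc 0) a = coord 6 a - coord 1 a"
  and "stack_facet 2 a = coord 0 a - coord 2 a"
  and "stack_facet 3 a = coord 1 a - coord 2 a"
  and "stack_facet 4 a = coord 2 a - coord 3 a"
  and "stack_facet 5 a = coord 2 a - coord 4 a"
  and "stack_facet 6 a = coord 2 a - coord 5 a"
  and "stack_facet 7 a = coord 3 a"
  and "stack_facet 8 a = coord 4 a"
  and "stack_facet 9 a = coord 5 a"
  by (simp_all add: stack_facet_def Let_def)

lemma nth_default_Cons_numeral: "nth_default y (x # xs) (numeral k) = nth_default y xs (pred_numeral k)"
  by (simp add: numeral_eq_Suc)

lemma eq_0_if_coords: "a \<in> first_coords 7 \<Longrightarrow> (\<And>i. i < 7 \<Longrightarrow> Poly_Mapping.lookup a i = 0) \<Longrightarrow> a = 0"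
  by (rule poly_mapping_eqI) (metis first_coords_iff lookup_zero not_le)

lemma less_7: "i < (7 :: nat) \<longleftrightarrow> i = 0 \<or> i = 1 \<or> i = 2 \<or> i = 3 \<or> i = 4 \<or> i = 5 \<or> i = 6"
  by auto

lemma less_6: "i < (6 :: nat) \<longleftrightarrow> i = 0 \<or> i = 1 \<or> i = 2 \<or> i = 3 \<or> i = 4 \<or> i = 5"
  by auto

lemma lvec_first_coords: "length xs \<le> m \<Longrightarrow> lvec xs \<in> first_coords m"
  by (simp add: first_coords_iff nth_default_def)

lemma lookup_exponent_6:
  assumes "W \<subseteq> {..<6}"
  shows "Poly_Mapping.lookup (exponent W + Poly_Mapping.single 6 1) i = (if i \<in> W then 1 else if i = 6 then 1 else 0)"
proof -
  have "6 \<notin> W" using assms by auto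
  then show ?thesis
    by (simp add: lookup_add lookup_exponent[OF finite_subset[OF assms finite_lessThan]] lookup_single when_def)
qed

lemma exponent_first_coords:
  assumes "W \<subseteq> {..<6}"
  shows "exponent W + Poly_Mapping.single 6 1 \<in> first_coords 7"
  unfolding first_coords_iff
proof (intro allI impI)
  fix i :: nat assume "7 \<le> i"
  then have "i \<notin> W" "i \<noteq> 6" using assms by auto
  then show "Poly_Mapping.lookup (exponent W + Poly_Mapping.single 6 1) i = 0"
    unfolding lookup_exponent_6[OF assms] by simp
qed

lemma stack_rank: "has_rank (class_group (toric_ring TYPE('k::field) (order_polytope 6 stack))) 3"
proof -
  obtain P where P: "order_polytope 6 stack = (6, P)" by (simp add: order_polytope_def)
  \<comment> \<open>\<open>?I\<close> is a spanning tree of the Hasse diagram with both bounds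
    adjoined, namely coordinate 6 and the constant 0; the covers 3, 8, 9 outside the tree account
    for the rank.\<close>
  let ?F = "{0, 1, 2, 3, 4, 5, 6, 7, 8, 9} :: nat set" and ?I = "{0, 1, 2, 4, 5, 6, 7} :: nat set"
  let ?T = "coord ` {7..}"
  let ?S = "{a \<in> sublattice ?T. \<forall>i\<in>?F. 0 \<le> stack_facet i a}"
  \<comment> \<open>The point \<open>e\<close> below falls by one along each cover, so all its facet
    heights are one; each row changes a single coordinate of it to bring facet \<open>i\<close> to
    height zero.\<close>
  let ?s = "\<lambda>i. [[4,3,2,1,1,1,4], [3,4,2,1,1,1,4], [2,3,2,1,1,1,4], [3,2,2,1,1,1,4], [3,3,2,2,1,1,4],
    [3,3,2,1,2,1,4], [3,3,2,1,1,2,4], [3,3,2,0,1,1,4], [3,3,2,1,0,1,4], [3,3,2,1,1,0,4]] ! i :: int list"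
  \<comment> \<open>Row \<open>i\<close> is, up to sign, the indicator of one side of the cut made
    by removing edge \<open>i\<close> from the tree. Row 3 is a placeholder, as 3 is not in
    \<open>?I\<close>.\<close>
  let ?m = "\<lambda>i. [[0,1,0,0,0,0,1], [0,-1,0,0,0,0,0], [1,1,0,0,0,0,1], [], [1,1,1,0,1,1,1],
    [0,0,0,0,-1,0,0], [0,0,0,0,0,-1,0], [1,1,1,1,1,1,1]] ! i :: int list"
  have S_iff: "a \<in> ?S \<longleftrightarrow> a \<in> first_coords 7 \<and> coord 0 a \<le> coord 6 a \<and> coord 1 a \<le> coord 6 a \<and> coord 2 a \<le> coord 0 a \<and> coord 2 a \<le> coord 1 a \<and>
      coord 3 a \<le> coord 2 a \<and> coord 4 a \<le> coord 2 a \<and> coord 5 a \<le> coord 2 a \<and> 0 \<le> coord 3 a \<and> 0 \<le> coord 4 a \<and> 0 \<le> coord 5 a" for a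
    by (simp add: stack_facet_simps)
  have "has_rank (class_group (toric_ring TYPE('k) (6, P))) 3"
  proof (rule class_group_rank_3[where T = ?T and F = ?F and \<sigma> = stack_facet and I = ?I and \<W> = "down_sets 6 stack"
        and s = ?s and m = ?m and e = "[3,3,2,1,1,1,4]"])
    show "lattice_points (6, P) = ind ` down_sets 6 stack"
      using lattice_points_order_polytope[of 6 stack] P by simp
    show "P \<subseteq> real_space 6" using P by (auto simp: order_polytope_def)
    show "W \<subseteq> {..<6}" if "W \<in> down_sets 6 stack" for W using that by (rule down_sets_subset)
    show "exponent W + Poly_Mapping.single 6 1 \<in> ?S" if W: "W \<in> down_sets 6 stack" for W
    proof -
      have sub: "W \<subseteq> {..<6}" using W by (rule down_sets_subset)
      then have "6 \<notin> W" by auto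
      have "2 \<in> W \<longrightarrow> 0 \<in> W \<and> 1 \<in> W" "3 \<in> W \<or> 4 \<in> W \<or> 5 \<in> W \<longrightarrow> 2 \<in> W"
        using W unfolding down_sets_stack by auto
      then show ?thesis
        unfolding S_iff lookup_exponent_6[OF sub] using \<open>6 \<notin> W\<close> exponent_first_coords[OF sub] by simp
    qed
    show "0 \<le> Poly_Mapping.lookup a 6" if "a \<in> ?S" for a
      using that unfolding S_iff by linarith
    show "\<exists>W\<in>down_sets 6 stack. a - (exponent W + Poly_Mapping.single 6 1) \<in> ?S" if aS: "a \<in> ?S" and nz: "a \<noteq> 0" for a
    proof -
      \<comment> \<open>Coordinates decrease upwards, so the places with positive value form a
        down-set; a cover leaving it has a difference of at least one to spare.\<close>
      define W where "W = {i. i < 6 \<and> 1 \<le> coord i a}"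
      have sub: "W \<subseteq> {..<6}" by (auto simp: W_def)
      have a: "a \<in> first_coords 7" using aS unfolding S_iff by blast
      have "coord 6 a \<noteq> 0"
      proof
        assume 6: "coord 6 a = 0"
        have "coord 0 a = 0" "coord 1 a = 0" "coord 2 a = 0" "coord 3 a = 0" "coord 4 a = 0" "coord 5 a = 0"
          using 6 aS unfolding S_iff by linarith+
        then have "coord i a = 0" if "i < 7" for i
          using 6 that unfolding less_7 by (elim disjE) simp_all
        then show False using nz eq_0_if_coords[OF a] by blast
      qed
      then have t: "1 \<le> coord 6 a" using aS unfolding S_iff by linarith
      have d: "W \<in> down_sets 6 stack"
        using aS unfolding S_iff down_sets_def W_def stack_def less_6 by auto
      have "a - (exponent W + Poly_Mapping.single 6 1) \<in> ?S"
        using aS a t exponent_first_coords[OF sub] sublattice_diff[OF additive_coords, of a 7]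
        unfolding S_iff lookup_minus lookup_exponent_6[OF sub] by (simp add: W_def)
      then show ?thesis using d by blast
    qed
    show "\<forall>i\<in>?F. Modules.additive (stack_facet i)"
      by (simp add: Modules.additive_def stack_facet_simps lookup_add)
    show "\<forall>i\<in>?F. lvec (?s i) \<in> sublattice ?T \<and> stack_facet i (lvec (?s i)) = 0 \<and> (\<forall>j\<in>?F. j \<noteq> i \<longrightarrow> 0 < stack_facet j (lvec (?s i)))"
      by (simp only: ball_simps(5,7), simp add: stack_facet_simps nth_default_Cons_numeral lvec_first_coords)
    show "\<forall>i\<in>?I. lvec (?m i) \<in> sublattice ?T \<and> (\<forall>k\<in>?I. stack_facet k (lvec (?m i)) = (if k = i then 1 else 0))"
      by (simp only: ball_simps(5,7), simp add: stack_facet_simps nth_default_Cons_numeral lvec_first_coords)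
    show "a = 0" if "a \<in> sublattice ?T" "\<forall>i\<in>?I. stack_facet i a = 0" for a
    proof (rule eq_0_if_coords[OF that(1)])
      show "coord i a = 0" if "i < 7" for i
        using \<open>\<forall>i\<in>?I. stack_facet i a = 0\<close> that unfolding less_7 by (auto simp: stack_facet_simps)
    qed
  qed (simp_all add: nth_default_Cons_numeral lvec_first_coords stack_facet_simps additive_coords)
  then show ?thesis by (simp add: P)
qed

section \<open>Class group of the stable set polytope of the 3-sun\<close>

definition sun_facet :: "nat \<Rightarrow> (nat \<Rightarrow>\<^sub>0 int) \<Rightarrow> int" where
  "sun_facet i a = (let x = Poly_Mapping.lookup a in
    [x 0, x 1, x 2, x 3, x 4, x 5, x 6 - x 0 - x 2 - x 3, x 6 - x 0 - x 1 - x 4, x 6 - x 1 - x 2 - x 5, x 6 - x 0 - x 1 - x 2] ! i)"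

lemma sun_facet_simps:
  shows "sun_facet 0 a = coord 0 a"
  and "sun_facet (Suc 0) a = coord 1 a"
  and "sun_facet 2 a = coord 2 a"
  and "sun_facet 3 a = coord 3 a"
  and "sun_facet 4 a = coord 4 a"
  and "sun_facet 5 a = coord 5 a"
  and "sun_facet 6 a = coord 6 a - coord 0 a - coord 2 a - coord 3 a"
  and "sun_facet 7 a = coord 6 a - coord 0 a - coord 1 a - coord 4 a"
  and "sun_facet 8 a = coord 6 a - coord 1 a - coord 2 a - coord 5 a"
  and "sun_facet 9 a = coord 6 a - coord 0 a - coord 1 a - coord 2 a"
  by (simp_all add: sun_facet_def Let_def)

lemma stable_set_sun_iff:
  assumes "W \<subseteq> {..<6}"
  shows "stable_set 6 sun W \<longleftrightarrow> \<not> (0 \<in> W \<and> 1 \<in> W) \<and> \<not> (0 \<in> W \<and> 2 \<in> W) \<and> \<not> (1 \<in> W \<and> 2 \<in> W) \<and> \<not> (0 \<in> W \<and> 3 \<in> W)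
    \<and> \<not> (2 \<in> W \<and> 3 \<in> W) \<and> \<not> (0 \<in> W \<and> 4 \<in> W) \<and> \<not> (1 \<in> W \<and> 4 \<in> W) \<and> \<not> (1 \<in> W \<and> 5 \<in> W) \<and> \<not> (2 \<in> W \<and> 5 \<in> W)"
    (is "_ \<longleftrightarrow> ?r")
proof
  assume st: "stable_set 6 sun W"
  have no: "\<not> (u \<in> W \<and> v \<in> W)" if "{u, v} \<in> sun" for u v
    using st that unfolding stable_set_def by blast
  show ?r by (intro conjI no) (simp_all add: sun_def)
next
  assume r: ?r
  have "{u, v} \<notin> sun" if "u \<in> W" "v \<in> W" for u v
    using r that unfolding sun_def insert_iff empty_iff doubleton_eq_iff by metis
  then show "stable_set 6 sun W" using assms by (simp add: stable_set_def)
qed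

lemma sun_rank: "has_rank (class_group (toric_ring TYPE('k::field) (stable_set_polytope 6 sun))) 3"
proof -
  let ?W = "{W. stable_set 6 sun W}"
  have W6: "W \<subseteq> {..<6}" if "W \<in> ?W" for W using that by (simp add: stable_set_def)
  let ?F = "{0, 1, 2, 3, 4, 5, 6, 7, 8, 9} :: nat set" and ?I = "{0, 1, 2, 3, 4, 5, 9} :: nat set"
  let ?T = "coord ` {7..}"
  let ?S = "{a \<in> sublattice ?T. \<forall>i\<in>?F. 0 \<le> sun_facet i a}"
  \<comment> \<open>Each row changes one coordinate of the all-ones point of degree 4, except the
    last: raising a single inner vertex would also tighten outer cliques, so all three are raised
    together with the degree.\<close>
  let ?s = "\<lambda>i. [[0,1,1,1,1,1,4], [1,0,1,1,1,1,4], [1,1,0,1,1,1,4], [1,1,1,0,1,1,4], [1,1,1,1,0,1,4],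
    [1,1,1,1,1,0,4], [1,1,1,2,1,1,4], [1,1,1,1,2,1,4], [1,1,1,1,1,2,4], [2,2,2,1,1,1,6]] ! i :: int list"
  let ?m = "\<lambda>i. [[1,0,0,0,0,0,1], [0,1,0,0,0,0,1], [0,0,1,0,0,0,1], [0,0,0,1,0,0,0], [0,0,0,0,1,0,0],
    [0,0,0,0,0,1,0], [], [], [], [0,0,0,0,0,0,1]] ! i :: int list"
  have S_iff: "a \<in> ?S \<longleftrightarrow> a \<in> first_coords 7 \<and> 0 \<le> coord 0 a \<and> 0 \<le> coord 1 a \<and> 0 \<le> coord 2 a \<and> 0 \<le> coord 3 a \<and> 0 \<le> coord 4 a \<and> 0 \<le> coord 5 a \<and>
      coord 0 a + coord 2 a + coord 3 a \<le> coord 6 a \<and> coord 0 a + coord 1 a + coord 4 a \<le> coord 6 a \<and>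
      coord 1 a + coord 2 a + coord 5 a \<le> coord 6 a \<and> coord 0 a + coord 1 a + coord 2 a \<le> coord 6 a" for a
    by (auto simp add: sun_facet_simps)
  have "has_rank (class_group (toric_ring TYPE('k) (6, convex hull (ind ` ?W)))) 3"
  proof (rule class_group_rank_3[where T = ?T and F = ?F and \<sigma> = sun_facet and I = ?I and \<W> = ?W
        and s = ?s and m = ?m and e = "[1,1,1,1,1,1,4]"])
    show "lattice_points (6, convex hull (ind ` ?W)) = ind ` ?W"
      by (rule lattice_points_convex_hull[OF W6])
    show "convex hull (ind ` ?W) \<subseteq> real_space 6" by (rule real_space_convex_hull[OF W6])
    show "W \<subseteq> {..<6}" if "W \<in> ?W" for W using that by (rule W6)
    show "exponent W + Poly_Mapping.single 6 1 \<in> ?S" if W: "W \<in> ?W" for W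
    proof -
      have sub: "W \<subseteq> {..<6}" using W by (rule W6)
      have "6 \<notin> W" using sub by auto
      have st: "stable_set 6 sun W" using W by simp
      show ?thesis
        unfolding S_iff lookup_exponent_6[OF sub]
        using st[unfolded stable_set_sun_iff[OF sub]] \<open>6 \<notin> W\<close> exponent_first_coords[OF sub] by auto
    qed
    show "0 \<le> Poly_Mapping.lookup a 6" if "a \<in> ?S" for a
      using that unfolding S_iff by linarith
    show "\<exists>W\<in>?W. a - (exponent W + Poly_Mapping.single 6 1) \<in> ?S" if aS: "a \<in> ?S" and nz: "a \<noteq> 0" for a
    proof -
      have a: "a \<in> first_coords 7" using aS unfolding S_iff by blast
      have "coord 6 a \<noteq> 0"
      proof
        assume 6: "coord 6 a = 0"
        have "coord 0 a = 0" "coord 1 a = 0" "coord 2 a = 0" "coord 3 a = 0" "coord 4 a = 0" "coord 5 a = 0"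
          using 6 aS unfolding S_iff by linarith+
        then have "coord i a = 0" if "i < 7" for i
          using 6 that unfolding less_7 by (elim disjE) simp_all
        then show False using nz eq_0_if_coords[OF a] by blast
      qed
      then have t: "1 \<le> coord 6 a" using aS unfolding S_iff by linarith
      \<comment> \<open>A stable set within the support may be subtracted as soon as it meets every
        clique whose inequality is tight.\<close>
      have step: "?thesis" if sub: "W \<subseteq> {..<6}" and st: "stable_set 6 sun W" and supp: "\<And>i. i \<in> W \<Longrightarrow> 1 \<le> coord i a"
        and hit: "0 \<in> W \<or> 2 \<in> W \<or> 3 \<in> W \<or> coord 0 a + coord 2 a + coord 3 a < coord 6 a"
          "0 \<in> W \<or> 1 \<in> W \<or> 4 \<in> W \<or> coord 0 a + coord 1 a + coord 4 a < coord 6 a"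
          "1 \<in> W \<or> 2 \<in> W \<or> 5 \<in> W \<or> coord 1 a + coord 2 a + coord 5 a < coord 6 a"
          "0 \<in> W \<or> 1 \<in> W \<or> 2 \<in> W \<or> coord 0 a + coord 1 a + coord 2 a < coord 6 a" for W
      proof -
        have "6 \<notin> W" using sub by auto
        have "a - (exponent W + Poly_Mapping.single 6 1) \<in> ?S"
          using aS a t exponent_first_coords[OF sub] sublattice_diff[OF additive_coords, of a 7] hit \<open>6 \<notin> W\<close>
            supp[of 0] supp[of 1] supp[of 2] supp[of 3] supp[of 4] supp[of 5]
          unfolding S_iff lookup_minus lookup_exponent_6[OF sub] by (auto split: if_splits)
        then show ?thesis using st by blast
      qed
      have nonneg: "0 \<le> coord 0 a" "0 \<le> coord 1 a" "0 \<le> coord 2 a" "0 \<le> coord 3 a" "0 \<le> coord 4 a" "0 \<le> coord 5 a"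
        and clique: "coord 0 a + coord 1 a + coord 2 a \<le> coord 6 a"
        using aS unfolding S_iff by blast+
      consider "1 \<le> coord 0 a" | "1 \<le> coord 1 a" | "1 \<le> coord 2 a" | "coord 0 a = 0" "coord 1 a = 0" "coord 2 a = 0"
        using nonneg by linarith
      then show ?thesis
      proof cases
        \<comment> \<open>The inner vertex 0 meets every maximal clique except
          \<open>{1, 2, 5}\<close>. Vertex 5 is added if possible; if its coordinate is 0, the inner
          clique inequality makes that clique slack.\<close>
        case 1
        show ?thesis
        proof (cases "1 \<le> coord 5 a")
          case True
          show ?thesis by (rule step[of "{0, 5}"]) (use 1 True in \<open>auto simp: stable_set_sun_iff\<close>)
        next
          case False
          show ?thesis by (rule step[of "{0}"]) (use 1 False clique nonneg in \<open>auto simp: stable_set_sun_iff\<close>)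
        qed
      next
        case 2
        show ?thesis
        proof (cases "1 \<le> coord 3 a")
          case True
          show ?thesis by (rule step[of "{1, 3}"]) (use 2 True in \<open>auto simp: stable_set_sun_iff\<close>)
        next
          case False
          show ?thesis by (rule step[of "{1}"]) (use 2 False clique nonneg in \<open>auto simp: stable_set_sun_iff\<close>)
        qed
      next
        case 3
        show ?thesis
        proof (cases "1 \<le> coord 4 a")
          case True
          show ?thesis by (rule step[of "{2, 4}"]) (use 3 True in \<open>auto simp: stable_set_sun_iff\<close>)
        next
          case False
          show ?thesis by (rule step[of "{2}"]) (use 3 False clique nonneg in \<open>auto simp: stable_set_sun_iff\<close>)
        qed
      next
        case 4
        define W where "W = {i \<in> {3, 4, 5}. 1 \<le> coord i a}"
        have sub: "W \<subseteq> {..<6}" by (auto simp: W_def)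
        have st: "stable_set 6 sun W" unfolding stable_set_sun_iff[OF sub] by (simp add: W_def)
        show ?thesis
          by (rule step[OF sub st]) (use 4 t nonneg in \<open>auto simp: W_def\<close>)
      qed
    qed
    show "\<forall>i\<in>?F. Modules.additive (sun_facet i)"
      by (simp add: Modules.additive_def sun_facet_simps lookup_add)
    show "\<forall>i\<in>?F. lvec (?s i) \<in> sublattice ?T \<and> sun_facet i (lvec (?s i)) = 0 \<and> (\<forall>j\<in>?F. j \<noteq> i \<longrightarrow> 0 < sun_facet j (lvec (?s i)))"
      by (simp only: ball_simps(5,7), simp add: sun_facet_simps nth_default_Cons_numeral lvec_first_coords)
    show "\<forall>i\<in>?I. lvec (?m i) \<in> sublattice ?T \<and> (\<forall>k\<in>?I. sun_facet k (lvec (?m i)) = (if k = i then 1 else 0))"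
      by (simp only: ball_simps(5,7), simp add: sun_facet_simps nth_default_Cons_numeral lvec_first_coords)
    show "a = 0" if "a \<in> sublattice ?T" "\<forall>i\<in>?I. sun_facet i a = 0" for a
    proof (rule eq_0_if_coords[OF that(1)])
      show "coord i a = 0" if "i < 7" for i
        using \<open>\<forall>i\<in>?I. sun_facet i a = 0\<close> that unfolding less_7 by (auto simp: sun_facet_simps)
    qed
  qed (simp_all add: nth_default_Cons_numeral lvec_first_coords sun_facet_simps additive_coords)
  then show ?thesis by (simp add: stable_set_polytope_eq)
qed

section \<open>Class group of the edge polytope of the octahedron\<close>

definition octahedron_facet :: "nat \<Rightarrow> (nat \<Rightarrow>\<^sub>0 int) \<Rightarrow> int" where
  "octahedron_facet i a = (let x = Poly_Mapping.lookup a in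
    [x 0, x 1, x 2, x 3, x 4, x 5, x 6 - x 0 - x 1, x 6 - x 2 - x 3, x 6 - x 4 - x 5] ! i)"

lemma octahedron_facet_simps:
  shows "octahedron_facet 0 a = coord 0 a"
  and "octahedron_facet (Suc 0) a = coord 1 a"
  and "octahedron_facet 2 a = coord 2 a"
  and "octahedron_facet 3 a = coord 3 a"
  and "octahedron_facet 4 a = coord 4 a"
  and "octahedron_facet 5 a = coord 5 a"
  and "octahedron_facet 6 a = coord 6 a - coord 0 a - coord 1 a"
  and "octahedron_facet 7 a = coord 6 a - coord 2 a - coord 3 a"
  and "octahedron_facet 8 a = coord 6 a - coord 4 a - coord 5 a"
  by (simp_all add: octahedron_facet_def Let_def)

text \<open>All generators have coordinate sum twice the degree, so the edge polytope is not
  full-dimensional and this functional has to vanish on the lattice.\<close>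

definition edge_degree :: "(nat \<Rightarrow>\<^sub>0 int) \<Rightarrow> int" where
  "edge_degree a = (let x = Poly_Mapping.lookup a in x 0 + x 1 + x 2 + x 3 + x 4 + x 5 - 2 * x 6)"

lemma sublattice_edge_iff:
  "a \<in> sublattice (insert edge_degree (coord ` {7..})) \<longleftrightarrow> a \<in> first_coords 7 \<and>
    coord 0 a + coord 1 a + coord 2 a + coord 3 a + coord 4 a + coord 5 a = 2 * coord 6 a"
  by (auto simp: sublattice_def edge_degree_def Let_def)

lemma octahedron_rank: "has_rank (class_group (toric_ring TYPE('k::field) (edge_polytope 6 octahedron))) 3"
proof -
  have W6: "W \<subseteq> {..<6}" if "W \<in> octahedron" for W using that simple_graph_octahedron by (simp add: simple_graph_def)
  let ?F = "{0, 1, 2, 3, 4, 5, 6, 7, 8} :: nat set" and ?I = "{0, 1, 2, 4, 6, 7} :: nat set"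
  let ?T = "insert edge_degree (coord ` {7..})"
  let ?S = "{a \<in> sublattice ?T. \<forall>i\<in>?F. 0 \<le> octahedron_facet i a}"
  \<comment> \<open>The coordinate sum must stay twice the degree. For a coordinate facet, entry
    \<open>i\<close> of the all-ones vector becomes 0 and the others are doubled; the last three
    rows double one part.\<close>
  let ?s = "\<lambda>i. [[0,2,2,2,2,2,5], [2,0,2,2,2,2,5], [2,2,0,2,2,2,5], [2,2,2,0,2,2,5], [2,2,2,2,0,2,5],
    [2,2,2,2,2,0,5], [2,2,1,1,1,1,4], [1,1,2,2,1,1,4], [1,1,1,1,2,2,4]] ! i :: int list"
  \<comment> \<open>Facets 3, 5 and 8 are left out of \<open>?I\<close>: facets 6 and 7 recover the
    degree and coordinate 3, the degree relation coordinate 5. Rows 3 and 5 are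
    placeholders.\<close>
  let ?m = "\<lambda>i. [[1,0,0,1,0,0,1], [0,1,0,1,0,0,1], [0,0,1,-1,0,0,0], [], [0,0,0,0,1,-1,0], [],
    [0,0,0,1,0,1,1], [0,0,0,-1,0,1,0]] ! i :: int list"
  have S_iff: "a \<in> ?S \<longleftrightarrow> a \<in> first_coords 7 \<and> coord 0 a + coord 1 a + coord 2 a + coord 3 a + coord 4 a + coord 5 a = 2 * coord 6 a \<and>
      0 \<le> coord 0 a \<and> 0 \<le> coord 1 a \<and> 0 \<le> coord 2 a \<and> 0 \<le> coord 3 a \<and> 0 \<le> coord 4 a \<and> 0 \<le> coord 5 a \<and>
      coord 0 a + coord 1 a \<le> coord 6 a \<and> coord 2 a + coord 3 a \<le> coord 6 a \<and> coord 4 a + coord 5 a \<le> coord 6 a" for a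
    unfolding mem_Collect_eq sublattice_edge_iff by (auto simp add: octahedron_facet_simps)
  have T_add: "\<forall>\<tau>\<in>?T. Modules.additive \<tau>"
    by (simp add: Modules.additive_def edge_degree_def Let_def lookup_add)
  have "has_rank (class_group (toric_ring TYPE('k) (6, convex hull (ind ` octahedron)))) 3"
  proof (rule class_group_rank_3[where T = ?T and F = ?F and \<sigma> = octahedron_facet and I = ?I and \<W> = octahedron
        and s = ?s and m = ?m and e = "[1,1,1,1,1,1,3]"])
    show "lattice_points (6, convex hull (ind ` octahedron)) = ind ` octahedron"
      by (rule lattice_points_convex_hull[OF W6])
    show "convex hull (ind ` octahedron) \<subseteq> real_space 6" by (rule real_space_convex_hull[OF W6])
    show "W \<subseteq> {..<6}" if "W \<in> octahedron" for W using that by (rule W6)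
    have edges: "e \<in> {{0,2}, {0,3}, {0,4}, {0,5}, {1,2}, {1,3}, {1,4}, {1,5}, {2,4}, {2,5}, {3,4}, {3,5}}"
      if e: "e \<in> octahedron" for e
    proof -
      obtain i j where ij: "e = {i, j}" "i < 6" "j < 6" "i div 2 \<noteq> j div 2" using octahedronE[OF e] by metis
      show ?thesis using ij(4) ij(2,3)[unfolded less_6] unfolding ij(1) by (elim disjE) (simp_all add: insert_commute)
    qed
    show "exponent W + Poly_Mapping.single 6 1 \<in> ?S" if W: "W \<in> octahedron" for W
    proof -
      have sub: "W \<subseteq> {..<6}" using W by (rule W6)
      show ?thesis
        unfolding S_iff lookup_exponent_6[OF sub]
        using edges[OF W] exponent_first_coords[OF sub] by (elim insertE emptyE) simp_all
    qed
    show "0 \<le> Poly_Mapping.lookup a 6" if "a \<in> ?S" for a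
      using that unfolding S_iff by linarith
    show "\<exists>W\<in>octahedron. a - (exponent W + Poly_Mapping.single 6 1) \<in> ?S" if aS: "a \<in> ?S" and nz: "a \<noteq> 0" for a
    proof -
      have a: "a \<in> first_coords 7" using aS unfolding S_iff by blast
      note ineq = aS[unfolded S_iff]
      have "coord 6 a \<noteq> 0"
      proof
        assume 6: "coord 6 a = 0"
        have "coord 0 a = 0" "coord 1 a = 0" "coord 2 a = 0" "coord 3 a = 0" "coord 4 a = 0" "coord 5 a = 0"
          using 6 ineq by linarith+
        then have "coord i a = 0" if "i < 7" for i
          using 6 that unfolding less_7 by (elim disjE) simp_all
        then show False using nz eq_0_if_coords[OF a] by blast
      qed
      then have t: "1 \<le> coord 6 a" using ineq by linarith
      \<comment> \<open>An edge within the support may be subtracted if it meets every part whose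
        inequality is tight.\<close>
      have step: "?thesis" if ij: "i < 6" "j < 6" "i div 2 \<noteq> j div 2" "1 \<le> coord i a" "1 \<le> coord j a"
        and r: "\<And>p. p \<in> {0, 1, 2} \<Longrightarrow> p = i div 2 \<or> p = j div 2 \<or> coord (2 * p) a + coord (2 * p + 1) a < coord 6 a" for i j
      proof -
        have W: "{i, j} \<in> octahedron" using ij by (simp add: octahedron_iff)
        have sub: "{i, j} \<subseteq> {..<6}" using ij by simp
        have "a - (exponent {i, j} + Poly_Mapping.single 6 1) \<in> ?S"
          using ineq sublattice_diff[OF additive_coords a exponent_first_coords[OF sub]] ij(3-5)
            r[of 0] r[of 1] r[of 2] ij(1,2)[unfolded less_6]
          unfolding S_iff lookup_minus lookup_exponent_6[OF sub] by (elim disjE) simp_all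
        then show ?thesis using W by blast
      qed
      let ?A = "coord 0 a + coord 1 a" and ?B = "coord 2 a + coord 3 a" and ?C = "coord 4 a + coord 5 a"
      have pick: "1 \<le> coord i a \<or> 1 \<le> coord j a" if "1 \<le> coord i a + coord j a" for i j
        using that by linarith
      \<comment> \<open>The part sums add up to twice a positive degree and each is at most the
        degree. If all were tight they would add up to more, so one is slack; the other two are then
        positive, and an edge between them can be subtracted.\<close>
      consider "?A < coord 6 a" | "?B < coord 6 a" | "?C < coord 6 a"
        using ineq t by linarith
      then show ?thesis
      proof cases
        case 1
        have "1 \<le> coord 2 a \<or> 1 \<le> coord 3 a" "1 \<le> coord 4 a \<or> 1 \<le> coord 5 a"
          using 1 ineq by (intro pick; linarith)+
        then show ?thesis
          using 1 by (elim disjE) (rule step[of 2 4] step[of 2 5] step[of 3 4] step[of 3 5]; force)+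
      next
        case 2
        have "1 \<le> coord 0 a \<or> 1 \<le> coord 1 a" "1 \<le> coord 4 a \<or> 1 \<le> coord 5 a"
          using 2 ineq by (intro pick; linarith)+
        then show ?thesis
          using 2 by (elim disjE) (rule step[of 0 4] step[of 0 5] step[of 1 4] step[of 1 5]; force)+
      next
        case 3
        have "1 \<le> coord 0 a \<or> 1 \<le> coord 1 a" "1 \<le> coord 2 a \<or> 1 \<le> coord 3 a"
          using 3 ineq by (intro pick; linarith)+
        then show ?thesis
          using 3 by (elim disjE) (rule step[of 0 2] step[of 0 3] step[of 1 2] step[of 1 3]; force)+
      qed
    qed
    show "\<forall>i\<in>?F. Modules.additive (octahedron_facet i)"
      by (simp add: Modules.additive_def octahedron_facet_simps lookup_add)
    show "\<forall>i\<in>?F. lvec (?s i) \<in> sublattice ?T \<and> octahedron_facet i (lvec (?s i)) = 0 \<and> (\<forall>j\<in>?F. j \<noteq> i \<longrightarrow> 0 < octahedron_facet j (lvec (?s i)))"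
      by (simp only: ball_simps(5,7), simp add: octahedron_facet_simps nth_default_Cons_numeral lvec_first_coords edge_degree_def Let_def sublattice_edge_iff)
    show "\<forall>i\<in>?I. lvec (?m i) \<in> sublattice ?T \<and> (\<forall>k\<in>?I. octahedron_facet k (lvec (?m i)) = (if k = i then 1 else 0))"
      by (simp only: ball_simps(5,7), simp add: octahedron_facet_simps nth_default_Cons_numeral lvec_first_coords edge_degree_def Let_def sublattice_edge_iff)
    show "a = 0" if "a \<in> sublattice ?T" "\<forall>i\<in>?I. octahedron_facet i a = 0" for a
    proof (rule eq_0_if_coords)
      show "a \<in> first_coords 7" using that(1) unfolding sublattice_edge_iff by blast
      have "coord 0 a + coord 1 a + coord 2 a + coord 3 a + coord 4 a + coord 5 a = 2 * coord 6 a"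
        using that(1) unfolding sublattice_edge_iff by blast
      then show "coord i a = 0" if "i < 7" for i
        using \<open>\<forall>i\<in>?I. octahedron_facet i a = 0\<close> that unfolding less_7 by (auto simp: octahedron_facet_simps)
    qed
    show "lvec [1,1,1,1,1,1,3] \<in> sublattice ?T"
      unfolding sublattice_edge_iff by (simp add: nth_default_def lvec_first_coords)
    show "\<forall>\<tau>\<in>?T. Modules.additive \<tau>" by (rule T_add)
  qed (simp_all add: octahedron_facet_simps nth_default_Cons_numeral)
  then show ?thesis by (simp add: edge_polytope_eq[OF simple_graph_octahedron])
qed

section \<open>The three families\<close>

lemma finite_down_set: "\<forall>W\<in>down_sets d r. finite W"
  by (auto simp: down_sets_def intro: finite_subset[OF _ finite_lessThan[of d]])

lemma finite_stable_set: "\<forall>W\<in>{W. stable_set d E W}. finite W"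
  by (auto simp: stable_set_def intro: finite_subset[OF _ finite_lessThan[of d]])

lemma finite_edge: "simple_graph d E \<Longrightarrow> \<forall>W\<in>E. finite W"
  by (auto simp: simple_graph_def intro: finite_subset[OF _ finite_lessThan[of d]])

lemma lattice_polytope_stable_set_polytope: "lattice_polytope (stable_set_polytope d E)"
  unfolding stable_set_polytope_eq by (rule lattice_polytope_convex_hull) (simp add: stable_set_def)

lemma lattice_polytope_edge_polytope: "simple_graph d E \<Longrightarrow> lattice_polytope (edge_polytope d E)"
  unfolding edge_polytope_eq by (rule lattice_polytope_convex_hull) (simp add: simple_graph_def)

lemma partial_order_stack: "partial_order_on {..<6} stack"
  unfolding partial_order_on_def preorder_on_def
  by (intro conjI refl_onI transI antisymI) (auto simp: stack_def)

theorem mainTheorem9: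
  shows "\<not> Order_classes TYPE('k::field) 3 \<subseteq> Stab_classes TYPE('k) 3 \<and>
    \<not> Order_classes TYPE('k) 3 \<subseteq> Edge_classes TYPE('k) 3 \<and>
    \<not> Stab_classes TYPE('k) 3 \<subseteq> Order_classes TYPE('k) 3 \<and>
    \<not> Stab_classes TYPE('k) 3 \<subseteq> Edge_classes TYPE('k) 3 \<and>
    \<not> Edge_classes TYPE('k) 3 \<subseteq> Order_classes TYPE('k) 3 \<and>
    \<not> Edge_classes TYPE('k) 3 \<subseteq> Stab_classes TYPE('k) 3"
proof -
  let ?O = "unimodular_class (order_polytope 6 stack)"
  let ?S = "unimodular_class (stable_set_polytope 6 sun)"
  let ?E = "unimodular_class (edge_polytope 6 octahedron)"
  have O: "?O \<in> Order_classes TYPE('k) 3"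
    unfolding Order_classes_def using partial_order_stack stack_rank by blast
  have S: "?S \<in> Stab_classes TYPE('k) 3"
    unfolding Stab_classes_def using perfect_graph_sun sun_rank by blast
  have E: "?E \<in> Edge_classes TYPE('k) 3"
    unfolding Edge_classes_def
    using simple_graph_octahedron odd_cycle_condition_octahedron octahedron_rank by blast
  have equiv: "sum_equiv A B" if eq: "unimodular_class P = unimodular_class Q" and Q: "lattice_polytope Q"
    and "lattice_points P = ind ` A" "\<forall>W\<in>A. finite W" "lattice_points Q = ind ` B" "\<forall>W\<in>B. finite W" for P Q A B
    using unimodularly_equivalent_sum_equiv[OF unimodular_class_eqD[OF eq Q], of A B] that(3-) by blast
  note order = lattice_points_order_polytope finite_down_set
  note stab = lattice_points_stable_set_polytope finite_stable_set
  note edge = lattice_points_edge_polytope finite_edge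
  note edgeO = edge[OF simple_graph_octahedron]
  note latS = lattice_polytope_stable_set_polytope
  note latE = lattice_polytope_edge_polytope
  show ?thesis
  proof (intro conjI notI)
    assume "Order_classes TYPE('k) 3 \<subseteq> Stab_classes TYPE('k) 3"
    then obtain d E' where eq: "?O = unimodular_class (stable_set_polytope d E')"
      using O unfolding Stab_classes_def by blast
    show False
      by (rule stack_not_stable[OF equiv[OF eq latS order stab]])
  next
    assume "Order_classes TYPE('k) 3 \<subseteq> Edge_classes TYPE('k) 3"
    then obtain d E' where g: "simple_graph d E'" and eq: "?O = unimodular_class (edge_polytope d E')"
      using O unfolding Edge_classes_def by blast
    show False
      by (rule stack_not_edge[OF equiv[OF eq latE[OF g] order edge[OF g]] g])
  next
    assume "Stab_classes TYPE('k) 3 \<subseteq> Order_classes TYPE('k) 3"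
    then obtain d r where eq: "?S = unimodular_class (order_polytope d r)"
      using S unfolding Order_classes_def by blast
    show False
      by (rule sun_not_order[OF sum_equiv_sym[OF equiv[OF eq[symmetric] latS order stab]]])
  next
    assume "Stab_classes TYPE('k) 3 \<subseteq> Edge_classes TYPE('k) 3"
    then obtain d E' where g: "simple_graph d E'" and eq: "?S = unimodular_class (edge_polytope d E')"
      using S unfolding Edge_classes_def by blast
    show False
      by (rule sun_not_edge[OF equiv[OF eq latE[OF g] stab edge[OF g]] g])
  next
    assume "Edge_classes TYPE('k) 3 \<subseteq> Order_classes TYPE('k) 3"
    then obtain d r where eq: "?E = unimodular_class (order_polytope d r)"
      using E unfolding Order_classes_def by blast
    show False
      by (rule octahedron_not_order[OF sum_equiv_sym[OF equiv[OF eq[symmetric]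
        latE[OF simple_graph_octahedron] order edgeO]]])
  next
    assume "Edge_classes TYPE('k) 3 \<subseteq> Stab_classes TYPE('k) 3"
    then obtain d E' where eq: "?E = unimodular_class (stable_set_polytope d E')"
      using E unfolding Stab_classes_def by blast
    show False
      by (rule octahedron_not_stable[OF equiv[OF eq latS edgeO stab]])
  qed
qed

end
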